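(* Let $\Omega$ be the set of infinite Young tableaux with its $\sigma$-algebra $\mathcal F$, $\mathsf P$ the Plancherel measure on $(\Omega,\mathcal F)$, and $J:\Omega\to\Omega$ the jeu de taquin map. The dynamical system $(\Omega,\mathcal F,\mathsf P,J)$ is measure-preserving and ergodic.
   Context: A box $(i,j)\in\mathbb N^2$ ($\mathbb N=\{1,2,\ldots\}$) lies in column $i$ and row $j$. A Young diagram $\lambda$ of size $n$ is a partition $\lambda(1)\ge\cdots\ge\lambda(k)>0$ of $n$, identified with the set of boxes $\{(i,j):1\le j\le k,\ 1\le i\le\lambda(j)\}$. Write $\lambda\nearrow\nu$ if $\nu$ is obtained from $\lambda$ by adding one box. $f^\lambda$ is the number of standard Young tableaux of shape $\lambda$. An infinite Young tableau is an array $t=(t_{i,j})_{i,j=1}^\infty$ of natural numbers in which each natural number appears exactly once and which is increasing in $i$ and in $j$. $\Omega$ is the set of all of them, with $\mathcal F$ the smallest $\sigma$-algebra making all coordinate functions $t\mapsto t_{i,j}$ measurable. An infinite path $\varnothing=\lambda_0\nearrow\lambda_1\nearrow\cdots$ that eventually includes every box of $\mathbb N^2$ corresponds bijectively to an infinite tableau $t$ (its recording tableau), via $\lambda_n=\{(i,j):t_{i,j}\le n\}$. The Plancherel growth process is the Markov chain $\varnothing=\Lambda_0\nearrow\Lambda_1\nearrow\cdots$ with transition probabilities $\mathrm{Prob}(\Lambda_{n+1}=\nu\mid\Lambda_n=\lambda)=\frac{f^\nu}{(n+1)f^\lambda}$ if $\lambda\nearrow\nu$ (and $0$ otherwise), $\lambda$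 of size $n$. It almost surely eventually includes every box, and the Plancherel measure $\mathsf P$ on $(\Omega,\mathcal F)$ is the law of its recording tableau. The jeu de taquin path of $t\in\Omega$ is defined by $\mathbf p_1=(1,1)$ and, if $\mathbf p_{k-1}=(i,j)$, then $\mathbf p_k=(i+1,j)$ if $t_{i+1,j}<t_{i,j+1}$ and $\mathbf p_k=(i,j+1)$ if $t_{i+1,j}>t_{i,j+1}$. The jeu de taquin map $J:\Omega\to\Omega$ sends $t$ to $s=J(t)$ given by $s_{i,j}=t_{\mathbf p_{k+1}}-1$ if $(i,j)=\mathbf p_k$ for some $k$, and $s_{i,j}=t_{i,j}-1$ otherwise. *)

theory Defs
  imports "HOL-Probability.Probability"
begin

type_synonym box = "nat \<times> nat"

text \<open>A box \<open>(i, j)\<close> lies in column \<open>i\<close> and row \<open>j\<close>; both coordinates start at 1.\<close>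

definition boxes :: "box set" where
  "boxes = {1..} \<times> {1..}"


section \<open>Young diagrams and standard Young tableaux\<close>

definition partitions :: "nat \<Rightarrow> nat list set" where
  "partitions n = {p. sorted_wrt (\<ge>) p \<and> (\<forall>x\<in>set p. x > 0) \<and> sum_list p = n}"

text \<open>Lists are indexed from 0, so the length of row \<open>j\<close> is \<open>p ! (j - 1)\<close>.\<close>

definition diagram :: "nat list \<Rightarrow> box set" where
  "diagram p = {(i, j). 1 \<le> j \<and> j \<le> length p \<and> 1 \<le> i \<and> i \<le> p ! (j - 1)}"

definition young_diagrams :: "nat \<Rightarrow> box set set" where
  "young_diagrams n = diagram ` partitions n"

definition adds_box :: "box set \<Rightarrow> box set \<Rightarrow> bool" (infix "\<nearrow>" 50) where
  "\<mu> \<nearrow> \<nu> \<longleftrightarrow> (\<exists>b. b \<notin> \<mu> \<and> \<nu> = insert b \<mu>)"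

definition increasing_on :: "box set \<Rightarrow> (box \<Rightarrow> nat) \<Rightarrow> bool" where
  "increasing_on B t \<longleftrightarrow>
     (\<forall>i j. (i, j) \<in> B \<longrightarrow> (Suc i, j) \<in> B \<longrightarrow> t (i, j) < t (Suc i, j)) \<and>
     (\<forall>i j. (i, j) \<in> B \<longrightarrow> (i, Suc j) \<in> B \<longrightarrow> t (i, j) < t (i, Suc j))"

definition standard_tableaux :: "box set \<Rightarrow> (box \<Rightarrow> nat) set" where
  "standard_tableaux \<mu> =
     {t \<in> extensional \<mu>. bij_betw t \<mu> {1..card \<mu>} \<and> increasing_on \<mu> t}"

definition num_syt :: "box set \<Rightarrow> nat" where
  "num_syt \<mu> = card (standard_tableaux \<mu>)"


section \<open>Infinite Young tableaux\<close>

definition infinite_tableaux :: "(box \<Rightarrow> nat) set" where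
  "infinite_tableaux =
     {t \<in> extensional boxes. bij_betw t boxes {1..} \<and> increasing_on boxes t}"

text \<open>
  The smallest \<open>\<sigma>\<close>-algebra making all coordinate functions measurable.  Here it is carried by
  a measure that is identically zero; only the underlying measurable space is used.
\<close>

definition tableau_space :: "(box \<Rightarrow> nat) measure" where
  "tableau_space =
     sigma infinite_tableaux {{t \<in> infinite_tableaux. t b \<in> A} | b A. b \<in> boxes}"


section \<open>The Plancherel growth process and the Plancherel measure\<close>

definition plancherel_transition :: "nat \<Rightarrow> box set \<Rightarrow> box set measure" where
  "plancherel_transition n \<mu> =
     point_measure (young_diagrams (Suc n))
       (\<lambda>\<nu>. if \<mu> \<nearrow> \<nu> then ennreal (real (num_syt \<nu>) / (real (n + 1) * real (num_syt \<mu>))) else 0)"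

text \<open>
  The conditional law of the diagram at time \<open>n\<close>, given the path \<open>\<omega>\<close> at times before \<open>n\<close>.
\<close>

primrec plancherel_kernel :: "nat \<Rightarrow> (nat \<Rightarrow> box set) \<Rightarrow> box set measure" where
  "plancherel_kernel 0 \<omega> = return (count_space (young_diagrams 0)) {}"
| "plancherel_kernel (Suc n) \<omega> = plancherel_transition n (\<omega> n)"

text \<open>
  The law, on sequences of diagrams, of the Markov chain with these transition probabilities:
  the Ionescu-Tulcea extension, i.e. the projective limit of the finite-dimensional laws
  generated by the kernels.  (The constants of both locales are used in their exported form.)
\<close>

definition plancherel_growth :: "(nat \<Rightarrow> box set) measure" where
  "plancherel_growth =
     (let M = (\<lambda>n. count_space (young_diagrams n))
      in projective_family.lim UNIV (Ionescu_Tulcea.CI plancherel_kernel M) M)"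

definition exhausting_paths :: "(nat \<Rightarrow> box set) set" where
  "exhausting_paths =
     {\<Lambda>. \<Lambda> 0 = {} \<and> (\<forall>n. \<Lambda> n \<in> young_diagrams n \<and> \<Lambda> n \<nearrow> \<Lambda> (Suc n)) \<and> (\<forall>b\<in>boxes. \<exists>n. b \<in> \<Lambda> n)}"

text \<open>
  On exhausting paths this is the unique \<open>t \<in> infinite_tableaux\<close> such that
  \<open>\<Lambda> n = {b \<in> boxes. t b \<le> n}\<close> for all \<open>n\<close>.
\<close>

definition recording_tableau :: "(nat \<Rightarrow> box set) \<Rightarrow> box \<Rightarrow> nat" where
  "recording_tableau \<Lambda> = (\<lambda>b\<in>boxes. LEAST n. b \<in> \<Lambda> n)"

text \<open>
  The recording tableau is defined only on exhausting paths, which form a set of full measure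
  for the growth process; hence the restriction loses no mass.
\<close>

definition plancherel_measure :: "(box \<Rightarrow> nat) measure" where
  "plancherel_measure =
     distr (restrict_space plancherel_growth exhausting_paths) tableau_space recording_tableau"


section \<open>Jeu de taquin\<close>

definition jdt_step :: "(box \<Rightarrow> nat) \<Rightarrow> box \<Rightarrow> box" where
  "jdt_step t = (\<lambda>(i, j). if t (i + 1, j) < t (i, j + 1) then (i + 1, j) else (i, j + 1))"

text \<open>The path is indexed from 0 here: \<open>jdt_path t k\<close> is the \<open>(k + 1)\<close>-st box of the path.\<close>

primrec jdt_path :: "(box \<Rightarrow> nat) \<Rightarrow> nat \<Rightarrow> box" where
  "jdt_path t 0 = (1, 1)"
| "jdt_path t (Suc k) = jdt_step t (jdt_path t k)"

text \<open>If \<open>b\<close> is the \<open>k\<close>-th box of the path, then \<open>jdt_step t b\<close> is by definition the next one.\<close>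

definition jeu_de_taquin :: "(box \<Rightarrow> nat) \<Rightarrow> box \<Rightarrow> nat" where
  "jeu_de_taquin t =
     (\<lambda>b\<in>boxes. if b \<in> range (jdt_path t) then t (jdt_step t b) - 1 else t b - 1)"


section \<open>Measure-preserving and ergodic dynamical systems\<close>

definition measure_preserving_system :: "'a measure \<Rightarrow> ('a \<Rightarrow> 'a) \<Rightarrow> bool" where
  "measure_preserving_system M T \<longleftrightarrow>
     prob_space M \<and> T \<in> measurable M M \<and>
     (\<forall>A\<in>sets M. emeasure M (T -` A \<inter> space M) = emeasure M A)"

definition ergodic_system :: "'a measure \<Rightarrow> ('a \<Rightarrow> 'a) \<Rightarrow> bool" where
  "ergodic_system M T \<longleftrightarrow>
     measure_preserving_system M T \<and>
     (\<forall>A\<in>sets M. T -` A \<inter> space M = A \<longrightarrow> emeasure M A = 0 \<or> emeasure M A = 1)"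

end

theory Submission
  imports Defs
begin

text \<open>
  In terms of words, the Plancherel measure is the law of the recording tableau of an infinite
  word of independent letters, and the jeu de taquin map deletes the first letter of the word.  The
  system is then a factor of a Bernoulli shift.  The proof below keeps the consequence of this picture that
  matters, the independence of consecutive blocks, but proves it by a finite count, without
  words and without the Robinson-Schensted correspondence.

  A standard tableau is encoded as the list of boxes in the order of their entries, and the jeu de
  taquin map acts on such lists (\<open>promote\<close>).  The operation \<open>insert_at p\<close> is the trace of inserting a
  new largest letter into a word at position \<open>p\<close>.  Two facts about it carry everything.  It is a
  bijection (\<open>bij_insertion\<close>): a path of length \<open>n\<close> together with one of \<open>n + 1\<close> positions is the
  same as a path of length \<open>n + 1\<close> together with a diagram obtained by removing one corner
  from its final shape.  And it commutes with the jeu de taquin map (\<open>promote_insert_at_0\<close>,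
  \<open>promote_insert_at_Suc\<close>), as deleting the first letter and inserting a largest one should.

  Let \<open>weight U\<close> be the number of standard tableaux of the shape of \<open>U\<close>, divided by the factorial of
  its size.  Removing the largest letter gives a recursion of Pascal type, from which the
  weights of all paths \<open>U\<close> that begin with \<open>S\<close> (of length \<open>m\<close>) and are sent to \<open>T\<close> by the \<open>m\<close>-th
  iterate of the jeu de taquin map add up to \<open>weight S * weight T\<close> (\<open>sum_weight_products\<close>).

  This identity, or the count \<open>sum_products\<close> behind it, is used four times.  It
  shows that the transition probabilities of the growth process add up to one, so that the process exists and starts with the path \<open>U\<close> with
  probability \<open>weight U\<close>.  It shows that the process reaches every box: the blocks of a
  fixed length are independent, and sooner or later one of them fills a whole rectangle
  (\<open>weight_missing_shape\<close>).  For \<open>m = 1\<close> it says that the Plancherel measure is invariant.  And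
  for general \<open>m\<close> it says that the \<open>m\<close>-th iterate of the jeu de taquin map is independent of the first \<open>m\<close>
  boxes (\<open>emeasure_cylinder_Int_vimage\<close>).  An invariant event is therefore independent of all
  cylinders, hence of itself, and has probability zero or one.
\<close>

section \<open>Young diagrams and addable boxes\<close>

definition young :: "box set \<Rightarrow> bool" where
  "young D \<longleftrightarrow> finite D \<and> D \<subseteq> boxes \<and>
     (\<forall>i j k l. (i, j) \<in> D \<longrightarrow> 1 \<le> k \<longrightarrow> k \<le> i \<longrightarrow> 1 \<le> l \<longrightarrow> l \<le> j \<longrightarrow> (k, l) \<in> D)"

definition addable :: "box set \<Rightarrow> box \<Rightarrow> bool" where
  "addable D b \<longleftrightarrow> young D \<and> b \<notin> D \<and> young (insert b D)"

lemma young_empty [simp]: "young {}"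
  by (simp add: young_def)

lemma youngI:
  assumes "finite D" "D \<subseteq> boxes"
    and "\<And>i j k l. (i, j) \<in> D \<Longrightarrow> 1 \<le> k \<Longrightarrow> k \<le> i \<Longrightarrow> 1 \<le> l \<Longrightarrow> l \<le> j \<Longrightarrow> (k, l) \<in> D"
  shows "young D"
  unfolding young_def using assms by blast

lemma youngD: "young D \<Longrightarrow> (i, j) \<in> D \<Longrightarrow> 1 \<le> k \<Longrightarrow> k \<le> i \<Longrightarrow> 1 \<le> l \<Longrightarrow> l \<le> j \<Longrightarrow> (k, l) \<in> D"
  unfolding young_def by blast

lemma young_pos: "young D \<Longrightarrow> (i, j) \<in> D \<Longrightarrow> 1 \<le> i \<and> 1 \<le> j"
  unfolding young_def boxes_def by auto

lemma young_subset: "young D \<Longrightarrow> D \<subseteq> boxes"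
  by (simp add: young_def)

lemma young_finite: "young D \<Longrightarrow> finite D"
  by (simp add: young_def)

text \<open>
  Locally, a box can be added as soon as its left and its lower neighbour, where they exist,
  are already there.  All later case distinctions about relative positions of boxes are
  reduced to this criterion.
\<close>

lemma addable_iff:
  "addable D (x, y) \<longleftrightarrow> young D \<and> 1 \<le> x \<and> 1 \<le> y \<and> (x, y) \<notin> D \<and>
     (x = 1 \<or> (x - 1, y) \<in> D) \<and> (y = 1 \<or> (x, y - 1) \<in> D)"
proof
  assume a: "addable D (x, y)"
  then have Y: "young D" "young (insert (x, y) D)" "(x, y) \<notin> D" by (auto simp: addable_def)
  have p: "1 \<le> x \<and> 1 \<le> y" using young_pos[OF Y(2)] by blast
  have "x = 1 \<or> (x - 1, y) \<in> insert (x, y) D"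
    using p youngD[OF Y(2), of x y "x - 1" y] by (cases "x = 1") auto
  moreover have "y = 1 \<or> (x, y - 1) \<in> insert (x, y) D"
    using p youngD[OF Y(2), of x y x "y - 1"] by (cases "y = 1") auto
  ultimately show "young D \<and> 1 \<le> x \<and> 1 \<le> y \<and> (x, y) \<notin> D \<and>
     (x = 1 \<or> (x - 1, y) \<in> D) \<and> (y = 1 \<or> (x, y - 1) \<in> D)"
    using Y p by (auto simp: diff_eq_eq)
next
  assume a: "young D \<and> 1 \<le> x \<and> 1 \<le> y \<and> (x, y) \<notin> D \<and>
     (x = 1 \<or> (x - 1, y) \<in> D) \<and> (y = 1 \<or> (x, y - 1) \<in> D)"
  have "(k, l) \<in> insert (x, y) D"
    if "(i, j) \<in> insert (x, y) D" "1 \<le> k" "k \<le> i" "1 \<le> l" "l \<le> j" for i j k l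
  proof (cases "(i, j) \<in> D")
    case True
    then show ?thesis using that a youngD[of D i j k l] by blast
  next
    case False
    then have ij: "i = x" "j = y" using that by auto
    then have "k = x \<and> l = y \<or> k < x \<or> l < y" using that by auto
    then consider "k = x" "l = y" | "k < x" | "l < y" by blast
    then show ?thesis
    proof cases
      case 2
      then have "(x - 1, y) \<in> D" using a that by auto
      then show ?thesis using youngD[of D "x - 1" y k l] a that ij 2 by auto
    next
      case 3
      then have "(x, y - 1) \<in> D" using a that by auto
      then show ?thesis using youngD[of D x "y - 1" k l] a that ij 3 by auto
    qed auto
  qed
  then show "addable D (x, y)"
    using a unfolding addable_def young_def boxes_def by auto
qed

lemma addable_young: "addable D b \<Longrightarrow> young D"
  and addable_young_insert: "addable D b \<Longrightarrow> young (insert b D)"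
  and addable_notin: "addable D b \<Longrightarrow> b \<notin> D"
  by (auto simp: addable_def)

lemma addable_leftmost:
  assumes "addable D (x, y)" "(z, y) \<notin> D" "1 \<le> z"
  shows "x \<le> z"
proof (rule ccontr)
  assume "\<not> x \<le> z"
  then have "z \<le> x - 1" "(x - 1, y) \<in> D" using assms by (auto simp: addable_iff)
  then show False using assms youngD[of D "x - 1" y z y] by (auto simp: addable_iff)
qed

lemma addable_lowest:
  assumes "addable D (x, y)" "(x, z) \<notin> D" "1 \<le> z"
  shows "y \<le> z"
proof (rule ccontr)
  assume "\<not> y \<le> z"
  then have "z \<le> y - 1" "(x, y - 1) \<in> D" using assms by (auto simp: addable_iff)
  then show False using assms youngD[of D x "y - 1" x z] by (auto simp: addable_iff)
qed

lemma addable_same_col: "addable D (x, y) \<Longrightarrow> addable D (x, y') \<Longrightarrow> y = y'"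
  using addable_lowest[of D x y y'] addable_lowest[of D x y' y] by (auto simp: addable_iff)

lemma addable_insert: "addable D b \<Longrightarrow> addable D c \<Longrightarrow> b \<noteq> c \<Longrightarrow> addable (insert c D) b"
  by (cases b) (auto simp: addable_iff addable_young_insert)

text \<open>
  The neighbours of \<open>d\<close> that can be filled only after \<open>d\<close>, hence the two possible
  continuations of a jeu de taquin path through \<open>d\<close>.
\<close>

definition adj :: "box \<Rightarrow> box \<Rightarrow> bool" where
  "adj d b \<longleftrightarrow> b = (fst d + 1, snd d) \<or> b = (fst d, snd d + 1)"

lemma not_adj: "addable D b \<Longrightarrow> addable E d \<Longrightarrow> d \<notin> D \<Longrightarrow> \<not> adj d b"
  by (cases b; cases d) (auto simp: addable_iff adj_def)

text \<open>
  The order in which \<open>d\<close> and then \<open>b\<close> are added may be reversed unless \<open>b\<close> leans on \<open>d\<close>.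
\<close>

lemma addable_remove: "addable (insert d D) b \<Longrightarrow> addable D d \<Longrightarrow> \<not> adj d b \<Longrightarrow> addable D b"
  by (cases b; cases d) (auto simp: addable_iff adj_def)

text \<open>
  The first free box of row \<open>y\<close>, the only candidate for an addable box in that row.
\<close>

definition next_box :: "box set \<Rightarrow> nat \<Rightarrow> box" where
  "next_box D y = ((LEAST x. 1 \<le> x \<and> (x, y) \<notin> D), y)"

lemma snd_next_box [simp]: "snd (next_box D y) = y"
  by (simp add: next_box_def)

lemma next_box_eq: "addable D (x, y) \<Longrightarrow> next_box D y = (x, y)"
proof -
  assume a: "addable D (x, y)"
  have "(LEAST x. 1 \<le> x \<and> (x, y) \<notin> D) = x"
  proof (rule Least_equality)
    show "1 \<le> x \<and> (x, y) \<notin> D" using a by (simp add: addable_iff)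
    show "x \<le> z" if "1 \<le> z \<and> (z, y) \<notin> D" for z
      using a that addable_leftmost by blast
  qed
  then show ?thesis by (simp add: next_box_def)
qed

lemma row_finite: "young D \<Longrightarrow> \<exists>x. 1 \<le> x \<and> (x, y) \<notin> D"
proof (rule ccontr)
  assume D: "young D" "\<nexists>x. 1 \<le> x \<and> (x, y) \<notin> D"
  then have "(\<lambda>x. (x, y)) ` {1..} \<subseteq> D" by auto
  moreover have "infinite ((\<lambda>x. (x, y)) ` {1::nat..})"
    using infinite_Ici[of "1::nat"] by (subst finite_image_iff) (auto simp: inj_on_def)
  ultimately show False using D young_finite finite_subset by blast
qed

lemma addable_next_box:
  assumes D: "young D" and y: "1 \<le> y"
    and below: "y = 1 \<or> (\<exists>x. (x, y - 1) \<in> D \<and> (x, y) \<notin> D)"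
  shows "addable D (next_box D y)"
proof -
  let ?P = "\<lambda>x. 1 \<le> x \<and> (x, y) \<notin> D"
  define x where "x = (LEAST x. ?P x)"
  have P: "?P x" unfolding x_def using row_finite[OF D] by (rule LeastI_ex)
  have min: "x \<le> z" if "?P z" for z unfolding x_def by (rule Least_le) (use that in auto)
  have "x = 1 \<or> (x - 1, y) \<in> D"
  proof (rule ccontr)
    assume "\<not> (x = 1 \<or> (x - 1, y) \<in> D)"
    then have "x \<le> x - 1" using P by (intro min) auto
    then show False using P by auto
  qed
  moreover have "y = 1 \<or> (x, y - 1) \<in> D"
  proof (cases "y = 1")
    case False
    then obtain z where z: "(z, y - 1) \<in> D" "(z, y) \<notin> D" using below by auto
    have "x \<le> z" using z young_pos[OF D z(1)] by (intro min) auto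
    then show ?thesis using youngD[OF D z(1), of x "y - 1"] P y False by auto
  qed simp
  moreover have "next_box D y = (x, y)"
    by (simp add: next_box_def x_def)
  ultimately show ?thesis
    using D P y by (simp add: addable_iff)
qed

lemma addable_next_box_first: "young D \<Longrightarrow> addable D (next_box D 1)"
  by (rule addable_next_box) auto

text \<open>
  A freshly added box leaves its row longer than the row above, so a box that is pushed out of
  it finds room in the next row, no further to the right.
\<close>

lemma bumped_box:
  assumes c: "addable D (x, y)"
  obtains z where "next_box (insert (x, y) D) (Suc y) = (z, Suc y)" "z \<le> x"
    "addable (insert (x, y) D) (z, Suc y)"
proof -
  let ?D = "insert (x, y) D"
  have notin: "(x, Suc y) \<notin> ?D"
    using c youngD[of D x "Suc y" x y] by (auto simp: addable_iff)
  have a: "addable ?D (next_box ?D (Suc y))"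
    by (rule addable_next_box) (use c notin in \<open>auto simp: addable_def\<close>)
  obtain z where z: "next_box ?D (Suc y) = (z, Suc y)" by (simp add: next_box_def)
  have "z \<le> x"
    using addable_leftmost[of ?D z "Suc y" x] a notin c unfolding z by (auto simp: addable_iff)
  then show thesis using that z a by simp
qed

section \<open>Growth paths\<close>

text \<open>
  A standard tableau is represented by the list of its boxes in the order of their entries:
  \<open>grows D bs\<close> says that adding the boxes \<open>bs\<close> to \<open>D\<close> one after the other gives a Young
  diagram at every step.  Starting from a nonempty \<open>D\<close> allows inductions that peel off the
  first box.
\<close>

fun grows :: "box set \<Rightarrow> box list \<Rightarrow> bool" where
  "grows D [] \<longleftrightarrow> young D"
| "grows D (b # bs) \<longleftrightarrow> addable D b \<and> grows (insert b D) bs"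

lemma grows_young: "grows D bs \<Longrightarrow> young D"
  by (cases bs) (auto simp: addable_def)

lemma grows_append: "grows D (as @ bs) \<longleftrightarrow> grows D as \<and> grows (D \<union> set as) bs"
proof (induction as arbitrary: D)
  case Nil
  then show ?case using grows_young by auto
qed auto

lemma grows_snoc: "grows D (bs @ [b]) \<longleftrightarrow> grows D bs \<and> addable (D \<union> set bs) b"
  by (auto simp: grows_append addable_def)

lemma grows_young_union: "grows D bs \<Longrightarrow> young (D \<union> set bs)"
  using grows_append[of D bs "[]"] by simp

lemma grows_take: "grows D bs \<Longrightarrow> grows D (take n bs)"
  by (metis append_take_drop_id grows_append)

lemma grows_distinct: "grows D bs \<Longrightarrow> distinct bs \<and> set bs \<inter> D = {}"
  by (induction bs arbitrary: D) (auto simp: addable_def)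

lemma grows_first: "grows {} (b # bs) \<Longrightarrow> b = (1, 1)"
  by (cases b) (auto simp: addable_iff)

section \<open>Jeu de taquin on growth paths\<close>

text \<open>
  The box \<open>d\<close> is the current end of the jeu de taquin path.  It waits until one of its two
  neighbours is filled; at that moment the entry of the neighbour slides into \<open>d\<close>, and the
  neighbour becomes the new end of the path.  No shapes need to be inspected.
\<close>

primrec slide :: "box \<Rightarrow> box list \<Rightarrow> box list" where
  "slide d [] = []"
| "slide d (b # bs) = (if adj d b then d # slide b bs else b # slide d bs)"

text \<open>
  The finite version of the jeu de taquin map: the smallest entry is removed from the corner box,
  the hole is filled by sliding, and all entries decrease by one.
\<close>

definition promote :: "box list \<Rightarrow> box list" where
  "promote bs = slide (hd bs) (tl bs)"

lemma promote_Cons [simp]: "promote (b # bs) = slide b bs"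
  by (simp add: promote_def)

lemma promote_Nil [simp]: "promote [] = []"
  by (simp add: promote_def)

lemma length_slide [simp]: "length (slide d bs) = length bs"
  by (induction bs arbitrary: d) auto

lemma length_promote [simp]: "length (promote bs) = length bs - 1"
  by (simp add: promote_def)

lemma set_slide: "set (slide d bs) \<subseteq> insert d (set bs)"
  by (induction bs arbitrary: d) (auto split: if_splits)

text \<open>
  At every time the diagram of the slid path is the original one without the current end \<open>d\<close>
  of the jeu de taquin path.
\<close>

lemma grows_slide: "addable D d \<Longrightarrow> grows (insert d D) bs \<Longrightarrow> grows D (slide d bs)"
proof (induction bs arbitrary: D d)
  case Nil
  then show ?case by (simp add: addable_def)
next
  case (Cons b bs)
  show ?case
  proof (cases "adj d b")
    case True
    then show ?thesis using Cons by auto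
  next
    case False
    then have b: "addable D b" "b \<noteq> d"
      using Cons.prems addable_remove[of d D b] by (auto simp: addable_def)
    then have "grows (insert b D) (slide d bs)"
      using Cons.prems by (intro Cons.IH) (auto simp: insert_commute intro: addable_insert)
    then show ?thesis using b False by simp
  qed
qed

lemma grows_promote: "grows {} bs \<Longrightarrow> grows {} (promote bs)"
  by (cases bs) (auto intro: grows_slide)

lemma grows_promote_pow: "grows {} bs \<Longrightarrow> grows {} ((promote ^^ m) bs)"
  by (induction m) (auto intro: grows_promote)

lemma length_promote_pow: "length ((promote ^^ m) bs) = length bs - m"
  by (induction m) auto

lemma set_promote: "set (promote bs) \<subseteq> set bs"
  using set_slide[of "hd bs" "tl bs"] by (cases bs) auto

lemma set_promote_pow: "set ((promote ^^ m) bs) \<subseteq> set bs"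
  by (induction m) (use set_promote in auto)

section \<open>Row insertion on growth paths\<close>

text \<open>
  In terms of words, a growth path records the shapes of the tableaux obtained by row insertion of
  the prefixes of a word.  Suppose that a new largest letter is inserted into the word.  From then
  on the new shapes exceed the old ones by the single box \<open>c\<close> that contains this letter, and \<open>D\<close> is
  the old shape.  If the old shape grows by a box other than \<open>c\<close>, so does the new one.  If it grows
  by \<open>c\<close>, the largest letter is bumped to the end of the next row.
\<close>

fun bump :: "box set \<Rightarrow> box \<Rightarrow> box list \<Rightarrow> box list" where
  "bump D c [] = []"
| "bump D c (b # bs) =
     (if b = c
      then let c' = next_box (insert c D) (Suc (snd c)) in c' # bump (insert c D) c' bs
      else b # bump (insert b D) c bs)"

text \<open>
  \<open>insert_from D p bs\<close> puts the largest letter at position \<open>p\<close> of the word, where it enters at the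
  end of the first row; \<open>D\<close> is the shape that is reached so far.  The last equation is an arbitrary
  value: it concerns positions beyond the end of the word.
\<close>

fun insert_from :: "box set \<Rightarrow> nat \<Rightarrow> box list \<Rightarrow> box list" where
  "insert_from D 0 bs = (let c = next_box D 1 in c # bump D c bs)"
| "insert_from D (Suc p) (b # bs) = b # insert_from (insert b D) p bs"
| "insert_from D (Suc p) [] = []"

abbreviation "insert_at \<equiv> insert_from {}"

text \<open>
  The heart of the proof.  On words, inserting a largest letter and deleting the first letter
  obviously commute; here this is proved directly on growth paths, without words, by following four
  shapes in time: the smallest one \<open>R\<close>, the shape \<open>insert d R\<close> of the path before sliding, the shape
  with the largest letter after sliding, and the largest shape of all.

  Two configurations can occur.  In the first one \<open>c\<close> (the box of the largest letter) and \<open>d\<close> (the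
  end of the jeu de taquin path) are distinct addable boxes of \<open>R\<close>, and both have the same meaning
  with and without the other operation.  In the second one the roles are exchanged: the largest letter sits in
  \<open>c\<close> before sliding and in \<open>d\<close> after it, while the jeu de taquin path ends in \<open>d\<close> without the
  largest letter and in \<open>c\<close> with it.  Then \<open>c\<close> lies in the column next to \<open>d\<close>, not above the row of
  \<open>d\<close>.  The proof checks that each new box \<open>b\<close> leads from one of these configurations to one
  of them, and that both sides of the equation emit the same box.
\<close>

lemma bump_commutes:
  "addable R c \<Longrightarrow> addable R d \<Longrightarrow> c \<noteq> d \<Longrightarrow> grows (insert d R) bs \<Longrightarrow>
     slide d (bump (insert d R) c bs) = bump R c (slide d bs)"
  "addable R d \<Longrightarrow> addable (insert d R) c \<Longrightarrow> fst c = Suc (fst d) \<Longrightarrow> snd c \<le> snd d \<Longrightarrow>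
     grows (insert d R) bs \<Longrightarrow> slide c (bump (insert d R) c bs) = bump R d (slide d bs)"
proof (induction bs arbitrary: R c d)
  case Nil
  {
    case 1
    show ?case by simp
  next
    case 2
    show ?case by simp
  }
next
  case (Cons b bs)
  {
    case 1
    obtain x y where c: "c = (x, y)" by (cases c)
    obtain u v where d: "d = (u, v)" by (cases d)
    have b: "addable (insert d R) b" and g: "grows (insert d (insert b R)) bs"
      using 1 by (auto simp: insert_commute)
    have nb: "b \<noteq> d" "b \<notin> R" using b by (auto simp: addable_def)
    have cR: "addable (insert d R) c" "addable (insert c R) d"
      using 1 by (auto intro: addable_insert)
    have nac: "\<not> adj d c" using 1 by (intro not_adj[of R]) (auto simp: addable_def)
    show ?case
    proof (cases "b = c")
      case True
      define c1 where "c1 = next_box (insert c (insert d R)) (Suc (snd c))"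
      define c2 where "c2 = next_box (insert c R) (Suc (snd c))"
      have ic: "insert c (insert d R) = insert d (insert c R)" by (rule insert_commute)
      have c2: "addable (insert c R) c2" "snd c2 = Suc y"
        using bumped_box[of R x y] 1(1) unfolding c2_def c snd_conv snd_next_box by metis+
      show ?thesis
      \<comment> \<open>The largest letter is bumped to row Suc y. If d is the next box of that row, the two operations
        get into each other's way and the second configuration begins.\<close>
      proof (cases "v = Suc y")
        case True
        then have c2d: "c2 = d"
          using cR(2) next_box_eq unfolding c d c2_def by simp
        have "u < x"
        proof (rule ccontr)
          assume "\<not> u < x"
          then have "(x, y) \<in> R"
            using 1 True youngD[of R u y x y] unfolding c d by (auto simp: addable_iff)
          then show False using 1 by (simp add: c addable_iff)
        qed
        then have "(Suc u, y) \<in> insert c R"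
          using 1 True youngD[of R "x - 1" y "Suc u" y]
          by (cases "Suc u = x") (auto simp: addable_iff c d)
        moreover have "(Suc u, v) \<notin> insert c (insert d R)"
          using 1 True youngD[of R "Suc u" v u v] by (auto simp: addable_iff c d)
        ultimately have ad: "addable (insert d (insert c R)) (Suc u, v)"
          using True cR(2)[THEN addable_young_insert] by (auto simp: addable_iff d)
        then have c1: "c1 = (Suc u, v)"
          unfolding c1_def ic using next_box_eq True by (simp add: c)
        have "slide c1 (bump (insert c (insert d R)) c1 bs) = bump (insert c R) d (slide d bs)"
          unfolding ic by (rule Cons.IH(2)) (use cR ad g \<open>b = c\<close> in \<open>auto simp: c1 d\<close>)
        moreover have "adj d c1" by (simp add: adj_def c1 d)
        ultimately show ?thesis
          using \<open>b = c\<close> c2d nac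
          by (simp add: Let_def c1_def[symmetric] c2_def[symmetric])
      next
        case False
        then have ne: "c2 \<noteq> d" using c2 d by auto
        have "addable (insert d (insert c R)) c2"
          using c2(1) cR(2) ne by (rule addable_insert)
        then have c1: "c1 = c2"
          unfolding c1_def ic using next_box_eq c2(2) by (metis c snd_conv prod.collapse)
        have "\<not> adj d c2"
          using not_adj[OF c2(1) 1(2)] 1 by (auto simp: addable_def)
        moreover have "slide d (bump (insert c (insert d R)) c2 bs) = bump (insert c R) c2 (slide d bs)"
          unfolding ic by (rule Cons.IH(1)) (use cR c2 ne g \<open>b = c\<close> in auto)
        ultimately show ?thesis
          using \<open>b = c\<close> c1 nac
          by (simp add: Let_def c1_def[symmetric] c2_def[symmetric])
      qed
    next
      case False
      show ?thesis
      proof (cases "adj d b")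
        case True
        have "slide b (bump (insert b (insert d R)) c bs) = bump (insert d R) c (slide b bs)"
          by (rule Cons.IH(1)) (use b g cR False in \<open>auto simp: insert_commute\<close>)
        then show ?thesis using True False 1 by simp
      next
        case nadj: False
        then have bR: "addable R b" using addable_remove[OF b] 1 by auto
        have "slide d (bump (insert d (insert b R)) c bs) = bump (insert b R) c (slide d bs)"
          by (rule Cons.IH(1)) (use bR 1 nb False g in \<open>auto intro: addable_insert\<close>)
        then show ?thesis using nadj False by (simp add: insert_commute)
      qed
    qed
  next
    case 2
    obtain u v where d: "d = (u, v)" by (cases d)
    obtain y where c: "c = (Suc u, y)" and yv: "y \<le> v" using 2 by (cases c) (auto simp: d)
    have b: "addable (insert d R) b" and g: "grows (insert d (insert b R)) bs"
      using 2 by (auto simp: insert_commute)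
    have nb: "b \<noteq> d" "b \<notin> R" using b by (auto simp: addable_def)
    have Y: "young (insert d R)" using b by (rule addable_young)
    have cd: "c \<noteq> d" "c \<notin> R" using 2 by (auto simp: addable_def)
    show ?case
    proof (cases "b = c")
      case True
      define c1 where "c1 = next_box (insert c (insert d R)) (Suc (snd c))"
      have ic: "insert c (insert d R) = insert d (insert c R)" by (rule insert_commute)
      have c1a: "addable (insert c (insert d R)) c1" "snd c1 = Suc y"
        using bumped_box[of "insert d R" "Suc u" y] 2(2) unfolding c1_def c snd_conv snd_next_box by metis+
      show ?thesis
      proof (cases "y = v")
        case True
        then have adj: "adj d c" by (simp add: adj_def c d)
        define c2 where "c2 = next_box (insert d R) (Suc (snd d))"
        obtain z where z: "c2 = (z, Suc v)" "z \<le> u" "addable (insert d R) (z, Suc v)"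
          using bumped_box[of R u v] 2(1) unfolding c2_def d snd_conv by metis
        have ne: "c2 \<noteq> c" using z c by auto
        have "addable (insert c (insert d R)) c2" using z ne 2 by (auto intro: addable_insert)
        then have c1: "c1 = c2" unfolding c1_def using next_box_eq z True by (metis c snd_conv)
        have "\<not> adj c c2" using not_adj[of "insert d R" c2 "insert d R" c] 2(2) z by (auto simp: addable_def)
        moreover have "slide c (bump (insert c (insert d R)) c2 bs) = bump (insert d R) c2 (slide c bs)"
          by (rule Cons.IH(1)) (use 2 z ne g \<open>b = c\<close> in \<open>auto simp: insert_commute\<close>)
        ultimately show ?thesis
          using \<open>b = c\<close> c1 adj z True
          by (simp add: Let_def c1_def[symmetric] c2_def[symmetric])
      next
        case False
        then have yv': "y < v" using yv by simp
        \<comment> \<open>All rows from the row of c up to the row of d end in the column of d, so the bumped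
          letter lands directly above c and the second configuration persists.\<close>
        have nadj: "\<not> adj d c" using yv' by (auto simp: adj_def c d)
        have cR: "addable R c" using addable_remove[OF 2(2) 2(1) nadj] .
        have dc: "addable (insert c R) d" using cR 2 cd by (auto intro: addable_insert)
        have "(u, Suc y) \<in> insert d R"
          using youngD[OF Y, of u v u "Suc y"] 2(1) yv' by (auto simp: addable_iff d)
        moreover have "(Suc u, Suc y) \<notin> insert c (insert d R)"
          using youngD[OF Y, of "Suc u" "Suc y" "Suc u" y] 2(2) by (auto simp: addable_iff c)
        ultimately have ad: "addable (insert c (insert d R)) (Suc u, Suc y)"
          using addable_young_insert[OF 2(2)] by (auto simp: addable_iff c)
        then have c1: "c1 = (Suc u, Suc y)" unfolding c1_def c snd_conv by (rule next_box_eq)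
        have "slide c1 (bump (insert c (insert d R)) c1 bs) = bump (insert c R) d (slide d bs)"
          unfolding ic by (rule Cons.IH(2))
            (use dc ad g \<open>b = c\<close> yv' in \<open>auto simp: c1 d insert_commute\<close>)
        moreover have "adj c c1" by (simp add: adj_def c c1)
        ultimately show ?thesis
          using \<open>b = c\<close> nadj cd
          by (simp add: Let_def c1_def[symmetric])
      qed
    next
      case False
      have nadjc: "\<not> adj c b" using not_adj[OF b 2(2)] 2(2) by (auto simp: addable_def)
      have cb: "addable (insert b (insert d R)) c" using 2 b False by (auto intro: addable_insert)
      show ?thesis
      proof (cases "adj d b")
        case True
        have bb: "b = (u, Suc v)"
        proof (rule ccontr)
          assume "b \<noteq> (u, Suc v)"
          then have "b = (Suc u, v)" using True by (auto simp: adj_def d)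
          then show False using addable_same_col[of "insert d R" "Suc u" v y] b 2(2) False c by auto
        qed
        have nx: "next_box (insert d R) (Suc v) = b" using b bb next_box_eq by auto
        have "slide c (bump (insert b (insert d R)) c bs) = bump (insert d R) b (slide b bs)"
          by (rule Cons.IH(2)) (use b cb g yv in \<open>auto simp: bb c insert_commute\<close>)
        then show ?thesis
          using True False nadjc nx by (simp add: Let_def) (simp add: d)
      next
        case nadj: False
        then have bR: "addable R b" using addable_remove[OF b] 2 by auto
        have "slide c (bump (insert d (insert b R)) c bs) = bump (insert b R) d (slide d bs)"
          by (rule Cons.IH(2))
            (use bR cb 2 nb g in \<open>auto simp: insert_commute intro: addable_insert\<close>)
        then show ?thesis using nadj False nb nadjc by (simp add: insert_commute)
      qed
    qed
  }
qed

text \<open>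
  A largest letter in first position stays in the first column, where it is the end of the jeu de
  taquin path: each time it is bumped, it moves to the box above, and the path follows it.
  Sliding therefore undoes the insertion.
\<close>

lemma slide_bump_first_column:
  "addable D (1, y) \<Longrightarrow> grows D bs \<Longrightarrow> slide (1, y) (bump D (1, y) bs) = bs"
proof (induction bs arbitrary: D y)
  case (Cons b bs)
  show ?case
  proof (cases "b = (1, y)")
    case True
    obtain z where z: "next_box (insert (1, y) D) (Suc y) = (z, Suc y)" "z \<le> 1"
        "addable (insert (1, y) D) (z, Suc y)"
      using bumped_box[OF Cons.prems(1)] by metis
    then have z1: "z = 1" by (auto simp: addable_iff)
    have "slide (1, Suc y) (bump (insert (1, y) D) (1, Suc y) bs) = bs"
      using Cons.prems z z1 True by (intro Cons.IH) auto
    then show ?thesis using True z z1 by (simp add: Let_def adj_def)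
  next
    case False
    have "\<not> adj (1, y) b"
      using Cons.prems by (intro not_adj[of D b D]) (auto simp: addable_def)
    moreover have "slide (1, y) (bump (insert b D) (1, y) bs) = bs"
      using Cons.prems False by (intro Cons.IH) (auto intro: addable_insert)
    ultimately show ?thesis using False by simp
  qed
qed simp

lemma promote_insert_at_0: "grows {} bs \<Longrightarrow> promote (insert_at 0 bs) = bs"
proof -
  assume g: "grows {} bs"
  have a: "addable {} (1, 1)" by (simp add: addable_iff)
  then have "next_box {} 1 = (1, 1)" by (rule next_box_eq)
  then show ?thesis using slide_bump_first_column[OF a g] by (simp add: Let_def)
qed

lemma slide_insert_from:
  "addable R d \<Longrightarrow> grows (insert d R) bs \<Longrightarrow> p \<le> length bs \<Longrightarrow>
     slide d (insert_from (insert d R) p bs) = insert_from R p (slide d bs)"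
proof (induction p arbitrary: R d bs)
  case 0
  define c where "c = next_box (insert d R) 1"
  define c' where "c' = next_box R 1"
  have c: "addable (insert d R) c" "snd c = 1" and c': "addable R c'" "snd c' = 1"
    using 0 addable_next_box_first grows_young unfolding c_def c'_def by (auto simp: addable_def)
  show ?case
  \<comment> \<open>If d is the end of the first row of R, insertion starts in the second configuration of
    \<open>bump_commutes\<close>, otherwise in the first one.\<close>
  proof (cases "snd d = 1")
    case True
    then obtain u where d: "d = (u, 1)" by (cases d) auto
    have c'd: "c' = d" using 0 next_box_eq unfolding c'_def d by auto
    have "addable (insert d R) (Suc u, 1)"
      using 0 addable_young_insert[OF 0(1)] youngD[of R "Suc u" 1 u 1] by (auto simp: addable_iff d)
    then have cc: "c = (Suc u, 1)" unfolding c_def by (rule next_box_eq)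
    have "slide c (bump (insert d R) c bs) = bump R d (slide d bs)"
      by (rule bump_commutes(2)) (use 0 c in \<open>auto simp: cc d\<close>)
    moreover have "adj d c" by (simp add: adj_def cc d)
    ultimately show ?thesis by (simp add: Let_def c_def[symmetric] c'_def[symmetric] c'd del: One_nat_def)
  next
    case False
    then have ne: "c' \<noteq> d" using c' by auto
    then have "addable (insert d R) c'" using c' 0 by (auto intro: addable_insert)
    then have cc: "c = c'" unfolding c_def using next_box_eq c' by (metis prod.collapse)
    have "\<not> adj d c'" using not_adj[OF c'(1) 0(1)] 0 by (auto simp: addable_def)
    moreover have "slide d (bump (insert d R) c' bs) = bump R c' (slide d bs)"
      by (rule bump_commutes(1)) (use 0 c' ne in auto)
    ultimately show ?thesis using cc by (simp add: Let_def c_def[symmetric] c'_def[symmetric] del: One_nat_def)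
  qed
next
  case (Suc p)
  then obtain b bs' where bs: "bs = b # bs'" by (cases bs) auto
  have b: "addable (insert d R) b" and g: "grows (insert b (insert d R)) bs'" "p \<le> length bs'"
    using Suc.prems by (auto simp: bs)
  show ?case
  proof (cases "adj d b")
    case True
    have "slide b (insert_from (insert b (insert d R)) p bs') = insert_from (insert d R) p (slide b bs')"
      using b g by (rule Suc.IH)
    then show ?thesis using True by (simp add: bs)
  next
    case False
    have bR: "addable R b" using addable_remove[OF b Suc.prems(1) False] .
    have "slide d (insert_from (insert d (insert b R)) p bs') = insert_from (insert b R) p (slide d bs')"
      by (rule Suc.IH) (use bR Suc.prems b g in \<open>auto simp: addable_def insert_commute\<close>)
    then show ?thesis using False by (simp add: bs insert_commute)
  qed
qed

lemma promote_insert_at_Suc: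
  assumes "grows {} bs" "p < length bs"
  shows "promote (insert_at (Suc p) bs) = insert_at p (promote bs)"
proof -
  obtain b bs' where bs: "bs = b # bs'" using assms by (cases bs) auto
  then show ?thesis using slide_insert_from[of "{}" b bs' p] assms by simp
qed

text \<open>
  Here \<open>e\<close> is the final position of the largest letter.  The last conjunct turns the recursion from
  the front into a recursion from the back, which is what bijectivity needs.
\<close>

lemma bump_structure:
  "addable D c \<Longrightarrow> grows D bs \<Longrightarrow>
   \<exists>e. addable (D \<union> set bs) e \<and> grows (insert c D) (bump D c bs) \<and>
       insert c D \<union> set (bump D c bs) = insert e (D \<union> set bs) \<and>
       (\<forall>b. bump D c (bs @ [b]) = bump D c bs @
          [if b = e then next_box (insert e (D \<union> set bs)) (Suc (snd e)) else b])"
proof (induction bs arbitrary: D c)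
  case Nil
  then show ?case by (intro exI[of _ c]) (auto simp: addable_def Let_def)
next
  case (Cons b bs)
  show ?case
  proof (cases "b = c")
    case True
    define c' where "c' = next_box (insert c D) (Suc (snd c))"
    obtain x y where c: "c = (x, y)" by (cases c)
    have c': "addable (insert c D) c'"
      using bumped_box[of D x y] Cons.prems(1) unfolding c'_def c snd_conv by metis
    have U: "insert c D \<union> set bs = D \<union> set (b # bs)" using True by auto
    obtain e where e: "addable (D \<union> set (b # bs)) e"
        "grows (insert c' (insert c D)) (bump (insert c D) c' bs)"
        "insert c' (insert c D) \<union> set (bump (insert c D) c' bs) = insert e (D \<union> set (b # bs))"
        "\<And>z. bump (insert c D) c' (bs @ [z]) = bump (insert c D) c' bs @
          [if z = e then next_box (insert e (D \<union> set (b # bs))) (Suc (snd e)) else z]"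
      using Cons.IH[OF c'] Cons.prems True unfolding U by auto
    show ?thesis
      using e c' True by (intro exI[of _ e]) (simp add: Let_def c'_def[symmetric] insert_commute)
  next
    case False
    have a: "addable (insert b D) c" using Cons.prems False by (auto intro: addable_insert)
    have a': "addable (insert c D) b" using Cons.prems False by (auto intro: addable_insert)
    have U: "insert b D \<union> set bs = D \<union> set (b # bs)" by auto
    obtain e where e: "addable (D \<union> set (b # bs)) e"
        "grows (insert c (insert b D)) (bump (insert b D) c bs)"
        "insert c (insert b D) \<union> set (bump (insert b D) c bs) = insert e (D \<union> set (b # bs))"
        "\<And>z. bump (insert b D) c (bs @ [z]) = bump (insert b D) c bs @
          [if z = e then next_box (insert e (D \<union> set (b # bs))) (Suc (snd e)) else z]"
      using Cons.IH[OF a] Cons.prems unfolding U by auto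
    show ?thesis
      using e a' False by (intro exI[of _ e]) (auto simp: insert_commute)
  qed
qed

lemma insert_from_structure:
  "grows D bs \<Longrightarrow> p \<le> length bs \<Longrightarrow>
   \<exists>e. addable (D \<union> set bs) e \<and> grows D (insert_from D p bs) \<and>
       D \<union> set (insert_from D p bs) = insert e (D \<union> set bs) \<and>
       (\<forall>b. insert_from D p (bs @ [b]) = insert_from D p bs @
          [if b = e then next_box (insert e (D \<union> set bs)) (Suc (snd e)) else b])"
proof (induction p arbitrary: D bs)
  case 0
  define c where "c = next_box D 1"
  have c: "addable D c"
    unfolding c_def using 0 grows_young by (intro addable_next_box_first) auto
  show ?case
    using bump_structure[OF c 0(1)] c
    by (simp add: Let_def c_def[symmetric] del: One_nat_def)
next
  case (Suc p)
  then obtain b bs' where bs: "bs = b # bs'" by (cases bs) auto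
  have U: "insert b D \<union> set bs' = D \<union> set bs" by (auto simp: bs)
  show ?case
    using Suc.IH[of "insert b D" bs'] Suc.prems unfolding U by (auto simp: bs)
qed

lemma insert_at_structure:
  assumes "grows {} bs" "p \<le> length bs"
  obtains e where "addable (set bs) e" "grows {} (insert_at p bs)"
    "set (insert_at p bs) = insert e (set bs)"
    "\<And>b. insert_at p (bs @ [b]) = insert_at p bs @
       [if b = e then next_box (insert e (set bs)) (Suc (snd e)) else b]"
  using insert_from_structure[OF assms] by auto

lemma insert_from_end: "insert_from D (length bs) bs = bs @ [next_box (D \<union> set bs) 1]"
  by (induction bs arbitrary: D) (auto simp: Let_def)

lemma length_bump [simp]: "length (bump D c bs) = length bs"
  by (induction bs arbitrary: D c) (auto simp: Let_def)

lemma length_insert_from: "p \<le> length bs \<Longrightarrow> length (insert_from D p bs) = Suc (length bs)"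
proof (induction p arbitrary: D bs)
  case (Suc p)
  then show ?case by (cases bs) auto
qed (simp add: Let_def)

lemma take_bump: "take n (bump D c bs) = bump D c (take n bs)"
  by (induction bs arbitrary: D c n) (auto simp: take_Cons Let_def split: nat.split)

lemma take_insert_from_after:
  "p \<le> n \<Longrightarrow> p \<le> length bs \<Longrightarrow> take (Suc n) (insert_from D p bs) = insert_from D p (take n bs)"
proof (induction p arbitrary: D bs n)
  case (Suc p)
  then obtain b bs' n' where "bs = b # bs'" "n = Suc n'" by (cases bs; cases n) auto
  then show ?case using Suc by auto
qed (simp add: Let_def take_bump)

lemma take_insert_from_before:
  "n \<le> p \<Longrightarrow> p \<le> length bs \<Longrightarrow> take n (insert_from D p bs) = take n bs"
proof (induction p arbitrary: D bs n)
  case (Suc p)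
  then obtain b bs' where "bs = b # bs'" by (cases bs) auto
  then show ?case using Suc by (cases n) auto
qed simp

lemma promote_pow_insert_at:
  "grows {} bs \<Longrightarrow> p \<le> length bs \<Longrightarrow> m \<le> p \<Longrightarrow>
     (promote ^^ m) (insert_at p bs) = insert_at (p - m) ((promote ^^ m) bs)"
proof (induction m)
  case (Suc m)
  then have "(promote ^^ Suc m) (insert_at p bs) = promote (insert_at (Suc (p - Suc m)) ((promote ^^ m) bs))"
    by (simp add: Suc_diff_Suc)
  also have "\<dots> = insert_at (p - Suc m) (promote ((promote ^^ m) bs))"
    using Suc.prems by (intro promote_insert_at_Suc grows_promote_pow) (auto simp: length_promote_pow)
  finally show ?case by simp
qed simp

text \<open>
  Once \<open>p\<close> letters are deleted the inserted letter is the first one, and deleting it as well leaves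
  no trace of it.
\<close>

lemma promote_pow_insert_at_passed:
  assumes "grows {} bs" "p \<le> length bs" "p \<le> m"
  shows "(promote ^^ Suc m) (insert_at p bs) = (promote ^^ m) bs"
proof -
  have p: "(promote ^^ Suc p) (insert_at p bs) = (promote ^^ p) bs"
    using promote_pow_insert_at[OF assms(1,2) order_refl]
      promote_insert_at_0[OF grows_promote_pow[OF assms(1)]] by simp
  obtain k where k: "m = k + p" using assms(3) by (metis add.commute le_Suc_ex)
  have "(promote ^^ Suc m) (insert_at p bs) = (promote ^^ k) ((promote ^^ Suc p) (insert_at p bs))"
    unfolding k add_Suc_right[symmetric] by (simp only: funpow_add comp_apply)
  also have "\<dots> = (promote ^^ m) bs"
    unfolding p k by (simp only: funpow_add comp_apply)
  finally show ?thesis .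
qed

section \<open>Insertion is bijective\<close>

definition paths :: "nat \<Rightarrow> box list set" where
  "paths n = {bs. grows {} bs \<and> length bs = n}"

definition lower_covers :: "box set \<Rightarrow> box set set" where
  "lower_covers D = {K. young K \<and> K \<nearrow> D}"

lemma lower_covers_insert:
  assumes "young K" "e \<notin> K"
  shows "K \<in> lower_covers (insert e K)"
proof -
  have "K \<nearrow> insert e K" unfolding adds_box_def using assms(2) by (intro exI[of _ e] conjI) simp_all
  then show ?thesis using assms(1) by (simp add: lower_covers_def)
qed

lemma young_Int:
  assumes A: "young A" and B: "young B"
  shows "young (A \<inter> B)"
proof (rule youngI)
  show "finite (A \<inter> B)" "A \<inter> B \<subseteq> boxes"
    using young_finite[OF A] young_subset[OF A] by auto
  show "(k, l) \<in> A \<inter> B" if "(i, j) \<in> A \<inter> B" "1 \<le> k" "k \<le> i" "1 \<le> l" "l \<le> j" for i j k l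
    using youngD[OF A, of i j k l] youngD[OF B, of i j k l] that by simp
qed

text \<open>
  The inserted letter can be traced backwards in time.  From the last shapes of the two paths one
  can tell whether the last box came from the inserted letter itself (then it lies in the first row),
  from bumping it (then it lies in a higher row, and the box that it left is the last one of the row
  below), or was simply copied.
\<close>

lemma insert_at_inj:
  "grows {} bs \<Longrightarrow> grows {} bs' \<Longrightarrow> p \<le> length bs \<Longrightarrow> p' \<le> length bs' \<Longrightarrow>
   insert_at p bs = insert_at p' bs' \<Longrightarrow> set bs = set bs' \<Longrightarrow> bs = bs' \<and> p = p'"
proof (induction bs arbitrary: p p' bs' rule: rev_induct)
  case Nil
  then show ?case by auto
next
  have last_row: "False"
    if "grows {} (xs @ [b])" "insert_at p (xs @ [b]) = bs' @ [next_box (set bs') 1]"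
      "p \<le> length xs" "set (xs @ [b]) = set bs'" for xs b p bs'
  proof -
    have g: "grows {} xs" and p: "p \<le> length xs" using that by (simp_all add: grows_snoc)
    obtain e where e: "addable (set xs) e"
      "grows {} (insert_at p xs)" "set (insert_at p xs) = insert e (set xs)"
      "\<And>b. insert_at p (xs @ [b]) = insert_at p xs @
         [if b = e then next_box (insert e (set xs)) (Suc (snd e)) else b]"
      by (rule insert_at_structure[OF g p]) (rule that)
    have eq: "insert_at p xs = bs'"
      "(if b = e then next_box (insert e (set xs)) (Suc (snd e)) else b) = next_box (set bs') 1"
      using that(2) e(4)[of b] by simp_all
    have "insert e (set xs) = insert b (set xs)" using eq(1) e(3) that(4) by simp
    moreover have "b \<notin> set xs" using that(1) by (simp add: grows_snoc addable_def)
    ultimately have "b = e" by auto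
    then have "Suc (snd e) = 1" using arg_cong[OF eq(2), of snd] by simp
    then show False using e(1) by (cases e) (auto simp: addable_iff)
  qed
  case (snoc b xs)
  have xs: "grows {} xs" "addable (set xs) b" using snoc.prems by (auto simp: grows_snoc)
  consider (ends) "p = length (xs @ [b])" "p' = length bs'"
    | (end1) "p = length (xs @ [b])" "p' < length bs'"
    | (end2) "p \<le> length xs" "p' = length bs'"
    | (bumps) "p \<le> length xs" "p' < length bs'"
    using snoc.prems by fastforce
  then show ?case
  proof cases
    case ends
    then show ?thesis
      using snoc.prems(5) insert_from_end[of "{}" "xs @ [b]"] insert_from_end[of "{}" bs']
      by (simp del: length_append)
  next
    case end1
    then obtain xs' b' where bs': "bs' = xs' @ [b']" by (cases bs' rule: rev_cases) auto
    have "insert_at p (xs @ [b]) = (xs @ [b]) @ [next_box (set (xs @ [b])) 1]"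
      using insert_from_end[of "{}" "xs @ [b]"] end1 by (simp del: length_append)
    then have False
      using snoc.prems end1 unfolding bs' by (intro last_row[of xs' b' p' "xs @ [b]"]) simp_all
    then show ?thesis ..
  next
    case end2
    have "insert_at p' bs' = bs' @ [next_box (set bs') 1]"
      using insert_from_end[of "{}" bs'] end2 by simp
    then have False
      using snoc.prems end2 by (intro last_row[of xs b p bs']) simp_all
    then show ?thesis ..
  next
    case bumps
    then obtain xs' b' where bs': "bs' = xs' @ [b']" by (cases bs' rule: rev_cases) auto
    have xs': "grows {} xs'" "addable (set xs') b'" and p': "p' \<le> length xs'"
      using snoc.prems bumps by (auto simp: grows_snoc bs')
    obtain e where e: "addable (set xs) e"
      "grows {} (insert_at p xs)" "set (insert_at p xs) = insert e (set xs)"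
      "\<And>b. insert_at p (xs @ [b]) = insert_at p xs @
         [if b = e then next_box (insert e (set xs)) (Suc (snd e)) else b]"
      by (rule insert_at_structure[OF xs(1) bumps(1)]) (rule that)
    obtain e' where e': "addable (set xs') e'"
      "grows {} (insert_at p' xs')" "set (insert_at p' xs') = insert e' (set xs')"
      "\<And>b. insert_at p' (xs' @ [b]) = insert_at p' xs' @
         [if b = e' then next_box (insert e' (set xs')) (Suc (snd e')) else b]"
      by (rule insert_at_structure[OF xs'(1) p']) (rule that)
    define V where "V = insert e (set xs)"
    have ins: "insert_at p xs = insert_at p' xs'"
      and last: "(if b = e then next_box V (Suc (snd e)) else b) =
                 (if b' = e' then next_box V (Suc (snd e')) else b')"
      using snoc.prems(5) e(3) e'(3) e(4)[of b] e'(4)[of b'] unfolding V_def bs' by simp_all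
    have V: "V = insert e' (set xs')" using e(3) e'(3) ins V_def by simp
    have B: "insert b (set xs) = insert b' (set xs')" using snoc.prems(6) by (simp add: bs')
    have nm: "b \<notin> set xs" "b' \<notin> set xs'" "e \<notin> set xs" "e' \<notin> set xs'"
      using xs(2) xs'(2) e(1) e'(1) by (simp_all add: addable_notin)
    have "set xs = set xs'"
    proof (cases "b = e")
      case True
      then have bV: "insert b' (set xs') = V" using B V_def by simp
      then have "b' = e'" using V nm(2,4) by auto
      then have "next_box V (Suc (snd e)) = next_box V (Suc (snd e'))" using last True by simp
      from arg_cong[OF this, of snd] have "snd e = snd e'" by simp
      then obtain x y x' where xy: "e = (x, y)" "e' = (x', y)"
        by (metis prod.collapse)
      have "e = e'"
      proof (rule ccontr)
        assume ne: "e \<noteq> e'"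
        have "e' \<in> set xs" "e \<in> set xs'" using V V_def ne nm(3,4) by auto
        then have "x \<le> x' \<Longrightarrow> e \<in> set xs" "x' \<le> x \<Longrightarrow> e' \<in> set xs'"
          using e(1) e'(1) youngD[of "set xs" x' y x y] youngD[of "set xs'" x y x' y]
          unfolding xy by (simp_all add: addable_iff)
        then show False using nm by linarith
      qed
      then show ?thesis using V V_def nm(3,4) by auto
    next
      case False
      then have "b' \<noteq> e'"
      proof -
        have "b' = e' \<Longrightarrow> insert b (set xs) = insert e (set xs)" using B V V_def by simp
        then show ?thesis using False nm(1) by auto
      qed
      then have "b = b'" using last False by simp
      then show ?thesis using B nm(1,2) by auto
    qed
    then have "xs = xs' \<and> p = p'"
      using snoc.IH[OF xs(1) xs'(1) bumps(1) p' ins] by simp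
    then show ?thesis using B nm(1,2) unfolding bs' by auto
  qed
qed

text \<open>
  Reverse bumping: given the path \<open>U\<close> and the smaller shape \<open>K\<close>, the box by which the two shapes differ
  is moved backwards in time, going down one row whenever it meets the last box of the path, until it
  leaves the first row.
\<close>

lemma insert_at_surj:
  "grows {} U \<Longrightarrow> K \<in> lower_covers (set U) \<Longrightarrow>
   \<exists>bs p. grows {} bs \<and> p \<le> length bs \<and> insert_at p bs = U \<and> set bs = K"
proof (induction U arbitrary: K rule: rev_induct)
  case Nil
  then show ?case by (auto simp: lower_covers_def adds_box_def)
next
  case (snoc e' V)
  have V: "grows {} V" "addable (set V) e'" using snoc.prems by (auto simp: grows_snoc)
  have "young K" "K \<nearrow> set (V @ [e'])" using snoc.prems by (simp_all add: lower_covers_def)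
  then obtain e where K: "young K" "e \<notin> K" and Ke: "insert e' (set V) = insert e K"
    unfolding adds_box_def by auto
  have e'V: "e' \<notin> set V" using V by (auto simp: addable_def)
  obtain x y where xy: "e' = (x, y)" by (cases e')
  have pos: "1 \<le> x" "1 \<le> y" using V by (auto simp: addable_iff xy)
  show ?case
  proof (cases "e = e'")
    case True
    then have KV: "K = set V" using Ke K e'V by auto
    show ?thesis
    proof (cases "y = 1")
      case True
      have "insert_at (length V) V = V @ [e']"
        using insert_from_end[of "{}" V] next_box_eq[of "set V" x y] V True by (simp add: xy)
      then show ?thesis using V KV by blast
    next
      case False
      \<comment> \<open>The letter in e' was bumped out of the last box c of the row below; c is a removable
        corner because that row is longer than the row of e'.\<close>
      define z where "z = Max {z. (z, y - 1) \<in> set V}"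
      have fin: "finite {z. (z, y - 1) \<in> set V}"
        using finite_vimageI[of "set V" "\<lambda>z. (z, y - 1)"] by (simp add: vimage_def inj_on_def)
      have xin: "(x, y - 1) \<in> set V" using V False by (auto simp: xy addable_iff)
      have "z \<in> {z. (z, y - 1) \<in> set V}" unfolding z_def
        by (rule Max_in[OF fin]) (use xin in blast)
      then have zin: "(z, y - 1) \<in> set V" by simp
      have zmax: "u \<le> z" if "(u, y - 1) \<in> set V" for u
        unfolding z_def by (rule Max_ge[OF fin]) (use that in simp)
      define c where "c = (z, y - 1)"
      define W where "W = set V - {c}"
      have Y: "young (set V)" using V by (simp add: addable_def)
      have W: "young W"
      proof -
        have "(k, l) \<noteq> c" if "(i, j) \<in> W" "1 \<le> k" "k \<le> i" "1 \<le> l" "l \<le> j" for i j k l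
        proof
          assume kl: "(k, l) = c"
          then have ij: "(i, j) \<in> set V" "(i, j) \<noteq> c" "z \<le> i" "y - 1 \<le> j"
            using that by (auto simp: W_def c_def)
          have "i = z"
            using youngD[OF Y ij(1), of i "y - 1"] zmax[of i] ij pos that False kl by (auto simp: c_def)
          then have "y \<le> j" using ij by (auto simp: c_def)
          moreover have "x \<le> z" using zmax xin by auto
          ultimately have "(x, y) \<in> set V" using youngD[OF Y ij(1), of x y] ij pos by auto
          then show False using e'V xy by simp
        qed
        then have "(k, l) \<in> W"
          if "(i, j) \<in> W" "1 \<le> k" "k \<le> i" "1 \<le> l" "l \<le> j" for i j k l
          using youngD[OF Y, of i j k l] that by (simp add: W_def)
        have fin': "finite W" "W \<subseteq> boxes" using young_finite[OF Y] young_subset[OF Y] by (auto simp: W_def)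
        show ?thesis by (rule youngI) fact+
      qed
      have WV: "insert c W = set V" using zin by (auto simp: W_def c_def)
      have "c \<notin> W" by (simp add: W_def)
      then have "W \<in> lower_covers (set V)"
        using lower_covers_insert[OF W, of c] WV by simp
      then obtain bs p where bs: "grows {} bs" "p \<le> length bs" "insert_at p bs = V" "set bs = W"
        using snoc.IH[OF V(1)] by blast
      obtain f where f: "addable (set bs) f"
      "grows {} (insert_at p bs)" "set (insert_at p bs) = insert f (set bs)"
        "\<And>b. insert_at p (bs @ [b]) = insert_at p bs @
           [if b = f then next_box (insert f (set bs)) (Suc (snd f)) else b]"
        by (rule insert_at_structure[OF bs(1,2)]) (rule that)
      have "insert f W = insert c W" "f \<notin> W" using f(1,3) bs(3,4) WV by (simp_all add: addable_notin)
      then have "f = c" using W_def by blast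
      then have "insert_at p (bs @ [c]) = V @ [e']"
        using f(4)[of c] bs(3,4) WV next_box_eq[of "set V" x y] V False pos by (simp add: c_def xy)
      moreover have "addable W c" using W WV Y by (auto simp: addable_def W_def)
      ultimately show ?thesis
        using bs KV WV by (intro exI[of _ "bs @ [c]"] exI[of _ p]) (simp add: grows_snoc)
    qed
  next
    case False
    define W where "W = set V - {e}"
    have eV: "e \<in> set V" using Ke False by auto
    have W: "W = set V \<inter> K" using Ke K(2) False by (auto simp: W_def)
    have "young W" unfolding W using addable_young[OF V(2)] K(1) by (rule young_Int)
    have KW: "K = insert e' W" using Ke K False e'V eV by (auto simp: W_def)
    have "e \<notin> W" "insert e W = set V" using eV by (auto simp: W_def)
    then have "W \<in> lower_covers (set V)"
      using lower_covers_insert[OF \<open>young W\<close>, of e] by simp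
    then obtain bs p where bs: "grows {} bs" "p \<le> length bs" "insert_at p bs = V" "set bs = W"
      using snoc.IH[OF V(1)] by blast
    obtain f where f: "addable (set bs) f"
      "grows {} (insert_at p bs)" "set (insert_at p bs) = insert f (set bs)"
      "\<And>b. insert_at p (bs @ [b]) = insert_at p bs @
         [if b = f then next_box (insert f (set bs)) (Suc (snd f)) else b]"
      by (rule insert_at_structure[OF bs(1,2)]) (rule that)
    have "insert f W = insert e W" "f \<notin> W"
      using f(1,3) bs(3,4) \<open>insert e W = set V\<close> by (simp_all add: addable_notin)
    then have "f = e" using W_def by blast
    then have "insert_at p (bs @ [e']) = V @ [e']" using f(4)[of e'] bs(3) False by simp
    moreover have "addable W e'" using \<open>young W\<close> KW K e'V by (auto simp: addable_def W_def)
    ultimately show ?thesis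
      using bs KW by (intro exI[of _ "bs @ [e']"] exI[of _ p]) (simp add: grows_snoc)
  qed
qed

text \<open>
  Corresponds to the bijection between permutations and pairs of tableaux, restricted to one letter:
  an extended path together with a smaller shape is the same thing as a path of that shape together
  with the position of the new letter.
\<close>

lemma bij_insertion:
  "bij_betw (\<lambda>(p, bs). (insert_at p bs, set bs)) ({..<Suc n} \<times> paths n)
     (SIGMA U:paths (Suc n). lower_covers (set U))"
proof (rule bij_betwI')
  fix a b assume ab: "a \<in> {..<Suc n} \<times> paths n" "b \<in> {..<Suc n} \<times> paths n"
  obtain p bs q cs where pq: "a = (p, bs)" "b = (q, cs)" by (metis surj_pair)
  have g: "grows {} bs" "grows {} cs" "p \<le> length bs" "q \<le> length cs"
    using ab by (simp_all add: pq paths_def)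
  have "bs = cs \<and> p = q" if "insert_at p bs = insert_at q cs" "set bs = set cs"
    using insert_at_inj[OF g that] .
  then show "((case a of (p, bs) \<Rightarrow> (insert_at p bs, set bs)) =
      (case b of (p, bs) \<Rightarrow> (insert_at p bs, set bs))) = (a = b)"
    by (auto simp: pq)
next
  fix a assume a: "a \<in> {..<Suc n} \<times> paths n"
  obtain p bs where pb: "a = (p, bs)" "grows {} bs" "length bs = n" "p \<le> length bs"
    using a by (auto simp: paths_def)
  obtain e where e: "addable (set bs) e" "grows {} (insert_at p bs)"
    "set (insert_at p bs) = insert e (set bs)"
    by (rule insert_at_structure[OF pb(2,4)]) (rule that)
  show "(case a of (p, bs) \<Rightarrow> (insert_at p bs, set bs)) \<in> (SIGMA U:paths (Suc n). lower_covers (set U))"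
    using pb e length_insert_from[OF pb(4)] lower_covers_insert[of "set bs" e]
      addable_young[OF e(1)] addable_notin[OF e(1)]
    by (simp add: paths_def)
next
  fix c assume c: "c \<in> (SIGMA U:paths (Suc n). lower_covers (set U))"
  then obtain U K where UK: "c = (U, K)" "grows {} U" "length U = Suc n" "K \<in> lower_covers (set U)"
    by (auto simp: paths_def)
  obtain bs p where bs: "grows {} bs" "p \<le> length bs" "insert_at p bs = U" "set bs = K"
    using insert_at_surj[OF UK(2,4)] by blast
  have "length bs = n" using length_insert_from[OF bs(2), of "{}"] bs(3) UK(3) by simp
  then have "(p, bs) \<in> {..<Suc n} \<times> paths n" using bs by (simp add: paths_def)
  then show "\<exists>a\<in>{..<Suc n} \<times> paths n. c = (case a of (p, bs) \<Rightarrow> (insert_at p bs, set bs))"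
    by (rule bexI[rotated]) (simp add: UK bs)
qed

section \<open>Counting paths\<close>

lemma paths_grows: "U \<in> paths n \<Longrightarrow> grows {} U"
  and paths_length: "U \<in> paths n \<Longrightarrow> length U = n"
  by (simp_all add: paths_def)

lemma paths_0 [simp]: "paths 0 = {[]}"
  by (auto simp: paths_def)

lemma card_set_path: "U \<in> paths n \<Longrightarrow> card (set U) = n"
  using grows_distinct[of "{}" U] by (simp add: paths_def distinct_card)

lemma young_set_path: "U \<in> paths n \<Longrightarrow> young (set U)"
  using grows_young_union[of "{}" U] by (simp add: paths_def)

lemma take_path: "U \<in> paths n \<Longrightarrow> m \<le> n \<Longrightarrow> take m U \<in> paths m"
  by (simp add: paths_def grows_take)

lemma promote_pow_path: "U \<in> paths (m + n) \<Longrightarrow> (promote ^^ m) U \<in> paths n"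
  by (simp add: paths_def grows_promote_pow length_promote_pow)

lemma young_subset_square:
  assumes D: "young D"
  shows "D \<subseteq> {1..card D} \<times> {1..card D}"
proof
  fix b assume b: "b \<in> D"
  obtain i j where ij: "b = (i, j)" by (cases b)
  have pos: "1 \<le> i" "1 \<le> j" using young_pos[OF D] b ij by auto
  have "(\<lambda>k. (k, j)) ` {1..i} \<subseteq> D" "(\<lambda>l. (i, l)) ` {1..j} \<subseteq> D"
    using youngD[OF D, of i j] b ij pos by auto
  then have "card ((\<lambda>k. (k, j)) ` {1..i}) \<le> card D" "card ((\<lambda>l. (i, l)) ` {1..j}) \<le> card D"
    by (auto intro: card_mono young_finite[OF D])
  then show "b \<in> {1..card D} \<times> {1..card D}"
    using pos ij by (simp add: card_image inj_on_def)
qed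

lemma finite_paths [simp]: "finite (paths n)"
proof (rule finite_subset)
  show "paths n \<subseteq> {bs. set bs \<subseteq> {1..n} \<times> {1..n} \<and> length bs = n}"
    using young_subset_square[OF young_set_path] card_set_path by (auto simp: paths_def)
  show "finite {bs. set bs \<subseteq> {1..n} \<times> {1..n} \<and> length bs = n}"
    by (rule finite_lists_length_eq) simp
qed

definition num_paths :: "box set \<Rightarrow> nat" where
  "num_paths D = card {bs. grows {} bs \<and> set bs = D}"

lemma paths_to_eq: "{bs. grows {} bs \<and> set bs = D} = {bs \<in> paths (card D). set bs = D}"
  using grows_distinct[of "{}"] by (auto simp: paths_def distinct_card)

lemma finite_paths_to [simp]: "finite {bs. grows {} bs \<and> set bs = D}"
  unfolding paths_to_eq by simp

lemma num_paths_empty [simp]: "num_paths {} = 1"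
proof -
  have "{bs. grows {} bs \<and> set bs = {}} = {[]}" by auto
  then show ?thesis by (simp add: num_paths_def)
qed

lemma lower_coversE:
  assumes "K \<in> lower_covers D"
  obtains e where "young K" "e \<notin> K" "D = insert e K"
  using assms unfolding lower_covers_def adds_box_def by blast

lemma finite_lower_covers: "finite D \<Longrightarrow> finite (lower_covers D)"
  by (rule finite_subset[of _ "Pow D"]) (auto elim!: lower_coversE)

text \<open>
  Remove the last box of a path.
\<close>

lemma num_paths_rec:
  assumes D: "young D" "D \<noteq> {}"
  shows "num_paths D = (\<Sum>K\<in>lower_covers D. num_paths K)"
proof -
  let ?P = "\<lambda>D. {bs. grows {} bs \<and> set bs = D}"
  have "bij_betw (\<lambda>bs. (set (butlast bs), butlast bs)) (?P D) (SIGMA K:lower_covers D. ?P K)"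
  proof (rule bij_betwI[where g = "\<lambda>(K, bs). bs @ [the_elem (D - K)]"])
    show "(\<lambda>bs. (set (butlast bs), butlast bs)) \<in> ?P D \<rightarrow> (SIGMA K:lower_covers D. ?P K)"
    proof
      fix bs assume bs: "bs \<in> ?P D"
      then obtain b cs where cs: "bs = cs @ [b]" using D by (cases bs rule: rev_cases) auto
      then have a: "grows {} cs" "addable (set cs) b" "D = insert b (set cs)"
        using bs by (auto simp: grows_snoc)
      then show "(set (butlast bs), butlast bs) \<in> (SIGMA K:lower_covers D. ?P K)"
        using lower_covers_insert[OF addable_young addable_notin, OF a(2) a(2)] by (simp add: cs)
    qed
    show "(\<lambda>(K, bs). bs @ [the_elem (D - K)]) \<in> (SIGMA K:lower_covers D. ?P K) \<rightarrow> ?P D"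
    proof
      fix c assume "c \<in> (SIGMA K:lower_covers D. ?P K)"
      then obtain K bs where c: "c = (K, bs)" "K \<in> lower_covers D" "grows {} bs" "set bs = K" by auto
      obtain e where e: "young K" "e \<notin> K" "D = insert e K" using c(2) by (rule lower_coversE)
      then have "D - K = {e}" by auto
      then show "(case c of (K, bs) \<Rightarrow> bs @ [the_elem (D - K)]) \<in> ?P D"
        using c e D by (simp add: grows_snoc addable_def)
    qed
    show "(case (set (butlast bs), butlast bs) of (K, bs) \<Rightarrow> bs @ [the_elem (D - K)]) = bs"
      if bs: "bs \<in> ?P D" for bs
    proof -
      obtain b cs where cs: "bs = cs @ [b]" using bs D by (cases bs rule: rev_cases) auto
      then have "D - set cs = {b}" using bs grows_distinct[of "{}" bs] by auto
      then show ?thesis by (simp add: cs)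
    qed
    show "(set (butlast (case c of (K, bs) \<Rightarrow> bs @ [the_elem (D - K)])),
        butlast (case c of (K, bs) \<Rightarrow> bs @ [the_elem (D - K)])) = c"
      if "c \<in> (SIGMA K:lower_covers D. ?P K)" for c
      using that by auto
  qed
  then have "card (?P D) = card (SIGMA K:lower_covers D. ?P K)" by (rule bij_betw_same_card)
  also have "\<dots> = (\<Sum>K\<in>lower_covers D. card (?P K))"
    using D by (intro card_SigmaI) (auto intro: finite_lower_covers young_finite)
  finally show ?thesis by (simp add: num_paths_def)
qed

text \<open>
  Combines the recursion for the number of paths with the bijection: to count paths whose shape is
  the shape of some \<open>U \<in> X\<close>, remove the largest letter from \<open>U\<close> in all possible ways.
\<close>

lemma sum_num_paths_insertion:
  assumes X: "X \<subseteq> paths (Suc n)"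
  shows "(\<Sum>U\<in>X. num_paths (set U)) =
    (\<Sum>p<Suc n. \<Sum>bs\<in>{bs \<in> paths n. insert_at p bs \<in> X}. num_paths (set bs))"
proof -
  have fX: "finite X" using X by (rule finite_subset) simp
  have "(\<Sum>U\<in>X. num_paths (set U)) = (\<Sum>U\<in>X. \<Sum>K\<in>lower_covers (set U). num_paths K)"
  proof (rule sum.cong)
    fix U assume "U \<in> X"
    then have U: "U \<in> paths (Suc n)" using X by auto
    then have "set U \<noteq> {}" by (auto simp: paths_def)
    then show "num_paths (set U) = (\<Sum>K\<in>lower_covers (set U). num_paths K)"
      by (rule num_paths_rec[OF young_set_path[OF U]])
  qed simp
  also have "\<dots> = (\<Sum>(U, K)\<in>(SIGMA U:X. lower_covers (set U)). num_paths K)"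
    using fX by (intro sum.Sigma) (auto intro: finite_lower_covers)
  also have "\<dots> = (\<Sum>(U, K)\<in>(SIGMA U:paths (Suc n). lower_covers (set U)). if U \<in> X then num_paths K else 0)"
  proof (rule sum.mono_neutral_cong_left)
    show "finite (SIGMA U:paths (Suc n). lower_covers (set U))"
      by (intro finite_SigmaI finite_lower_covers) auto
  qed (use X in \<open>auto split: if_splits\<close>)
  also have "\<dots> = (\<Sum>(p, bs)\<in>{..<Suc n} \<times> paths n. if insert_at p bs \<in> X then num_paths (set bs) else 0)"
    by (subst sum.reindex_bij_betw[OF bij_insertion, symmetric]) (simp add: case_prod_beta)
  also have "\<dots> = (\<Sum>p<Suc n. \<Sum>bs\<in>paths n. if insert_at p bs \<in> X then num_paths (set bs) else 0)"
    by (rule sum.cartesian_product[symmetric])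
  also have "\<dots> = (\<Sum>p<Suc n. \<Sum>bs\<in>{bs \<in> paths n. insert_at p bs \<in> X}. num_paths (set bs))"
    by (simp add: sum.inter_filter)
  finally show ?thesis .
qed

section \<open>Independence of the blocks of a path\<close>

text \<open>
  The paths that begin with \<open>S\<close> and turn into \<open>T\<close> when the jeu de taquin map has removed that
  beginning.  In terms of words: the recording tableau of the first block is \<open>S\<close>, that of the
  second block is \<open>T\<close>.
\<close>

definition products :: "box list \<Rightarrow> box list \<Rightarrow> box list set" where
  "products S T = {U \<in> paths (length S + length T).
     take (length S) U = S \<and> (promote ^^ length S) U = T}"

lemma products_subset: "products S T \<subseteq> paths (length S + length T)"
  by (auto simp: products_def)

lemma finite_products [simp]: "finite (products S T)"
  by (rule finite_subset[OF products_subset]) simp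

lemma products_Int:
  "S \<in> paths m \<Longrightarrow> S' \<in> paths m \<Longrightarrow> S \<noteq> S' \<or> T \<noteq> T' \<Longrightarrow> products S T \<inter> products S' T' = {}"
  by (auto simp: products_def paths_def)

lemma sum_lessThan_add:
  fixes g :: "nat \<Rightarrow> nat"
  shows "(\<Sum>p<a + b. g p) = (\<Sum>p<a. g p) + (\<Sum>q<b. g (a + q))"
  by (induction b) simp_all

text \<open>
  A letter in the first block changes the first block only.
\<close>

lemma insert_at_early_in_products:
  assumes S: "S \<in> paths (Suc m)" and T: "T \<in> paths n" and p: "p < Suc m"
  shows "{U \<in> paths (m + n). insert_at p U \<in> products S T} =
     (\<Union>S'\<in>{S' \<in> paths m. insert_at p S' = S}. products S' T)" (is "?L = ?R")
proof -
  have "U \<in> ?L \<longleftrightarrow> U \<in> ?R" for U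
  proof (cases "U \<in> paths (m + n)")
    case True
    then have U: "grows {} U" "length U = m + n" by (simp_all add: paths_def)
    have "insert_at p U \<in> paths (Suc m + n)"
      using insert_from_structure[OF U(1), of p] p U(2) by (auto simp: paths_def length_insert_from)
    then have "U \<in> ?L \<longleftrightarrow> insert_at p (take m U) = S \<and> (promote ^^ m) U = T"
      using True S T p U promote_pow_insert_at_passed[OF U(1), of p m]
        take_insert_from_after[of p m U "{}"]
      by (simp add: products_def paths_def del: funpow.simps)
    also have "\<dots> \<longleftrightarrow> U \<in> ?R"
      using True T take_path[OF True, of m] by (auto simp: products_def paths_def)
    finally show ?thesis .
  qed (use T in \<open>auto simp: products_def paths_def\<close>)
  then show ?thesis by blast
qed

text \<open>
  A letter behind the first block changes the second block only.
\<close>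

lemma insert_at_late_in_products:
  assumes S: "S \<in> paths m" and T: "T \<in> paths (Suc n)" and q: "q < Suc n"
  shows "{U \<in> paths (m + n). insert_at (m + q) U \<in> products S T} =
     (\<Union>T'\<in>{T' \<in> paths n. insert_at q T' = T}. products S T')" (is "?L = ?R")
proof -
  have "U \<in> ?L \<longleftrightarrow> U \<in> ?R" for U
  proof (cases "U \<in> paths (m + n)")
    case True
    then have U: "grows {} U" "length U = m + n" by (simp_all add: paths_def)
    have "insert_at (m + q) U \<in> paths (m + Suc n)"
      using insert_from_structure[OF U(1), of "m + q"] q U(2) by (auto simp: paths_def length_insert_from)
    then have "U \<in> ?L \<longleftrightarrow> take m U = S \<and> insert_at q ((promote ^^ m) U) = T"
      using True S T q U promote_pow_insert_at[OF U(1), of "m + q" m]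
        take_insert_from_before[of m "m + q" U "{}"]
      by (simp add: products_def paths_def)
    also have "\<dots> \<longleftrightarrow> U \<in> ?R"
      using True S promote_pow_path[OF True] by (auto simp: products_def paths_def)
    finally show ?thesis .
  qed (use S in \<open>auto simp: products_def paths_def\<close>)
  then show ?thesis by blast
qed

lemma sum_num_paths_preimages:
  assumes S: "S \<in> paths (Suc m)"
  shows "(\<Sum>p<Suc m. \<Sum>S'\<in>{S' \<in> paths m. insert_at p S' = S}. num_paths (set S')) = num_paths (set S)"
  using sum_num_paths_insertion[of "{S}" m] S by simp

text \<open>
  On words this says that there are \<open>m + n choose m\<close> ways to distribute the values among the
  two blocks.  The proof removes the largest letter, which belongs to one of the blocks, so that
  both sides satisfy the recursion of Pascal's triangle.
\<close>

lemma sum_products: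
  "S \<in> paths m \<Longrightarrow> T \<in> paths n \<Longrightarrow>
   (\<Sum>U\<in>products S T. num_paths (set U)) = ((m + n) choose m) * (num_paths (set S) * num_paths (set T))"
proof (induction "m + n" arbitrary: m n S T)
  case 0
  then have "products S T = {[]}" by (auto simp: products_def paths_def)
  then show ?case using 0 by simp
next
  case (Suc N)
  consider "m = 0" | "n = 0" | m' n' where "m = Suc m'" "n = Suc n'"
    by (meson not0_implies_Suc)
  then show ?case
  proof cases
    case 1
    then have "products S T = {T}" using Suc.prems by (auto simp: products_def paths_def)
    then show ?thesis using 1 Suc.prems by simp
  next
    case 2
    have "(promote ^^ length S) S = []"
      using length_promote_pow[of "length S" S] by simp
    then have "products S T = {S}" using 2 Suc.prems by (auto simp: products_def paths_def)
    then show ?thesis using 2 Suc.prems by simp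
  next
    case 3
    let ?f = "\<lambda>U. num_paths (set U)"
    have lens: "length S = Suc m'" "length T = Suc n'" using Suc.prems 3 by (simp_all add: paths_def)
    have N: "N = m' + Suc n'" "N = Suc m' + n'" using Suc.hyps 3 by simp_all
    have sub: "products S T \<subseteq> paths (Suc N)"
      using products_subset[of S T] lens N by simp
    have early: "(\<Sum>bs\<in>{bs \<in> paths N. insert_at p bs \<in> products S T}. ?f bs) =
      (N choose m') * ((\<Sum>S'\<in>{S' \<in> paths m'. insert_at p S' = S}. ?f S') * ?f T)"
      if "p < Suc m'" for p
    proof -
      have "(\<Sum>bs\<in>{bs \<in> paths N. insert_at p bs \<in> products S T}. ?f bs) =
        (\<Sum>S'\<in>{S' \<in> paths m'. insert_at p S' = S}. \<Sum>U\<in>products S' T. ?f U)"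
        unfolding N(1) insert_at_early_in_products[OF Suc.prems[unfolded 3] that]
        by (rule sum.UNION_disjoint) (auto simp: products_Int[of _ m'])
      also have "\<dots> = (\<Sum>S'\<in>{S' \<in> paths m'. insert_at p S' = S}. (N choose m') * (?f S' * ?f T))"
        using Suc.hyps(1)[OF N(1)] Suc.prems 3 N(1) by (intro sum.cong) simp_all
      finally show ?thesis by (simp add: sum_distrib_left sum_distrib_right)
    qed
    have late: "(\<Sum>bs\<in>{bs \<in> paths N. insert_at (Suc m' + q) bs \<in> products S T}. ?f bs) =
      (N choose Suc m') * (?f S * (\<Sum>T'\<in>{T' \<in> paths n'. insert_at q T' = T}. ?f T'))"
      if "q < Suc n'" for q
    proof -
      have "(\<Sum>bs\<in>{bs \<in> paths N. insert_at (Suc m' + q) bs \<in> products S T}. ?f bs) =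
        (\<Sum>T'\<in>{T' \<in> paths n'. insert_at q T' = T}. \<Sum>U\<in>products S T'. ?f U)"
        unfolding N(2) insert_at_late_in_products[OF Suc.prems[unfolded 3] that]
        by (rule sum.UNION_disjoint) (simp_all add: products_Int[OF Suc.prems(1) Suc.prems(1)])
      also have "\<dots> = (\<Sum>T'\<in>{T' \<in> paths n'. insert_at q T' = T}. (N choose Suc m') * (?f S * ?f T'))"
        using Suc.hyps(1)[OF N(2)] Suc.prems 3 N(2) by (intro sum.cong) simp_all
      finally show ?thesis by (simp add: sum_distrib_left)
    qed
    have "(\<Sum>U\<in>products S T. ?f U) =
      (\<Sum>p<Suc m' + Suc n'. \<Sum>bs\<in>{bs \<in> paths N. insert_at p bs \<in> products S T}. ?f bs)"
      using sum_num_paths_insertion[OF sub] N(2) by simp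
    also have "\<dots> =
      (\<Sum>p<Suc m'. (N choose m') * ((\<Sum>S'\<in>{S' \<in> paths m'. insert_at p S' = S}. ?f S') * ?f T)) +
      (\<Sum>q<Suc n'. (N choose Suc m') * (?f S * (\<Sum>T'\<in>{T' \<in> paths n'. insert_at q T' = T}. ?f T')))"
      unfolding sum_lessThan_add by (intro arg_cong2[of _ _ _ _ "(+)"] sum.cong refl early late) simp_all
    also have "\<dots> = (N choose m') * (?f S * ?f T) + (N choose Suc m') * (?f S * ?f T)"
      unfolding sum_distrib_left[symmetric] sum_distrib_right[symmetric]
      using sum_num_paths_preimages[of S m'] sum_num_paths_preimages[of T n'] Suc.prems 3 by simp
    also have "\<dots> = (Suc N choose Suc m') * (?f S * ?f T)"
      by (simp add: algebra_simps)
    finally show ?thesis using 3 N by simp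
  qed
qed

section \<open>Path weights\<close>

text \<open>
  This turns out to be the probability that the Plancherel growth process starts with the path \<open>U\<close>.
\<close>

definition weight :: "box list \<Rightarrow> real" where
  "weight U = real (num_paths (set U)) / fact (length U)"

lemma weight_nonneg: "0 \<le> weight U"
  by (simp add: weight_def)

lemma weight_Nil [simp]: "weight [] = 1"
  by (simp add: weight_def)

lemma weight_pos: "grows {} U \<Longrightarrow> 0 < weight U"
proof -
  assume "grows {} U"
  then have "num_paths (set U) \<noteq> 0" unfolding num_paths_def by (subst card_0_eq) auto
  then show ?thesis by (simp add: weight_def)
qed

text \<open>
  The binomial coefficient in \<open>sum_products\<close> is absorbed by the factorials: initial block and
  remainder are independent.
\<close>

lemma sum_weight_products:
  assumes S: "S \<in> paths m" and T: "T \<in> paths n"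
  shows "(\<Sum>U\<in>products S T. weight U) = weight S * weight T"
proof -
  have "(\<Sum>U\<in>products S T. weight U) = (\<Sum>U\<in>products S T. real (num_paths (set U)) / fact (m + n))"
    using S T by (intro sum.cong) (auto simp: products_def paths_def weight_def)
  also have "\<dots> = real (\<Sum>U\<in>products S T. num_paths (set U)) / fact (m + n)"
    by (simp add: sum_divide_distrib)
  also have "\<dots> = weight S * weight T"
    using S T unfolding sum_products[OF S T]
    by (simp add: weight_def paths_def binomial_fact field_simps)
  finally show ?thesis .
qed

lemma sum_weight_two_blocks:
  assumes X: "X \<subseteq> paths m" and Y: "Y \<subseteq> paths n"
  shows "(\<Sum>U\<in>{U \<in> paths (m + n). take m U \<in> X \<and> (promote ^^ m) U \<in> Y}. weight U) =
    (\<Sum>S\<in>X. weight S) * (\<Sum>T\<in>Y. weight T)"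
proof -
  have fin: "finite X" "finite Y" using X Y finite_paths finite_subset by blast+
  have "{U \<in> paths (m + n). take m U \<in> X \<and> (promote ^^ m) U \<in> Y} =
      (\<Union>(S, T)\<in>X \<times> Y. products S T)"
    using X Y by (auto simp: products_def paths_def subset_iff)
  also have "(\<Sum>U\<in>\<dots>. weight U) = (\<Sum>(S, T)\<in>X \<times> Y. \<Sum>U\<in>products S T. weight U)"
    using fin by (subst sum.UNION_disjoint)
      (auto simp: case_prod_unfold products_Int[OF subsetD[OF X] subsetD[OF X]])
  also have "\<dots> = (\<Sum>(S, T)\<in>X \<times> Y. weight S * weight T)"
    using sum_weight_products[OF subsetD[OF X] subsetD[OF Y]] by (intro sum.cong) auto
  also have "\<dots> = (\<Sum>S\<in>X. weight S) * (\<Sum>T\<in>Y. weight T)"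
    by (simp add: sum_product sum.cartesian_product)
  finally show ?thesis .
qed

lemma paths_1: "paths (Suc 0) = {[(1, 1)]}"
proof (intro equalityI subsetI)
  fix U assume U: "U \<in> paths (Suc 0)"
  then obtain b where "U = [b]" by (auto simp: paths_def length_Suc_conv)
  then show "U \<in> {[(1, 1)]}" using U grows_first[of b "[]"] by (simp add: paths_def)
next
  fix U :: "box list" assume "U \<in> {[(1, 1)]}"
  moreover have "addable {} (1, 1)" by (simp add: addable_iff)
  ultimately show "U \<in> paths (Suc 0)" by (auto simp: paths_def addable_def)
qed

lemma num_paths_single: "num_paths {(1, 1)} = 1"
proof -
  have "{bs \<in> paths (card {(1::nat, 1::nat)}). set bs = {(1, 1)}} = {[(1, 1)]}"
    by (auto simp: paths_1)
  then show ?thesis unfolding num_paths_def paths_to_eq by simp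
qed

lemma sum_weight_paths: "(\<Sum>U\<in>paths n. weight U) = 1"
proof (induction n)
  case (Suc n)
  have w1: "(\<Sum>T\<in>paths (Suc 0). weight T) = 1"
    using num_paths_single by (simp add: paths_1 weight_def)
  have "{U \<in> paths (n + Suc 0). take n U \<in> paths n \<and> (promote ^^ n) U \<in> paths (Suc 0)} = paths (Suc n)"
    using take_path[of _ "Suc n" n] promote_pow_path[of _ n "Suc 0"] by auto
  then show ?case
    using sum_weight_two_blocks[of "paths n" n "paths (Suc 0)" "Suc 0"] Suc w1 by simp
qed simp

lemma young_remove_corner:
  assumes D: "young D" "D \<noteq> {}"
  obtains e where "e \<in> D" "young (D - {e})"
proof -
  define h where "h = (\<lambda>b::box. fst b + snd b)"
  have fin: "finite (h ` D)" "h ` D \<noteq> {}" using D young_finite[OF D(1)] by auto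
  obtain e where e: "e \<in> D" "h e = Max (h ` D)" using Max_in[OF fin] by auto
  have max: "h b \<le> h e" if "b \<in> D" for b
    unfolding e(2) by (rule Max_ge[OF fin(1)]) (use that in simp)
  have "young (D - {e})"
  proof (rule youngI)
    show "finite (D - {e})" "D - {e} \<subseteq> boxes"
      using young_finite[OF D(1)] young_subset[OF D(1)] by auto
    fix i j k l assume a: "(i, j) \<in> D - {e}" "1 \<le> k" "k \<le> i" "1 \<le> l" "l \<le> j"
    then have "(k, l) \<in> D" using youngD[OF D(1), of i j k l] by auto
    moreover have "(k, l) \<noteq> e"
    proof
      assume "(k, l) = e"
      then have "i + j \<le> k + l" using max[of "(i, j)"] a by (auto simp: h_def)
      then show False using a \<open>(k, l) = e\<close> by auto
    qed
    ultimately show "(k, l) \<in> D - {e}" by simp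
  qed
  then show thesis using that e(1) by blast
qed

lemma young_has_path:
  "young D \<Longrightarrow> \<exists>bs. grows {} bs \<and> set bs = D"
proof (induction "card D" arbitrary: D)
  case 0
  then show ?case using young_finite by (intro exI[of _ "[]"]) auto
next
  case (Suc n)
  have "D \<noteq> {}" using Suc.hyps(2) by auto
  with Suc.prems obtain e where e: "e \<in> D" "young (D - {e})"
    by (rule young_remove_corner)
  have "n = card (D - {e})"
    using Suc.hyps(2) card_Suc_Diff1[OF young_finite[OF Suc.prems] e(1)] by linarith
  then obtain bs where bs: "grows {} bs" "set bs = D - {e}"
    using Suc.hyps(1)[OF _ e(2)] by auto
  have "insert e (D - {e}) = D" using e by auto
  then have "grows {} (bs @ [e])" using bs e Suc.prems by (simp add: grows_snoc addable_def)
  then show ?case using bs e by (intro exI[of _ "bs @ [e]"]) auto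
qed

text \<open>
  Cut a path into \<open>K\<close> blocks of \<open>card R\<close> boxes each.  If one of the blocks, after the jeu de taquin
  map has removed everything before it, is a given path \<open>T\<close> of shape \<open>R\<close>, then the whole path contains \<open>R\<close>,
  because sliding only moves entries inside the shape.  By independence, all blocks avoid \<open>T\<close> with weight
  \<open>(1 - weight T) ^ K\<close>.
\<close>

lemma weight_missing_shape:
  assumes R: "young R" "R \<noteq> {}"
  shows "\<exists>q<1. 0 \<le> q \<and> (\<forall>K. (\<Sum>U\<in>{U \<in> paths (K * card R). \<not> R \<subseteq> set U}. weight U) \<le> q ^ K)"
proof -
  obtain T where T: "grows {} T" "set T = R" using young_has_path[OF R(1)] by blast
  define r where "r = card R"
  have Tp: "T \<in> paths r" using T grows_distinct[of "{}" T] by (auto simp: paths_def r_def distinct_card)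
  define q where "q = 1 - weight T"
  have "(\<Sum>U\<in>{T}. weight U) \<le> (\<Sum>U\<in>paths r. weight U)"
    using Tp by (intro sum_mono2) (auto simp: weight_nonneg)
  then have q: "0 \<le> q" "q < 1"
    using weight_pos[OF T(1)] by (simp_all add: q_def sum_weight_paths)
  have qsum: "(\<Sum>U\<in>paths r - {T}. weight U) = q"
    using Tp by (simp add: sum_diff1 sum_weight_paths q_def)
  have "(\<Sum>U\<in>{U \<in> paths (K * r). \<not> R \<subseteq> set U}. weight U) \<le> q ^ K" for K
  proof (induction K)
    case 0
    have "{U \<in> paths (0 * r). \<not> R \<subseteq> set U} = {[]}" using R by auto
    then show ?case by simp
  next
    case (Suc K)
    let ?X = "{U \<in> paths (K * r). \<not> R \<subseteq> set U}"
    have "{U \<in> paths (Suc K * r). \<not> R \<subseteq> set U} \<subseteq>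
        {U \<in> paths (K * r + r). take (K * r) U \<in> ?X \<and> (promote ^^ (K * r)) U \<in> paths r - {T}}"
    proof
      fix U assume "U \<in> {U \<in> paths (Suc K * r). \<not> R \<subseteq> set U}"
      then have U: "U \<in> paths (K * r + r)" "\<not> R \<subseteq> set U" by (simp_all add: add.commute)
      have "\<not> R \<subseteq> set (take (K * r) U)" using U(2) set_take_subset[of "K * r" U] by blast
      moreover have "(promote ^^ (K * r)) U \<noteq> T" using U(2) T(2) set_promote_pow[of "K * r" U] by blast
      ultimately show "U \<in> {U \<in> paths (K * r + r). take (K * r) U \<in> ?X \<and> (promote ^^ (K * r)) U \<in> paths r - {T}}"
        using U(1) take_path[OF U(1), of "K * r"] promote_pow_path[OF U(1)] by simp
    qed
    then have "(\<Sum>U\<in>{U \<in> paths (Suc K * r). \<not> R \<subseteq> set U}. weight U) \<le>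
        (\<Sum>U\<in>{U \<in> paths (K * r + r). take (K * r) U \<in> ?X \<and> (promote ^^ (K * r)) U \<in> paths r - {T}}. weight U)"
      by (intro sum_mono2) (auto simp: weight_nonneg)
    also have "\<dots> = (\<Sum>U\<in>?X. weight U) * q"
      by (subst sum_weight_two_blocks) (auto simp: qsum)
    also have "\<dots> \<le> q ^ K * q" using Suc q by (intro mult_right_mono) auto
    finally show ?case by (simp add: mult.commute)
  qed
  then show ?thesis using q unfolding r_def by blast
qed

section \<open>Young diagrams as partitions, tableaux as paths\<close>

lemma initial_segment:
  fixes A :: "nat set"
  assumes "finite A" "\<And>x. x \<in> A \<Longrightarrow> 1 \<le> x" "\<And>x y. x \<in> A \<Longrightarrow> 1 \<le> y \<Longrightarrow> y \<le> x \<Longrightarrow> y \<in> A"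
  shows "A = {1..card A}"
proof (cases "A = {}")
  case False
  have "A = {1..Max A}"
  proof (intro equalityI subsetI)
    show "x \<in> {1..Max A}" if "x \<in> A" for x
      using assms(2)[OF that] Max_ge[OF assms(1) that] by simp
    show "x \<in> A" if "x \<in> {1..Max A}" for x
      by (rule assms(3)[OF Max_in[OF assms(1) False]]) (use that in auto)
  qed
  then have "card A = Max A" by (metis card_atLeastAtMost diff_Suc_1)
  then show ?thesis using \<open>A = {1..Max A}\<close> by simp
qed simp

lemma card_diagram: "card (diagram p) = sum_list p"
proof -
  have "diagram p = (\<lambda>(j, i). (i, Suc j)) ` (SIGMA j:{0..<length p}. {1..p ! j})"
  proof (intro equalityI subsetI)
    fix b assume "b \<in> diagram p"
    then obtain i j where "b = (i, j)" "1 \<le> j" "j \<le> length p" "1 \<le> i" "i \<le> p ! (j - 1)"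
      by (auto simp: diagram_def)
    then show "b \<in> (\<lambda>(j, i). (i, Suc j)) ` (SIGMA j:{0..<length p}. {1..p ! j})"
      by (intro image_eqI[of _ _ "(j - 1, i)"]) auto
  qed (auto simp: diagram_def)
  moreover have "inj_on (\<lambda>(j, i). (i, Suc j)) (SIGMA j:{0..<length p}. {1..p ! j})"
    by (auto simp: inj_on_def)
  ultimately have "card (diagram p) = card (SIGMA j:{0..<length p}. {1..p ! j})"
    by (simp add: card_image)
  also have "\<dots> = (\<Sum>j = 0..<length p. p ! j)" by (subst card_SigmaI) auto
  finally show ?thesis by (simp add: sum_list_sum_nth)
qed

lemma young_diagram: "sorted_wrt (\<ge>) p \<Longrightarrow> young (diagram p)"
proof (rule youngI)
  show "diagram p \<subseteq> boxes" by (auto simp: diagram_def boxes_def)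
  have "diagram p \<subseteq> (\<Union>j\<in>{1..length p}. {1..p ! (j - 1)} \<times> {j})" by (auto simp: diagram_def)
  then show "finite (diagram p)" by (rule finite_subset) auto
  fix i j k l
  assume a: "sorted_wrt (\<ge>) p" "(i, j) \<in> diagram p" "1 \<le> k" "k \<le> i" "1 \<le> l" "l \<le> j"
  then have j: "j \<le> length p" "i \<le> p ! (j - 1)" by (auto simp: diagram_def)
  have "p ! (j - 1) \<le> p ! (l - 1)"
  proof (cases "l = j")
    case False
    then have "l - 1 < j - 1" "j - 1 < length p" using a j by auto
    then show ?thesis using sorted_wrt_nth_less[OF a(1)] by blast
  qed simp
  then show "(k, l) \<in> diagram p" using a j by (auto simp: diagram_def)
qed

lemma young_eq_diagram:
  assumes D: "young D"
  shows "\<exists>p. sorted_wrt (\<ge>) p \<and> (\<forall>x\<in>set p. x > 0) \<and> diagram p = D"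
proof -
  define r where "r j = card {i. (i, j) \<in> D}" for j
  define h where "h = card {j. (1, j) \<in> D}"
  have fin: "finite {i. (i, j) \<in> D}" for j
    using finite_vimageI[OF young_finite[OF D], of "\<lambda>i. (i, j)"] by (simp add: vimage_def inj_on_def)
  have finc: "finite {j. (i, j) \<in> D}" for i
    using finite_vimageI[OF young_finite[OF D], of "Pair i"] by (simp add: vimage_def inj_on_def)
  have row: "{i. (i, j) \<in> D} = {1..r j}" for j
    unfolding r_def
  proof (rule initial_segment[OF fin])
    show "1 \<le> x" if "x \<in> {i. (i, j) \<in> D}" for x using young_pos[OF D, of x j] that by simp
    show "y \<in> {i. (i, j) \<in> D}" if "x \<in> {i. (i, j) \<in> D}" "1 \<le> y" "y \<le> x" for x y
      using youngD[OF D, of x j y j] young_pos[OF D, of x j] that by simp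
  qed
  have col: "{j. (1, j) \<in> D} = {1..h}"
    unfolding h_def
  proof (rule initial_segment[OF finc])
    show "1 \<le> x" if "x \<in> {j. (1, j) \<in> D}" for x using young_pos[OF D, of 1 x] that by simp
    show "y \<in> {j. (1, j) \<in> D}" if "x \<in> {j. (1, j) \<in> D}" "1 \<le> y" "y \<le> x" for x y
      using youngD[OF D, of 1 x 1 y] that by simp
  qed
  have mem: "(i, j) \<in> D \<longleftrightarrow> 1 \<le> i \<and> i \<le> r j" for i j
    using row[of j] by (auto simp: set_eq_iff)
  have mem1: "(1, j) \<in> D \<longleftrightarrow> 1 \<le> j \<and> j \<le> h" for j
    using col by (auto simp: set_eq_iff)
  have anti: "r j' \<le> r j" if "1 \<le> j" "j \<le> j'" for j j'
  proof (cases "r j' = 0")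
    case False
    then have "(r j', j') \<in> D" by (simp add: mem)
    then have "(r j', j) \<in> D" using youngD[OF D, of "r j'" j' "r j'" j] that False by simp
    then show ?thesis by (simp add: mem)
  qed simp
  define p where "p = map (\<lambda>j. r (Suc j)) [0..<h]"
  have "sorted_wrt (\<ge>) p"
    unfolding p_def sorted_wrt_map
    by (rule sorted_wrt_mono_rel[OF _ sorted_wrt_upt]) (auto intro: anti)
  moreover have "\<forall>x\<in>set p. x > 0"
  proof
    fix x assume "x \<in> set p"
    then obtain j where j: "j < h" "x = r (Suc j)" by (auto simp: p_def)
    then have "(1, Suc j) \<in> D" using mem1[of "Suc j"] by simp
    then show "x > 0" using mem[of 1 "Suc j"] j by simp
  qed
  moreover have "diagram p = D"
  proof -
    have "(i, j) \<in> diagram p \<longleftrightarrow> (i, j) \<in> D" for i j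
    proof
      assume "(i, j) \<in> diagram p"
      then show "(i, j) \<in> D" by (auto simp: diagram_def p_def mem)
    next
      assume a: "(i, j) \<in> D"
      then have "1 \<le> j \<and> j \<le> h"
        using mem1[of j] youngD[OF D, of i j 1 j] young_pos[OF D, of i j] by auto
      then show "(i, j) \<in> diagram p" using a by (auto simp: diagram_def p_def mem)
    qed
    then show ?thesis by auto
  qed
  ultimately show ?thesis by blast
qed

lemma young_diagrams_eq: "young_diagrams n = {D. young D \<and> card D = n}"
proof (intro equalityI subsetI)
  fix D assume "D \<in> young_diagrams n"
  then show "D \<in> {D. young D \<and> card D = n}"
    by (auto simp: young_diagrams_def partitions_def card_diagram intro: young_diagram)
next
  fix D assume "D \<in> {D. young D \<and> card D = n}"
  then obtain p where "sorted_wrt (\<ge>) p" "\<forall>x\<in>set p. x > 0" "diagram p = D" "card D = n"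
    using young_eq_diagram by blast
  then show "D \<in> young_diagrams n"
    using card_diagram[of p] by (auto simp: young_diagrams_def partitions_def)
qed

lemma finite_young_diagrams: "finite (young_diagrams n)"
proof (rule finite_subset)
  show "young_diagrams n \<subseteq> set ` paths n"
  proof
    fix D assume "D \<in> young_diagrams n"
    then have D: "young D" "card D = n" by (simp_all add: young_diagrams_eq)
    obtain bs where bs: "grows {} bs" "set bs = D" using young_has_path[OF D(1)] by blast
    then have "bs \<in> paths n" using D grows_distinct[of "{}" bs] by (auto simp: paths_def distinct_card)
    then show "D \<in> set ` paths n" using bs by blast
  qed
qed simp

text \<open>
  With \<open>B\<close> a Young diagram this covers finite
  tableaux, with \<open>B = boxes\<close> the beginnings of infinite ones.
\<close>

definition path_of :: "box set \<Rightarrow> (box \<Rightarrow> nat) \<Rightarrow> nat \<Rightarrow> box list" where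
  "path_of B t n = map (inv_into B t) [1..<Suc n]"

lemma length_path_of [simp]: "length (path_of B t n) = n"
  by (simp add: path_of_def)

lemma path_of_Suc: "path_of B t (Suc n) = path_of B t n @ [inv_into B t (Suc n)]"
  by (simp add: path_of_def)

lemma take_path_of: "m \<le> n \<Longrightarrow> take m (path_of B t n) = path_of B t m"
  by (simp add: path_of_def take_map take_upt del: upt_Suc)

lemma nth_path_of: "k < n \<Longrightarrow> path_of B t n ! k = inv_into B t (Suc k)"
  by (simp add: path_of_def del: upt_Suc)

definition down_closed :: "box set \<Rightarrow> bool" where
  "down_closed B \<longleftrightarrow> B \<subseteq> boxes \<and>
     (\<forall>i j k l. (i, j) \<in> B \<longrightarrow> 1 \<le> k \<longrightarrow> k \<le> i \<longrightarrow> 1 \<le> l \<longrightarrow> l \<le> j \<longrightarrow> (k, l) \<in> B)"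

lemma down_closed_young: "young D \<Longrightarrow> down_closed D"
  by (simp add: young_def down_closed_def)

lemma down_closed_boxes: "down_closed boxes"
  by (auto simp: boxes_def down_closed_def)

lemma down_closedD:
  "down_closed B \<Longrightarrow> (i, j) \<in> B \<Longrightarrow> 1 \<le> k \<Longrightarrow> k \<le> i \<Longrightarrow> 1 \<le> l \<Longrightarrow> l \<le> j \<Longrightarrow> (k, l) \<in> B"
  unfolding down_closed_def by blast

lemma increasing_on_mono:
  assumes B: "down_closed B" and t: "increasing_on B t"
    and ij: "(i, j) \<in> B" and k: "1 \<le> k" "k \<le> i" and l: "1 \<le> l" "l \<le> j"
  shows "t (k, l) \<le> t (i, j)"
proof -
  have "t (k, j) \<le> t (i, j)"
    using k(2) ij
  proof (induction i rule: dec_induct)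
    case (step i)
    have "(i, j) \<in> B" using down_closedD[OF B step.prems, of i j] step.hyps k l by simp
    then show ?case using step t unfolding increasing_on_def by fastforce
  qed simp
  moreover have kj: "(k, j) \<in> B" using down_closedD[OF B ij, of k j] k l by simp
  have "t (k, l) \<le> t (k, j)"
    using l(2) kj
  proof (induction j rule: dec_induct)
    case (step j)
    have "(k, j) \<in> B" using down_closedD[OF B step.prems, of k j] step.hyps k l by simp
    then show ?case using step t unfolding increasing_on_def by fastforce
  qed simp
  ultimately show ?thesis by simp
qed

text \<open>
  The converse of the fact that the boxes with small entries form a Young diagram.
\<close>

lemma increasing_onI_sublevels:
  assumes B: "B \<subseteq> boxes" and inj: "inj_on t B" and sub: "\<And>k. young {b \<in> B. t b \<le> k}"
  shows "increasing_on B t"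
proof -
  have "t (i, j) < t (i', j')"
    if "(i, j) \<in> B" "(i', j') \<in> B" "i \<le> i'" "j \<le> j'" "(i, j) \<noteq> (i', j')" for i j i' j'
  proof -
    have "(i, j) \<in> {b \<in> B. t b \<le> t (i', j')}"
      by (rule youngD[OF sub]) (use that B in \<open>auto simp: boxes_def\<close>)
    moreover have "t (i, j) \<noteq> t (i', j')" using inj that by (auto dest: inj_onD)
    ultimately show ?thesis by simp
  qed
  then show ?thesis unfolding increasing_on_def by simp
qed

lemma set_path_of:
  assumes inj: "inj_on t B" and im: "{1..n} \<subseteq> t ` B" "t ` B \<subseteq> {1..}"
  shows "set (path_of B t n) = {b \<in> B. t b \<le> n}"
proof (intro equalityI subsetI)
  fix b assume "b \<in> set (path_of B t n)"
  then have "b \<in> inv_into B t ` {1..<Suc n}" by (simp add: path_of_def del: upt_Suc)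
  then obtain k where k: "k \<in> {1..n}" "b = inv_into B t k" by (auto simp: atLeastLessThanSuc_atLeastAtMost)
  then have "k \<in> t ` B" using im by blast
  then show "b \<in> {b \<in> B. t b \<le> n}" using k by (auto simp: f_inv_into_f inv_into_into)
next
  fix b assume b: "b \<in> {b \<in> B. t b \<le> n}"
  then have "t b \<in> {1..n}" using im by auto
  moreover have "b = inv_into B t (t b)" using b inj by simp
  ultimately show "b \<in> set (path_of B t n)"
    unfolding path_of_def set_map by (intro image_eqI[of _ _ "t b"]) auto
qed

lemma grows_path_of:
  assumes B: "down_closed B" and inj: "inj_on t B" and im: "{1..n} \<subseteq> t ` B" "t ` B \<subseteq> {1..}"
    and inc: "increasing_on B t"
  shows "grows {} (path_of B t n)"
  using im(1)
proof (induction n)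
  case 0
  then show ?case by (simp add: path_of_def)
next
  case (Suc n)
  have young: "young (set (path_of B t m))" if "m \<le> Suc n" for m
  proof (rule youngI)
    have m: "{1..m} \<subseteq> t ` B" using Suc.prems that by auto
    note s = set_path_of[OF inj m im(2)]
    show "finite (set (path_of B t m))" by simp
    show "set (path_of B t m) \<subseteq> boxes" using B unfolding s down_closed_def by blast
    show "(k, l) \<in> set (path_of B t m)"
      if "(i, j) \<in> set (path_of B t m)" "1 \<le> k" "k \<le> i" "1 \<le> l" "l \<le> j" for i j k l
      using that increasing_on_mono[OF B inc, of i j k l] down_closedD[OF B, of i j k l]
      unfolding s by auto
  qed
  have "{1..n} \<subseteq> t ` B" using Suc.prems by auto
  note s = set_path_of[OF inj this im(2)]
  have "Suc n \<in> t ` B" using Suc.prems by auto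
  then have "inv_into B t (Suc n) \<notin> set (path_of B t n)"
    unfolding s by (simp add: f_inv_into_f)
  then have "addable (set (path_of B t n)) (inv_into B t (Suc n))"
    using young[of n] young[of "Suc n"] by (simp add: addable_def path_of_Suc)
  then show ?case
    using Suc.IH \<open>{1..n} \<subseteq> t ` B\<close> by (simp add: path_of_Suc grows_snoc)
qed

text \<open>
  A standard tableau and the list of its boxes in the order of their entries determine each other.
\<close>

lemma num_syt_eq:
  assumes D: "young D"
  shows "num_syt D = num_paths D"
proof -
  define n where "n = card D"
  define pos where "pos bs b = Suc (THE k. k < length bs \<and> bs ! k = b)" for bs and b :: box
  have pos_nth: "pos bs (bs ! k) = Suc k" if "distinct bs" "k < length bs" for bs k
  proof -
    have "(THE j. j < length bs \<and> bs ! j = bs ! k) = k"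
      using that by (intro the_equality) (auto simp: nth_eq_iff_index_eq)
    then show ?thesis by (simp add: pos_def)
  qed
  have len: "length bs = n \<and> distinct bs" if "grows {} bs" "set bs = D" for bs
    using that grows_distinct[of "{}" bs] by (auto simp: n_def distinct_card)
  have "bij_betw (\<lambda>t. path_of D t n) (standard_tableaux D) {bs. grows {} bs \<and> set bs = D}"
  proof (rule bij_betwI[where g = "\<lambda>bs. restrict (pos bs) D"])
    have t: "inj_on t D" "t ` D = {1..n}" "increasing_on D t" "t \<in> extensional D"
      if "t \<in> standard_tableaux D" for t
      using that by (auto simp: standard_tableaux_def bij_betw_def n_def)
    show "(\<lambda>t. path_of D t n) \<in> standard_tableaux D \<rightarrow> {bs. grows {} bs \<and> set bs = D}"
    proof
      fix t assume "t \<in> standard_tableaux D"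
      note t = t[OF this]
      have "set (path_of D t n) = D"
        using set_path_of[OF t(1), of n] t(2) by auto
      then show "path_of D t n \<in> {bs. grows {} bs \<and> set bs = D}"
        using grows_path_of[OF down_closed_young[OF D] t(1), of n] t by simp
    qed
    show "(\<lambda>bs. restrict (pos bs) D) \<in> {bs. grows {} bs \<and> set bs = D} \<rightarrow> standard_tableaux D"
    proof
      fix bs assume "bs \<in> {bs. grows {} bs \<and> set bs = D}"
      then have bs: "grows {} bs" "set bs = D" "length bs = n" "distinct bs" using len by auto
      let ?t = "restrict (pos bs) D"
      have val: "?t (bs ! k) = Suc k" if "k < n" for k
        using that bs pos_nth[of bs k] nth_mem[of k bs] by simp
      have D_nth: "D = (!) bs ` {..<n}" using bs by (auto simp: set_conv_nth)
      have im: "?t ` D = {1..n}"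
      proof -
        have "?t ` D = Suc ` {..<n}" unfolding D_nth image_image using val D_nth by (intro image_cong) auto
        then show ?thesis by (auto simp: image_Suc_lessThan)
      qed
      have "card (?t ` D) = card D" using im by (simp add: n_def)
      then have inj: "inj_on ?t D" using young_finite[OF D] eq_card_imp_inj_on by blast
      have "young {b \<in> D. ?t b \<le> k}" for k
      proof -
        have "{b \<in> D. ?t b \<le> k} = set (take k bs)"
        proof (intro equalityI subsetI)
          fix b assume "b \<in> {b \<in> D. ?t b \<le> k}"
          moreover then obtain j where "j < n" "b = bs ! j" unfolding D_nth by auto
          ultimately have "j < k" "j < n" "b = bs ! j" using val[of j] by auto
          then show "b \<in> set (take k bs)" using bs by (auto simp: in_set_conv_nth)
        next
          fix b assume "b \<in> set (take k bs)"
          then obtain j where "j < k" "j < n" "b = bs ! j" using bs by (auto simp: in_set_conv_nth)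
          then show "b \<in> {b \<in> D. ?t b \<le> k}" using val[of j] bs by auto
        qed
        then show ?thesis using grows_young_union[OF grows_take[OF bs(1)], of k] by simp
      qed
      then have "increasing_on D ?t"
        using inj young_subset[OF D] by (intro increasing_onI_sublevels)
      then show "?t \<in> standard_tableaux D"
        using inj im by (simp add: standard_tableaux_def bij_betw_def n_def)
    qed
    show "restrict (pos (path_of D t n)) D = t" if t': "t \<in> standard_tableaux D" for t
    proof (rule extensionalityI)
      note t = t[OF t']
      fix b assume b: "b \<in> D"
      then have "t b \<in> {1..n}" using t(2) by blast
      then obtain k where k: "t b = Suc k" "k < n" by (cases "t b") auto
      have "path_of D t n ! k = b" using k b t(1) inv_into_f_f[OF t(1) b] by (simp add: nth_path_of)
      moreover have "distinct (path_of D t n)"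
        using grows_distinct[OF grows_path_of[OF down_closed_young[OF D] t(1), of n]] t by simp
      ultimately have "pos (path_of D t n) b = Suc k"
        using pos_nth[of "path_of D t n" k] k by simp
      then show "restrict (pos (path_of D t n)) D b = t b" using b k by simp
    qed (use t[OF t'] in auto)
    show "path_of D (restrict (pos bs) D) n = bs" if "bs \<in> {bs. grows {} bs \<and> set bs = D}" for bs
    proof (rule nth_equalityI)
      have bs: "set bs = D" "length bs = n" "distinct bs" using that len by auto
      then show "length (path_of D (restrict (pos bs) D) n) = length bs" by simp
      fix k assume "k < length (path_of D (restrict (pos bs) D) n)"
      then have k: "k < n" by simp
      have inj: "inj_on (restrict (pos bs) D) D"
      proof (rule inj_onI)
        fix x y assume xy: "x \<in> D" "y \<in> D" "restrict (pos bs) D x = restrict (pos bs) D y"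
        obtain i j where "x = bs ! i" "y = bs ! j" "i < n" "j < n"
          using xy bs by (auto simp: in_set_conv_nth)
        then show "x = y" using xy pos_nth[of bs i] pos_nth[of bs j] bs by auto
      qed
      have "inv_into D (restrict (pos bs) D) (Suc k) = bs ! k"
        by (rule inv_into_f_eq[OF inj]) (use bs k pos_nth[of bs k] nth_mem[of k bs] in auto)
      then show "path_of D (restrict (pos bs) D) n ! k = bs ! k" using k by (simp add: nth_path_of)
    qed
  qed
  then have "card (standard_tableaux D) = card {bs. grows {} bs \<and> set bs = D}"
    by (rule bij_betw_same_card)
  then show ?thesis by (simp add: num_syt_def num_paths_def)
qed

text \<open>
  This makes the transition probabilities of the growth process sum up to one.  It is the case of
  \<open>sum_products\<close> where the second block is a single letter: then the products are just the
  extensions of \<open>S\<close> by one box.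
\<close>

lemma sum_num_paths_up:
  assumes D: "D \<in> young_diagrams n"
  shows "(\<Sum>E\<in>{E \<in> young_diagrams (Suc n). D \<nearrow> E}. num_paths E) = Suc n * num_paths D"
proof -
  have yD: "young D" "card D = n" using D by (simp_all add: young_diagrams_eq)
  obtain S where S: "grows {} S" "set S = D" using young_has_path[OF yD(1)] by blast
  have Sp: "S \<in> paths n" using S yD grows_distinct[of "{}" S] by (auto simp: paths_def distinct_card)
  let ?T = "[(1, 1)] :: box list"
  have prod: "products S ?T = {U \<in> paths (Suc n). take n U = S}"
    using Sp promote_pow_path[of _ n "Suc 0"] by (auto simp: products_def paths_length paths_1)
  have "bij_betw set (products S ?T) {E \<in> young_diagrams (Suc n). D \<nearrow> E}"
  proof (rule bij_betw_imageI)
    have snoc: "\<exists>b. U = S @ [b] \<and> addable D b" if "U \<in> products S ?T" for U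
    proof -
      have U: "U \<in> paths (Suc n)" "take n U = S" using that prod by auto
      then have "length U = Suc n" by (simp add: paths_def)
      then have "U = S @ [U ! n]" using U(2) take_Suc_conv_app_nth[of n U] by simp
      then show ?thesis using U(1) S grows_snoc[of "{}" S "U ! n"] by (metis paths_grows Un_empty_left)
    qed
    show "inj_on set (products S ?T)"
    proof (rule inj_onI)
      fix U V assume UV: "U \<in> products S ?T" "V \<in> products S ?T" "set U = set V"
      obtain b c where bc: "U = S @ [b]" "V = S @ [c]" "addable D b" "addable D c"
        using snoc UV by meson
      then have "insert b D = insert c D" "b \<notin> D" "c \<notin> D" using UV(3) S(2) by (auto simp: addable_def)
      then show "U = V" using bc by auto
    qed
    show "set ` products S ?T = {E \<in> young_diagrams (Suc n). D \<nearrow> E}"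
    proof (intro equalityI subsetI)
      fix E assume "E \<in> set ` products S ?T"
      then obtain U where U: "U \<in> products S ?T" "E = set U" by blast
      obtain b where b: "U = S @ [b]" "addable D b" using snoc[OF U(1)] by blast
      have "D \<nearrow> insert b D" using b unfolding adds_box_def addable_def by blast
      moreover have "U \<in> paths (Suc n)" using U(1) prod by simp
      ultimately show "E \<in> {E \<in> young_diagrams (Suc n). D \<nearrow> E}"
        using U b S young_set_path[of U "Suc n"] card_set_path[of U "Suc n"]
        by (simp add: young_diagrams_eq)
    next
      fix E assume "E \<in> {E \<in> young_diagrams (Suc n). D \<nearrow> E}"
      then have E: "young E" "D \<nearrow> E" by (simp_all add: young_diagrams_eq)
      then obtain b where b: "b \<notin> D" "E = insert b D" unfolding adds_box_def by blast
      then have "S @ [b] \<in> products S ?T"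
        unfolding prod using E yD S Sp by (simp add: paths_def grows_snoc addable_def)
      then show "E \<in> set ` products S ?T" using b S by (intro image_eqI[of _ _ "S @ [b]"]) auto
    qed
  qed
  then have "(\<Sum>E\<in>{E \<in> young_diagrams (Suc n). D \<nearrow> E}. num_paths E) = (\<Sum>U\<in>products S ?T. num_paths (set U))"
    by (rule sum.reindex_bij_betw[symmetric])
  also have "\<dots> = Suc n * num_paths D"
    using sum_products[OF Sp, of ?T "Suc 0"] num_paths_single S(2) by (simp add: paths_1)
  finally show ?thesis .
qed

section \<open>Jeu de taquin on infinite tableaux\<close>

lemma infinite_tableauD:
  assumes "t \<in> infinite_tableaux"
  shows "inj_on t boxes" "t ` boxes = {1..}" "increasing_on boxes t" "t \<in> extensional boxes"
  using assms by (auto simp: infinite_tableaux_def bij_betw_def)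

lemma path_of_tableau:
  assumes t: "t \<in> infinite_tableaux"
  shows "path_of boxes t n \<in> paths n"
  using grows_path_of[OF down_closed_boxes infinite_tableauD(1)[OF t], of n] infinite_tableauD[OF t]
  by (auto simp: paths_def)

lemma set_path_of_tableau:
  assumes t: "t \<in> infinite_tableaux"
  shows "set (path_of boxes t n) = {b \<in> boxes. t b \<le> n}"
  using set_path_of[OF infinite_tableauD(1)[OF t], of n] infinite_tableauD[OF t] by auto

text \<open>
  An enumeration \<open>g\<close> of all boxes by growing Young diagrams is the inverse of an infinite tableau.
\<close>

lemma infinite_tableauI:
  assumes t: "t \<in> extensional boxes" and g: "\<And>k. g k \<in> boxes" "\<And>k. t (g k) = Suc k"
    and surj: "boxes \<subseteq> range g" and sub: "\<And>k. young (g ` {..<k})"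
  shows "t \<in> infinite_tableaux" "path_of boxes t n = map g [0..<n]"
proof -
  have inj: "inj_on t boxes"
  proof (rule inj_onI)
    fix b c assume bc: "b \<in> boxes" "c \<in> boxes" "t b = t c"
    then obtain k l where "b = g k" "c = g l" using surj by blast
    then show "b = c" using bc g by simp
  qed
  have im: "t ` boxes = {1..}"
  proof (intro equalityI subsetI)
    fix m assume "m \<in> t ` boxes"
    then show "m \<in> {1..}" using surj g by auto
  next
    fix m :: nat assume "m \<in> {1..}"
    then obtain k where "m = Suc k" by (cases m) auto
    then show "m \<in> t ` boxes" using g[of k] by (metis imageI)
  qed
  have "{b \<in> boxes. t b \<le> k} = g ` {..<k}" for k
  proof (intro equalityI subsetI)
    fix b assume "b \<in> {b \<in> boxes. t b \<le> k}"
    moreover then obtain l where "b = g l" using surj by blast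
    ultimately show "b \<in> g ` {..<k}" using g by auto
  next
    fix b assume "b \<in> g ` {..<k}"
    then show "b \<in> {b \<in> boxes. t b \<le> k}" using g by auto
  qed
  then have "increasing_on boxes t"
    using sub inj by (intro increasing_onI_sublevels) auto
  then show "t \<in> infinite_tableaux"
    using t inj im by (simp add: infinite_tableaux_def bij_betw_def)
  show "path_of boxes t n = map g [0..<n]"
  proof (rule nth_equalityI)
    fix k assume "k < length (path_of boxes t n)"
    then have k: "k < n" by simp
    have "inv_into boxes t (Suc k) = g k" using g by (intro inv_into_f_eq[OF inj]) auto
    then show "path_of boxes t n ! k = map g [0..<n] ! k" using k by (simp add: nth_path_of)
  qed simp
qed

definition slide_end :: "box \<Rightarrow> box list \<Rightarrow> box" where
  "slide_end = foldl (\<lambda>d b. if adj d b then b else d)"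

lemma slide_snoc:
  "slide d (bs @ [b]) = slide d bs @ [if adj (slide_end d bs) b then slide_end d bs else b]"
  by (induction bs arbitrary: d) (simp_all add: slide_end_def)

lemma slide_end_snoc:
  "slide_end d (bs @ [b]) = (if adj (slide_end d bs) b then b else slide_end d bs)"
  by (simp add: slide_end_def)

lemma adj_jdt_step: "adj d (jdt_step t d)"
  by (cases d) (simp add: jdt_step_def adj_def)

lemma jdt_step_boxes: "d \<in> boxes \<Longrightarrow> jdt_step t d \<in> boxes"
  by (cases d) (auto simp: jdt_step_def boxes_def)

lemma jdt_path_boxes: "jdt_path t k \<in> boxes"
  by (induction k) (auto simp: jdt_step_boxes, simp add: boxes_def)

lemma jdt_step_le:
  "adj d b \<Longrightarrow> t (jdt_step t d) \<le> t b"
  by (cases d) (auto simp: jdt_step_def adj_def)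

lemma jdt_step_greater:
  assumes "t \<in> infinite_tableaux" "d \<in> boxes"
  shows "t d < t (jdt_step t d)"
  using infinite_tableauD(3)[OF assms(1)] assms(2) jdt_step_boxes[OF assms(2), of t]
  by (cases d) (auto simp: increasing_on_def jdt_step_def boxes_def)

lemma tableau_first:
  assumes t: "t \<in> infinite_tableaux"
  shows "t (1, 1) = 1"
proof -
  have "path_of boxes t (Suc 0) = [(1, 1)]" using path_of_tableau[OF t, of "Suc 0"] by (simp add: paths_1)
  then have "(1, 1) \<in> {b \<in> boxes. t b \<le> Suc 0}"
    unfolding set_path_of_tableau[OF t, symmetric] by simp
  moreover have "t (1, 1) \<in> {1..}"
    unfolding infinite_tableauD(2)[OF t, symmetric] by (rule imageI) (simp add: boxes_def)
  ultimately show ?thesis by simp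
qed

text \<open>
  The infinite jeu de taquin path, defined by comparing entries, and the finite one, which waits for
  the first neighbour to be filled, are the same: the neighbour that is filled first is the one with
  the smaller entry.  The box \<open>d n\<close> is the last box of the path with an entry at most \<open>n + 1\<close>, and \<open>g n\<close>
  is the box that has entry \<open>n + 1\<close> after the slide.
\<close>

lemma jeu_de_taquin_promote:
  assumes t: "t \<in> infinite_tableaux"
  shows "jeu_de_taquin t \<in> infinite_tableaux"
    "path_of boxes (jeu_de_taquin t) n = promote (path_of boxes t (Suc n))"
proof -
  note T = infinite_tableauD[OF t]
  define e where "e = inv_into boxes t"
  have e: "e k \<in> boxes" "t (e k) = k" if "1 \<le> k" for k
    using that T(2) by (auto simp: e_def inv_into_into f_inv_into_f)
  have te: "e (t b) = b" if "b \<in> boxes" for b using that T(1) by (simp add: e_def)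
  have t1: "t b \<ge> 1" if "b \<in> boxes" for b using that T(2) by auto
  have e1: "e 1 = (1, 1)" using te[of "(1, 1)"] tableau_first[OF t] by (simp add: boxes_def)
  define q where "q = jdt_path t"
  have q0: "q 0 = (1, 1)" and qS: "q (Suc k) = jdt_step t (q k)" and qb: "q k \<in> boxes" for k
    by (simp_all add: q_def jdt_path_boxes)
  have "t (q k) < t (q (Suc k))" for k
    using jdt_step_greater[OF t qb[of k]] by (simp add: qS)
  then have mono: "strict_mono (\<lambda>k. t (q k))" by (simp add: strict_mono_Suc_iff)
  define us where "us n = map e [2..<n + 2]" for n
  have us_Suc: "us (Suc n) = us n @ [e (n + 2)]" for n by (simp add: us_def)
  have us0: "us 0 = []" by (simp add: us_def)
  have path: "path_of boxes t (Suc n) = (1, 1) # us n" for n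
    using e1 by (induction n) (simp_all add: us_Suc us0 path_of_def e_def)
  define d where "d n = slide_end (1, 1) (us n)" for n
  have d0: "d 0 = (1, 1)" by (simp add: d_def us0 slide_end_def)
  have dS: "d (Suc n) = (if adj (d n) (e (n + 2)) then e (n + 2) else d n)" for n
    by (simp add: d_def us_Suc slide_end_snoc)
  define g where "g n = (if adj (d n) (e (n + 2)) then d n else e (n + 2))" for n
  have promote: "promote (path_of boxes t (Suc n)) = map g [0..<n]" for n
    unfolding path promote_Cons by (induction n) (simp_all add: us0 us_Suc slide_snoc d_def g_def)
  have adj_iff: "adj (d n) (e (n + 2)) \<longleftrightarrow> jdt_step t (d n) = e (n + 2)"
    if "d n \<in> boxes" "Suc n < t (jdt_step t (d n))" for n
  proof
    assume "adj (d n) (e (n + 2))"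
    then have "t (jdt_step t (d n)) = n + 2" using jdt_step_le[of "d n" "e (n + 2)" t] e that by fastforce
    then show "jdt_step t (d n) = e (n + 2)" using te[OF jdt_step_boxes[OF that(1)]] by metis
  qed (use adj_jdt_step[of "d n" t] in simp)
  \<comment> \<open>The end of the finite path is the last box of the infinite path that is already filled.\<close>
  have inv: "\<exists>i. d n = q i \<and> t (q i) \<le> Suc n \<and> Suc n < t (q (Suc i))" for n
  proof (induction n)
    case 0
    then show ?case
      using d0 q0 tableau_first[OF t] strict_monoD[OF mono, of 0 1] by (intro exI[of _ 0]) simp
  next
    case (Suc n)
    then obtain i where i: "d n = q i" "t (q i) \<le> Suc n" "Suc n < t (q (Suc i))" by blast
    have ai: "adj (d n) (e (n + 2)) \<longleftrightarrow> q (Suc i) = e (n + 2)"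
      using adj_iff[of n] i qb[of i] by (simp add: qS)
    show ?case
    proof (cases "adj (d n) (e (n + 2))")
      case True
      then have "q (Suc i) = e (n + 2)" using ai by simp
      then show ?thesis
        using True e[of "n + 2"] strict_monoD[OF mono, of "Suc i" "Suc (Suc i)"]
        by (intro exI[of _ "Suc i"]) (simp add: dS)
    next
      case False
      then have "t (q (Suc i)) \<noteq> n + 2" using ai te[OF qb[of "Suc i"]] by auto
      then show ?thesis using False i by (intro exI[of _ i]) (simp add: dS)
    qed
  qed
  have db: "d n \<in> boxes" for n using inv[of n] qb by auto
  have adj_path: "adj (d n) (e (n + 2)) \<longleftrightarrow> q (Suc i) = e (n + 2)" if "d n = q i" "Suc n < t (q (Suc i))" for n i
    using adj_iff[of n] that qb[of i] by (simp add: qS)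
  \<comment> \<open>There is only one such box, since entries increase along the path.\<close>
  have index: "i = m" if "t (q i) \<le> Suc n" "Suc n < t (q (Suc i))" "t (q m) \<le> Suc n" "Suc n < t (q (Suc m))"
    for i m n
  proof (rule ccontr)
    assume "i \<noteq> m"
    then consider "Suc i \<le> m" | "Suc m \<le> i" by linarith
    then show False
    proof cases
      case 1
      then have "t (q (Suc i)) \<le> t (q m)" using monoD[OF strict_mono_mono[OF mono]] by simp
      then show False using that by simp
    next
      case 2
      then have "t (q (Suc m)) \<le> t (q i)" using monoD[OF strict_mono_mono[OF mono]] by simp
      then show False using that by simp
    qed
  qed
  let ?s = "jeu_de_taquin t"
  have s: "?s b = (if b \<in> range q then t (jdt_step t b) - 1 else t b - 1)" if "b \<in> boxes" for b
    using that by (simp add: jeu_de_taquin_def q_def)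
  have gb: "g n \<in> boxes" for n using db e by (simp add: g_def)
  have sg: "?s (g n) = Suc n" for n
  proof -
    obtain i where i: "d n = q i" "t (q i) \<le> Suc n" "Suc n < t (q (Suc i))" using inv by blast
    show ?thesis
    proof (cases "adj (d n) (e (n + 2))")
      case True
      then have "t (jdt_step t (d n)) = n + 2" using adj_path[OF i(1,3)] e[of "n + 2"] i(1) by (simp add: qS)
      moreover have "g n = d n" "d n \<in> range q" using True i by (auto simp: g_def)
      ultimately show ?thesis using s[OF db[of n]] by simp
    next
      case False
      have "e (n + 2) \<notin> range q"
      proof
        assume "e (n + 2) \<in> range q"
        then obtain m where m: "e (n + 2) = q m" by blast
        then have tm: "t (q m) = n + 2" using e[of "n + 2"] by simp
        have "i < m"
        proof (rule ccontr)
          assume "\<not> i < m"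
          then have "t (q m) \<le> t (q i)" using monoD[OF strict_mono_mono[OF mono]] by simp
          then show False using tm i by simp
        qed
        moreover have "m \<noteq> Suc i" using False adj_path[OF i(1,3)] m by auto
        ultimately have "t (q (Suc i)) < t (q m)" using strict_monoD[OF mono, of "Suc i" m] by simp
        then show False using tm i by simp
      qed
      then show ?thesis using False s[OF e(1)[of "n + 2"]] e(2)[of "n + 2"] by (simp add: g_def)
    qed
  qed
  have surj: "boxes \<subseteq> range g"
  proof
    fix b assume b: "b \<in> boxes"
    show "b \<in> range g"
    proof (cases "b \<in> range q")
      case True
      then obtain m where m: "b = q m" by blast
      have lt: "t (q m) < t (q (Suc m))" using strict_monoD[OF mono, of m "Suc m"] by simp
      then obtain n where n: "t (q (Suc m)) = n + 2"
        using t1[OF qb[of m]] by (metis add_2_eq_Suc' le_add_diff_inverse2 Suc_leI Suc_1 le_trans Suc_le_mono One_nat_def)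
      obtain i where i: "d n = q i" "t (q i) \<le> Suc n" "Suc n < t (q (Suc i))" using inv by blast
      have "i = m" using index[OF i(2,3), of m] lt n by simp
      moreover have "e (n + 2) = q (Suc m)" using te[OF qb[of "Suc m"]] n by simp
      ultimately have "g n = b" using adj_path[OF i(1,3)] i(1) m by (simp add: g_def)
      then show ?thesis by blast
    next
      case False
      then have "b \<noteq> (1, 1)" using q0 by (metis rangeI)
      then have "t b \<noteq> 1" using te[OF b] e1 by auto
      then obtain n where n: "t b = n + 2" using t1[OF b] by (metis add_2_eq_Suc' not0_implies_Suc One_nat_def not_one_le_zero)
      obtain i where i: "d n = q i" "t (q i) \<le> Suc n" "Suc n < t (q (Suc i))" using inv by blast
      have eb: "e (n + 2) = b" using te[OF b] n by simp
      then have "\<not> adj (d n) (e (n + 2))" using adj_path[OF i(1,3)] False by (metis rangeI)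
      then have "g n = b" using eb by (simp add: g_def)
      then show ?thesis by blast
    qed
  qed
  have young: "young (g ` {..<k})" for k
  proof -
    have "set (promote (path_of boxes t (Suc k))) = g ` {..<k}" unfolding promote by (auto simp: atLeast0LessThan)
    moreover have "young (set (promote (path_of boxes t (Suc k))))"
      using grows_young_union[OF grows_promote[OF paths_grows[OF path_of_tableau[OF t]]], of "Suc k"] by simp
    ultimately show ?thesis by simp
  qed
  have ext: "?s \<in> extensional boxes" by (simp add: jeu_de_taquin_def)
  show "?s \<in> infinite_tableaux" by (rule infinite_tableauI(1)[OF ext gb sg surj young])
  show "path_of boxes ?s n = promote (path_of boxes t (Suc n))"
    unfolding promote by (rule infinite_tableauI(2)[OF ext gb sg surj young])
qed

lemma jeu_de_taquin_pow:
  assumes t: "t \<in> infinite_tableaux"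
  shows "(jeu_de_taquin ^^ m) t \<in> infinite_tableaux"
    "path_of boxes ((jeu_de_taquin ^^ m) t) n = (promote ^^ m) (path_of boxes t (m + n))"
proof -
  show J: "(jeu_de_taquin ^^ m) t \<in> infinite_tableaux" for m
    by (induction m) (simp_all add: t jeu_de_taquin_promote(1))
  show "path_of boxes ((jeu_de_taquin ^^ m) t) n = (promote ^^ m) (path_of boxes t (m + n))"
    by (induction m arbitrary: n) (simp_all add: jeu_de_taquin_promote(2)[OF J])
qed

section \<open>Finite-dimensional laws of the Plancherel growth process\<close>

abbreviation diagram_space :: "nat \<Rightarrow> box set measure" where
  "diagram_space n \<equiv> count_space (young_diagrams n)"

lemma num_paths_pos: "young D \<Longrightarrow> 0 < num_paths D"
  using young_has_path[of D] by (auto simp: num_paths_def card_gt_0_iff)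

lemma space_plancherel_transition: "space (plancherel_transition n D) = young_diagrams (Suc n)"
  and sets_plancherel_transition: "sets (plancherel_transition n D) = Pow (young_diagrams (Suc n))"
  by (simp_all add: plancherel_transition_def space_point_measure sets_point_measure)

lemma emeasure_plancherel_transition:
  assumes D: "D \<in> young_diagrams n" and E: "E \<in> young_diagrams (Suc n)" "D \<nearrow> E"
  shows "emeasure (plancherel_transition n D) {E} = ennreal (real (num_paths E) / (real (n + 1) * real (num_paths D)))"
proof -
  have "num_syt D = num_paths D" "num_syt E = num_paths E"
    using D E by (simp_all add: young_diagrams_eq num_syt_eq)
  then show ?thesis
    using E by (simp add: plancherel_transition_def emeasure_point_measure_finite[OF finite_young_diagrams]
      del: of_nat_add)
qed

lemma prob_space_plancherel_transition:
  assumes D: "D \<in> young_diagrams n"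
  shows "prob_space (plancherel_transition n D)"
proof (rule prob_spaceI)
  let ?Y = "young_diagrams (Suc n)"
  have yD: "young D" using D by (simp add: young_diagrams_eq)
  have syt: "num_syt E = num_paths E" if "E \<in> ?Y" for E
    using that by (simp add: young_diagrams_eq num_syt_eq)
  have "emeasure (plancherel_transition n D) (space (plancherel_transition n D)) =
     (\<Sum>E\<in>?Y. if D \<nearrow> E then ennreal (real (num_paths E) / (real (n + 1) * real (num_paths D))) else 0)"
    unfolding space_plancherel_transition plancherel_transition_def
    by (subst emeasure_point_measure_finite[OF finite_young_diagrams])
      (auto intro!: sum.cong simp: num_syt_eq[OF yD] syt space_point_measure simp del: of_nat_add)
  also have "\<dots> = (\<Sum>E\<in>{E \<in> ?Y. D \<nearrow> E}. ennreal (real (num_paths E) / (real (n + 1) * real (num_paths D))))"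
    by (rule sum.inter_filter[OF finite_young_diagrams, symmetric])
  also have "\<dots> = ennreal (\<Sum>E\<in>{E \<in> ?Y. D \<nearrow> E}. real (num_paths E) / (real (n + 1) * real (num_paths D)))"
    by (rule sum_ennreal) simp
  also have "(\<Sum>E\<in>{E \<in> ?Y. D \<nearrow> E}. real (num_paths E) / (real (n + 1) * real (num_paths D))) =
      real (\<Sum>E\<in>{E \<in> ?Y. D \<nearrow> E}. num_paths E) / (real (n + 1) * real (num_paths D))"
    by (simp add: sum_divide_distrib)
  also have "\<dots> = 1"
    unfolding sum_num_paths_up[OF D] using num_paths_pos[OF yD] by (simp add: distrib_right add_nonneg_eq_0_iff)
  finally show "emeasure (plancherel_transition n D) (space (plancherel_transition n D)) = 1" by simp
qed

lemma Ionescu_Tulcea_plancherel: "Ionescu_Tulcea plancherel_kernel diagram_space"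
proof (rule Ionescu_Tulcea.intro)
  show "plancherel_kernel i \<in> measurable (PiM {0..<i} diagram_space) (subprob_algebra (diagram_space i))" for i
  proof (cases i)
    case 0
    have "{} \<in> young_diagrams 0" by (simp add: young_diagrams_eq)
    then have "return (diagram_space 0) {} \<in> space (subprob_algebra (diagram_space 0))"
      by (auto simp: space_subprob_algebra intro!: prob_space_imp_subprob_space prob_space_return)
    moreover have "plancherel_kernel 0 = (\<lambda>_. return (diagram_space 0) {})" by (simp add: fun_eq_iff)
    ultimately show ?thesis using 0 by simp
  next
    case (Suc n)
    have tr: "plancherel_transition n \<in> measurable (diagram_space n) (subprob_algebra (diagram_space i))"
      using Suc prob_space_plancherel_transition
      by (auto simp: space_subprob_algebra sets_plancherel_transition intro!: prob_space_imp_subprob_space)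
    have comp: "(\<lambda>\<omega>. \<omega> n) \<in> measurable (PiM {0..<i} diagram_space) (diagram_space n)"
      by (rule measurable_component_singleton) (simp add: Suc)
    have "plancherel_kernel i = (\<lambda>\<omega>. plancherel_transition n (\<omega> n))"
      by (simp add: Suc fun_eq_iff)
    then show ?thesis using measurable_compose[OF comp tr] by simp
  qed
  show "prob_space (plancherel_kernel i x)" if x: "x \<in> space (PiM {0..<i} diagram_space)" for i x
  proof (cases i)
    case 0
    then show ?thesis by (auto intro!: prob_space_return simp: young_diagrams_eq)
  next
    case (Suc n)
    then have "x n \<in> young_diagrams n" using x by (auto simp: space_PiM PiE_iff)
    then show ?thesis using Suc by (simp add: prob_space_plancherel_transition)
  qed
qed

text \<open>
  For points that are measurable, the composition of kernels is a product of transition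
  probabilities.
\<close>

lemma (in Ionescu_Tulcea) emeasure_C_Suc_point:
  assumes f: "f \<in> space (PiM {0..<Suc m} M)" and sing: "\<And>i. i \<le> m \<Longrightarrow> {f i} \<in> sets (M i)"
  shows "emeasure (C 0 (Suc m) (\<lambda>_. undefined)) {f} =
    emeasure (C 0 m (\<lambda>_. undefined)) {restrict f {0..<m}} * emeasure (P m (restrict f {0..<m})) {f m}"
proof -
  let ?C = "C 0 m (\<lambda>_. undefined)" and ?f = "restrict f {0..<m}"
  have u: "(\<lambda>_. undefined) \<in> space (PiM {0..<0} M)" by (simp add: space_PiM)
  have fE: "f \<in> extensional {0..<Suc m}" "\<And>i. i \<le> m \<Longrightarrow> f i \<in> space (M i)"
    using f by (auto simp: space_PiM PiE_iff)
  have point: "{restrict f {0..<k}} \<in> sets (PiM {0..<k} M)" if "k \<le> Suc m" for k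
  proof -
    have "{restrict f {0..<k}} = (\<Pi>\<^sub>E i\<in>{0..<k}. {f i})"
      by (auto simp: PiE_iff extensional_def fun_eq_iff)
    then show ?thesis using sing that by (auto intro!: sets_PiM_I_finite)
  qed
  have "restrict f {0..<Suc m} = f" using fE(1) by (rule extensional_restrict)
  then have pf: "{f} \<in> sets (PiM {0..<Suc m} M)" using point[of "Suc m"] by simp
  have sC: "sets ?C = sets (PiM {0..<m} M)" using sets_C[OF u, of m] by simp
  then have spC: "space ?C = space (PiM {0..<m} M)" by (rule sets_eq_imp_space_eq)
  have "emeasure (C 0 (Suc m) (\<lambda>_. undefined)) {f} = (\<integral>\<^sup>+\<omega>. emeasure (eP m \<omega>) {f} \<partial>?C)"
    using prob_space.not_empty[OF prob_space_C[OF u, of m]] pf measurable_eP[of m]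
    by (simp add: emeasure_bind[of _ _ "PiM {0..<Suc m} M"] measurable_cong_sets[OF sC refl])
  also have "\<dots> = (\<integral>\<^sup>+\<omega>. emeasure (P m ?f) {f m} * indicator {?f} \<omega> \<partial>?C)"
  proof (rule nn_integral_cong)
    fix \<omega> assume "\<omega> \<in> space ?C"
    then have w: "\<omega> \<in> space (PiM {0..<m} M)" by (simp add: spC)
    have "(\<lambda>x. fun_upd \<omega> m x) -` {f} \<inter> space (M m) = (if \<omega> = ?f then {f m} else {})"
    proof -
      have upd: "fun_upd \<omega> m x = f \<longleftrightarrow> \<omega> = ?f \<and> x = f m" for x
      proof
        assume e: "fun_upd \<omega> m x = f"
        then have "f m = x" by auto
        moreover have "\<omega> = ?f"
        proof
          fix i
          show "\<omega> i = ?f i" using w e by (cases "i < m") (auto simp: space_PiM PiE_iff extensional_def)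
        qed
        ultimately show "\<omega> = ?f \<and> x = f m" by simp
      next
        assume e: "\<omega> = ?f \<and> x = f m"
        show "fun_upd \<omega> m x = f"
        proof
          fix i
          show "fun_upd \<omega> m x i = f i"
            using e fE(1) by (cases "i < m"; cases "i = m") (auto simp: extensional_def)
        qed
      qed
      have "(\<lambda>x. fun_upd \<omega> m x) -` {f} \<inter> space (M m) = {x \<in> space (M m). \<omega> = ?f \<and> x = f m}"
        unfolding vimage_def singleton_iff upd by blast
      then show ?thesis using fE(2)[of m] by (cases "\<omega> = ?f") auto
    qed
    then show "emeasure (eP m \<omega>) {f} = emeasure (P m ?f) {f m} * indicator {?f} \<omega>"
      using emeasure_eP[OF w pf] by simp
  qed
  also have "\<dots> = emeasure ?C {?f} * emeasure (P m ?f) {f m}"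
    using point[of m] by (subst nn_integral_cmult_indicator) (auto simp: sC mult.commute)
  finally show ?thesis .
qed

text \<open>
  The first \<open>n + 1\<close> diagrams along a path, as a point of the finite product space.
\<close>

definition path_word :: "box list \<Rightarrow> nat \<Rightarrow> nat \<Rightarrow> box set" where
  "path_word S n = restrict (\<lambda>k. set (take k S)) {0..<Suc n}"

text \<open>
  The product of the transition probabilities telescopes.
\<close>

lemma emeasure_C_path_word:
  "S \<in> paths n \<Longrightarrow>
   emeasure (Ionescu_Tulcea.C plancherel_kernel diagram_space 0 (Suc n) (\<lambda>_. undefined)) {path_word S n} =
     ennreal (weight S)"
proof (induction n arbitrary: S)
  interpret IT: Ionescu_Tulcea plancherel_kernel diagram_space by (rule Ionescu_Tulcea_plancherel)
  have word_space: "path_word S n \<in> space (PiM {0..<Suc n} diagram_space)" if "S \<in> paths n" for S n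
  proof -
    have "set (take k S) \<in> young_diagrams k" if "k \<le> n" for k
      using take_path[OF \<open>S \<in> paths n\<close> that] young_set_path card_set_path by (auto simp: young_diagrams_eq)
    then show ?thesis by (auto simp: space_PiM path_word_def)
  qed
  have sing: "{path_word S n i} \<in> sets (diagram_space i)" if "S \<in> paths n" "i \<le> n" for S n i
    using word_space[OF that(1)] that(2) by (auto simp: space_PiM PiE_iff)
  {
    case 0
    have [simp]: "path_word S 0 0 = {}" by (simp add: path_word_def)
    have u: "restrict (path_word S 0) {} = (\<lambda>_. undefined)" by (simp add: fun_eq_iff)
    have "{} \<in> young_diagrams 0" by (simp add: young_diagrams_eq)
    moreover have "{\<lambda>_. undefined} \<in> sets (PiM {} diagram_space)"
      using sets.top[of "PiM {} diagram_space"] by (simp only: space_PiM_empty)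
    ultimately show ?case
      using IT.emeasure_C_Suc_point[OF word_space[OF 0] sing[OF 0]] 0
      by (simp add: u)
  next
    case (Suc n)
    have S: "S \<in> paths (Suc n)" by fact
    let ?S = "take n S"
    have S': "?S \<in> paths n" using take_path[OF S] by simp
    have res: "restrict (path_word S (Suc n)) {0..<Suc n} = path_word ?S n"
      by (auto simp: path_word_def restrict_def fun_eq_iff)
    have last: "path_word S (Suc n) (Suc n) = set S" "path_word ?S n n = set ?S"
      using S by (auto simp: path_word_def paths_def)
    have Seq: "S = ?S @ [S ! n]" using S take_Suc_conv_app_nth[of n S] by (simp add: paths_def)
    have "addable (set ?S) (S ! n)" using paths_grows[OF S] Seq by (metis grows_snoc Un_empty_left)
    then have "set ?S \<nearrow> insert (S ! n) (set ?S)" unfolding adds_box_def addable_def by blast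
    moreover have "insert (S ! n) (set ?S) = set S" using Seq by (metis Un_insert_right list.set(2) set_append Un_empty_right list.set(1))
    ultimately have up: "set ?S \<nearrow> set S" by simp
    have Y: "set ?S \<in> young_diagrams n" "set S \<in> young_diagrams (Suc n)"
      using S S' young_set_path card_set_path by (auto simp: young_diagrams_eq)
    have "emeasure (IT.C 0 (Suc (Suc n)) (\<lambda>_. undefined)) {path_word S (Suc n)} =
        ennreal (weight ?S) * ennreal (real (num_paths (set S)) / (real (n + 1) * real (num_paths (set ?S))))"
      using IT.emeasure_C_Suc_point[OF word_space[OF S] sing[OF S]] Suc.IH[OF S']
        emeasure_plancherel_transition[OF Y up]
      by (simp add: res last del: IT.C.simps of_nat_add)
    also have "\<dots> = ennreal (weight ?S * (real (num_paths (set S)) / (real (n + 1) * real (num_paths (set ?S)))))"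
      by (rule ennreal_mult[symmetric]) (auto simp: weight_nonneg)
    also have "weight ?S * (real (num_paths (set S)) / (real (n + 1) * real (num_paths (set ?S)))) = weight S"
    proof -
      have "N / F * (a / (c * N)) = a / (c * F)" if "N \<noteq> 0" "F \<noteq> 0" "c \<noteq> 0" for N F a c :: real
        using that by (simp add: field_simps)
      from this[of "real (num_paths (set ?S))" "fact n" "real (n + 1)" "real (num_paths (set S))"]
      show ?thesis
        using S S' num_paths_pos[OF young_set_path[OF S']]
        by (simp add: weight_def paths_length del: of_nat_add)
    qed
    finally show ?case .
  }
qed

definition growth_cylinder :: "box list \<Rightarrow> (nat \<Rightarrow> box set) set" where
  "growth_cylinder S =
     {\<Lambda> \<in> space (PiM UNIV diagram_space). \<forall>k\<le>length S. \<Lambda> k = set (take k S)}"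

lemma space_plancherel_growth: "space plancherel_growth = space (PiM UNIV diagram_space)"
  and sets_plancherel_growth [measurable_cong]: "sets plancherel_growth = sets (PiM UNIV diagram_space)"
proof -
  interpret IT: Ionescu_Tulcea plancherel_kernel diagram_space by (rule Ionescu_Tulcea_plancherel)
  show "space plancherel_growth = space (PiM UNIV diagram_space)"
    "sets plancherel_growth = sets (PiM UNIV diagram_space)"
    by (simp_all add: plancherel_growth_def Let_def)
qed

lemma growth_cylinder_sets_emeasure:
  assumes S: "S \<in> paths n"
  shows "growth_cylinder S \<in> sets plancherel_growth"
    and "emeasure plancherel_growth (growth_cylinder S) = ennreal (weight S)"
proof -
  interpret IT: Ionescu_Tulcea plancherel_kernel diagram_space by (rule Ionescu_Tulcea_plancherel)
  have "set (take k S) \<in> young_diagrams k" if "k \<le> n" for k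
    using take_path[OF S that] young_set_path card_set_path by (auto simp: young_diagrams_eq)
  then have "(\<Pi>\<^sub>E k\<in>{0..<Suc n}. {set (take k S)}) \<in> sets (PiM {0..<Suc n} diagram_space)"
    by (intro sets_PiM_I_finite) auto
  moreover have "(\<Pi>\<^sub>E k\<in>{0..<Suc n}. {set (take k S)}) = {path_word S n}"
    by (auto simp: path_word_def PiE_iff extensional_def fun_eq_iff)
  ultimately have X: "{path_word S n} \<in> sets (PiM {0..<Suc n} diagram_space)" by simp
  have emb: "prod_emb UNIV diagram_space {0..<Suc n} {path_word S n} = growth_cylinder S"
  proof -
    have "restrict \<Lambda> {0..<Suc n} = path_word S n \<longleftrightarrow> (\<forall>k\<le>length S. \<Lambda> k = set (take k S))" for \<Lambda>
    proof
      assume eq: "restrict \<Lambda> {0..<Suc n} = path_word S n"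
      show "\<forall>k\<le>length S. \<Lambda> k = set (take k S)"
      proof (intro allI impI)
        fix k assume "k \<le> length S"
        then show "\<Lambda> k = set (take k S)"
          using fun_cong[OF eq, of k] S by (simp add: path_word_def paths_length)
      qed
    next
      assume "\<forall>k\<le>length S. \<Lambda> k = set (take k S)"
      then show "restrict \<Lambda> {0..<Suc n} = path_word S n"
        unfolding path_word_def using S by (intro restrict_ext) (simp add: paths_length)
    qed
    then show ?thesis by (auto simp: prod_emb_def growth_cylinder_def space_PiM)
  qed
  show "growth_cylinder S \<in> sets plancherel_growth"
    unfolding emb[symmetric] sets_plancherel_growth by (rule measurable_prod_emb[OF _ X]) simp
  have "emeasure plancherel_growth (growth_cylinder S) = IT.CI {0..<Suc n} {path_word S n}"
    unfolding emb[symmetric] using IT.lim[OF _ X] by (simp add: plancherel_growth_def Let_def)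
  also have "\<dots> = IT.C 0 (Suc n) (\<lambda>_. undefined) (prod_emb {0..<Suc n} diagram_space {0..<Suc n} {path_word S n})"
    by (rule IT.emeasure_CI[OF _ X]) simp
  also have "prod_emb {0..<Suc n} diagram_space {0..<Suc n} {path_word S n} = {path_word S n}"
    using sets.sets_into_space[OF X] by (intro prod_emb_id) (simp add: space_PiM)
  finally show "emeasure plancherel_growth (growth_cylinder S) = ennreal (weight S)"
    using emeasure_C_path_word[OF S] by simp
qed

section \<open>The growth process exhausts the quadrant\<close>

lemma disjoint_growth_cylinders:
  assumes "S \<in> paths n" "T \<in> paths n" "S \<noteq> T"
  shows "growth_cylinder S \<inter> growth_cylinder T = {}"
proof (rule ccontr)
  assume "growth_cylinder S \<inter> growth_cylinder T \<noteq> {}"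
  then have eq: "set (take k S) = set (take k T)" if "k \<le> n" for k
    using that assms(1,2) by (auto simp: growth_cylinder_def paths_length)
  have "S ! k = T ! k" if k: "k < n" for k
  proof -
    have "insert (S ! k) (set (take k S)) = insert (T ! k) (set (take k T))"
      using eq[of "Suc k"] k assms(1,2) by (simp add: take_Suc_conv_app_nth paths_length)
    moreover have "S ! k \<notin> set (take k S)" if "S \<in> paths n" for S
    proof -
      have "distinct (take (Suc k) S)"
        using grows_distinct[OF paths_grows[OF that]] by simp
      then show ?thesis using k that by (simp add: take_Suc_conv_app_nth paths_length)
    qed
    ultimately show ?thesis using eq[of k] k assms(1,2) by auto
  qed
  then have "S = T" using assms by (intro nth_equalityI) (auto simp: paths_length)
  then show False using assms by simp
qed

lemma emeasure_growth_cylinders: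
  assumes X: "X \<subseteq> paths n"
  shows "(\<Union>S\<in>X. growth_cylinder S) \<in> sets plancherel_growth"
    and "emeasure plancherel_growth (\<Union>S\<in>X. growth_cylinder S) = ennreal (\<Sum>S\<in>X. weight S)"
proof -
  have fin: "finite X" using X finite_paths by (rule finite_subset)
  have sets: "growth_cylinder ` X \<subseteq> sets plancherel_growth"
    using X growth_cylinder_sets_emeasure(1) by blast
  then show "(\<Union>S\<in>X. growth_cylinder S) \<in> sets plancherel_growth"
    using fin by (intro sets.finite_UN) auto
  have "disjoint_family_on growth_cylinder X"
    unfolding disjoint_family_on_def using X disjoint_growth_cylinders by blast
  then have "emeasure plancherel_growth (\<Union>S\<in>X. growth_cylinder S) =
      (\<Sum>S\<in>X. emeasure plancherel_growth (growth_cylinder S))"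
    using sets fin by (intro sum_emeasure[symmetric]) auto
  also have "\<dots> = (\<Sum>S\<in>X. ennreal (weight S))"
    using X growth_cylinder_sets_emeasure(2) by (intro sum.cong) auto
  also have "\<dots> = ennreal (\<Sum>S\<in>X. weight S)"
    by (rule sum_ennreal) (rule weight_nonneg)
  finally show "emeasure plancherel_growth (\<Union>S\<in>X. growth_cylinder S) = ennreal (\<Sum>S\<in>X. weight S)" .
qed

lemma prob_space_plancherel_growth: "prob_space plancherel_growth"
proof (rule prob_spaceI)
  have "young_diagrams 0 = {{}}"
    using young_finite by (auto simp: young_diagrams_eq card_eq_0_iff)
  then have "growth_cylinder [] = space plancherel_growth"
    by (auto simp: growth_cylinder_def space_plancherel_growth space_PiM PiE_iff)
  then show "emeasure plancherel_growth (space plancherel_growth) = 1"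
    using growth_cylinder_sets_emeasure(2)[of "[]" 0] by simp
qed

lemma AE_growth_cylinders:
  "AE \<Lambda> in plancherel_growth. \<forall>n. \<Lambda> \<in> (\<Union>S\<in>paths n. growth_cylinder S)"
  unfolding AE_all_countable
proof
  fix n
  interpret prob_space plancherel_growth by (rule prob_space_plancherel_growth)
  have "emeasure plancherel_growth (\<Union>S\<in>paths n. growth_cylinder S) = 1"
    using emeasure_growth_cylinders(2)[of "paths n" n] by (simp add: sum_weight_paths)
  then show "AE \<Lambda> in plancherel_growth. \<Lambda> \<in> (\<Union>S\<in>paths n. growth_cylinder S)"
    using emeasure_growth_cylinders(1)[of "paths n" n]
    by (intro AE_prob_1) (simp add: measure_def)
qed

lemma sets_growth_box: "{\<Lambda> \<in> space plancherel_growth. b \<in> \<Lambda> n} \<in> sets plancherel_growth"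
proof -
  have m: "(\<lambda>\<Lambda>. \<Lambda> n) \<in> measurable (PiM UNIV diagram_space) (diagram_space n)"
    by (rule measurable_component_singleton) simp
  have "(\<lambda>\<Lambda>. \<Lambda> n) -` {D \<in> young_diagrams n. b \<in> D} \<inter> space (PiM UNIV diagram_space) =
      {\<Lambda> \<in> space (PiM UNIV diagram_space). b \<in> \<Lambda> n}"
    by (auto simp: space_PiM PiE_iff)
  then show ?thesis
    using measurable_sets[OF m, of "{D \<in> young_diagrams n. b \<in> D}"]
    by (simp add: space_plancherel_growth sets_plancherel_growth)
qed

lemma young_rectangle: "young ({1..i} \<times> {1..j})"
  by (rule youngI) (auto simp: boxes_def)

text \<open>
  Missing the box forever means missing the rectangle spanned by it at all times, which has
  probability zero by \<open>weight_missing_shape\<close>.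
\<close>

lemma AE_growth_reaches_box:
  assumes b: "b \<in> boxes"
  shows "AE \<Lambda> in plancherel_growth. \<exists>n. b \<in> \<Lambda> n"
proof -
  interpret prob_space plancherel_growth by (rule prob_space_plancherel_growth)
  obtain i j where ij: "b = (i, j)" "1 \<le> i" "1 \<le> j" using b by (auto simp: boxes_def)
  define R where "R = {1..i} \<times> {1..j}"
  have R: "young R" "R \<noteq> {}" "b \<in> R" using ij young_rectangle by (auto simp: R_def)
  obtain q where q: "q < 1" "0 \<le> q"
    "\<And>K. (\<Sum>U\<in>{U \<in> paths (K * card R). \<not> R \<subseteq> set U}. weight U) \<le> q ^ K"
    using weight_missing_shape[OF R(1,2)] by blast
  let ?N = "{\<Lambda> \<in> space plancherel_growth. \<forall>n. b \<notin> \<Lambda> n}"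
  have N: "?N \<in> sets plancherel_growth"
  proof -
    have "?N = space plancherel_growth - (\<Union>n. {\<Lambda> \<in> space plancherel_growth. b \<in> \<Lambda> n})" by auto
    then show ?thesis using sets_growth_box by auto
  qed
  have "emeasure plancherel_growth ?N \<le> ennreal (q ^ K)" for K
  proof -
    let ?X = "{U \<in> paths (K * card R). \<not> R \<subseteq> set U}"
    have "AE \<Lambda> in plancherel_growth. \<Lambda> \<in> ?N \<longrightarrow> \<Lambda> \<in> (\<Union>S\<in>?X. growth_cylinder S)"
      using AE_growth_cylinders
    proof eventually_elim
      case (elim \<Lambda>)
      then obtain S where S: "S \<in> paths (K * card R)" "\<Lambda> \<in> growth_cylinder S" by blast
      then have "\<Lambda> (K * card R) = set S" by (auto simp: growth_cylinder_def paths_length)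
      then show ?case using S R(3) by auto
    qed
    then have "emeasure plancherel_growth ?N \<le> emeasure plancherel_growth (\<Union>S\<in>?X. growth_cylinder S)"
      using emeasure_growth_cylinders(1)[of ?X] by (intro emeasure_mono_AE) auto
    also have "\<dots> = ennreal (\<Sum>S\<in>?X. weight S)"
      by (rule emeasure_growth_cylinders(2)) auto
    also have "\<dots> \<le> ennreal (q ^ K)" using q(3) by (intro ennreal_leI)
    finally show ?thesis .
  qed
  then have le: "prob ?N \<le> q ^ K" for K
    using q by (simp add: emeasure_eq_measure)
  have "(\<lambda>K. q ^ K) \<longlonglongrightarrow> 0" using q by (intro LIMSEQ_power_zero) simp
  then have "prob ?N \<le> 0" using le by (intro LIMSEQ_le_const) auto
  then have "emeasure plancherel_growth ?N = 0"
    by (simp add: emeasure_eq_measure measure_le_0_iff)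
  then have "?N \<in> null_sets plancherel_growth" using N by auto
  then show ?thesis by (rule AE_I') auto
qed

text \<open>
  Being a growing sequence of diagrams is expressed by cylinders, whose measures are known; this
  gives both measurability and full measure.
\<close>

lemma exhausting_paths_eq:
  "exhausting_paths = {\<Lambda> \<in> space plancherel_growth.
     (\<forall>n. \<Lambda> \<in> (\<Union>S\<in>paths n. growth_cylinder S)) \<and> (\<forall>b\<in>boxes. \<exists>n. b \<in> \<Lambda> n)}"
proof (intro equalityI subsetI)
  fix \<Lambda> assume L: "\<Lambda> \<in> exhausting_paths"
  then have L: "\<Lambda> 0 = {}" "\<And>n. \<Lambda> n \<in> young_diagrams n" "\<And>n. \<Lambda> n \<nearrow> \<Lambda> (Suc n)" "\<forall>b\<in>boxes. \<exists>n. b \<in> \<Lambda> n"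
    by (auto simp: exhausting_paths_def)
  have sp: "\<Lambda> \<in> space (PiM UNIV diagram_space)" using L(2) by (simp add: space_PiM PiE_iff)
  have "\<exists>S\<in>paths n. \<Lambda> \<in> growth_cylinder S" for n
  proof (induction n)
    case 0
    then show ?case using sp L(1) by (simp add: growth_cylinder_def)
  next
    case (Suc n)
    then obtain S where S: "S \<in> paths n" "\<Lambda> \<in> growth_cylinder S" by blast
    then have Ln: "\<Lambda> n = set S" by (auto simp: growth_cylinder_def paths_length)
    obtain b where b: "b \<notin> set S" "\<Lambda> (Suc n) = insert b (set S)"
      using L(3)[of n] unfolding adds_box_def Ln by blast
    have "young (insert b (set S))" using L(2)[of "Suc n"] b by (simp add: young_diagrams_eq)
    then have "S @ [b] \<in> paths (Suc n)"
      using S(1) b young_set_path[OF S(1)] by (simp add: paths_def grows_snoc addable_def)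
    moreover have "\<Lambda> \<in> growth_cylinder (S @ [b])"
      using S b by (auto simp: growth_cylinder_def paths_length le_Suc_eq)
    ultimately show ?case by blast
  qed
  then show "\<Lambda> \<in> {\<Lambda> \<in> space plancherel_growth.
     (\<forall>n. \<Lambda> \<in> (\<Union>S\<in>paths n. growth_cylinder S)) \<and> (\<forall>b\<in>boxes. \<exists>n. b \<in> \<Lambda> n)}"
    using sp L(4) by (simp add: space_plancherel_growth)
next
  fix \<Lambda> assume "\<Lambda> \<in> {\<Lambda> \<in> space plancherel_growth.
     (\<forall>n. \<Lambda> \<in> (\<Union>S\<in>paths n. growth_cylinder S)) \<and> (\<forall>b\<in>boxes. \<exists>n. b \<in> \<Lambda> n)}"
  then have L: "\<And>n. \<exists>S\<in>paths n. \<Lambda> \<in> growth_cylinder S" "\<forall>b\<in>boxes. \<exists>n. b \<in> \<Lambda> n" by auto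
  have "\<Lambda> n \<in> young_diagrams n \<and> \<Lambda> n \<nearrow> \<Lambda> (Suc n)" for n
  proof -
    obtain S where S: "S \<in> paths (Suc n)" "\<Lambda> \<in> growth_cylinder S" using L(1) by blast
    then have eq: "\<Lambda> n = set (take n S)" "\<Lambda> (Suc n) = set S"
      by (auto simp: growth_cylinder_def paths_length)
    have Seq: "S = take n S @ [S ! n]" using S take_Suc_conv_app_nth[of n S] by (simp add: paths_def)
    have S': "take n S \<in> paths n" using take_path[OF S(1)] by simp
    have "grows {} (take n S @ [S ! n])" using paths_grows[OF S(1)] Seq by simp
    then have "addable (set (take n S)) (S ! n)" by (simp add: grows_snoc)
    then have "set (take n S) \<nearrow> insert (S ! n) (set (take n S))" unfolding adds_box_def addable_def by blast
    moreover have "insert (S ! n) (set (take n S)) = set S" using arg_cong[OF Seq, of set] by simp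
    ultimately show ?thesis
      using eq young_set_path[OF S'] card_set_path[OF S'] by (simp add: young_diagrams_eq)
  qed
  moreover have "\<Lambda> 0 = {}" using L(1)[of 0] by (simp add: growth_cylinder_def)
  ultimately show "\<Lambda> \<in> exhausting_paths" using L(2) by (simp add: exhausting_paths_def)
qed

lemma exhausting_paths_sets: "exhausting_paths \<in> sets plancherel_growth"
proof -
  have eq: "exhausting_paths = space plancherel_growth \<inter> (\<Inter>n. \<Union>S\<in>paths n. growth_cylinder S) \<inter>
      (\<Inter>b\<in>boxes. \<Union>n. {\<Lambda> \<in> space plancherel_growth. b \<in> \<Lambda> n})"
    unfolding exhausting_paths_eq by auto
  have paths: "(\<Inter>n. \<Union>S\<in>paths n. growth_cylinder S) \<in> sets plancherel_growth"
    using emeasure_growth_cylinders(1)[OF order_refl] by (intro sets.countable_INT') auto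
  have exhaust: "(\<Inter>b\<in>boxes. \<Union>n. {\<Lambda> \<in> space plancherel_growth. b \<in> \<Lambda> n}) \<in> sets plancherel_growth"
  proof (rule sets.countable_INT')
    show "countable boxes" "boxes \<noteq> {}" by (auto simp: boxes_def)
    show "(\<lambda>b. \<Union>n. {\<Lambda> \<in> space plancherel_growth. b \<in> \<Lambda> n}) ` boxes \<subseteq> sets plancherel_growth"
      using sets_growth_box by (intro image_subsetI sets.countable_UN) auto
  qed
  show ?thesis unfolding eq by (intro sets.Int sets.top paths exhaust)
qed

lemma AE_exhausting_paths: "AE \<Lambda> in plancherel_growth. \<Lambda> \<in> exhausting_paths"
proof -
  have "countable boxes" by (simp add: boxes_def)
  then have "AE \<Lambda> in plancherel_growth. \<forall>b\<in>boxes. \<exists>n. b \<in> \<Lambda> n"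
    using AE_growth_reaches_box by (subst AE_ball_countable) auto
  then show ?thesis
    using AE_growth_cylinders AE_space by eventually_elim (simp add: exhausting_paths_eq)
qed

section \<open>Cylinders of infinite tableaux\<close>

text \<open>
  Here \<open>g k\<close> is the box that is added at time \<open>k + 1\<close>.
\<close>

lemma recording_tableau_exhausting:
  assumes L: "\<Lambda> \<in> exhausting_paths"
  shows "recording_tableau \<Lambda> \<in> infinite_tableaux"
    and "S \<in> paths n \<Longrightarrow> path_of boxes (recording_tableau \<Lambda>) n = S \<longleftrightarrow> \<Lambda> \<in> growth_cylinder S"
proof -
  have L: "\<Lambda> 0 = {}" "\<And>n. \<Lambda> n \<in> young_diagrams n" "\<And>n. \<Lambda> n \<nearrow> \<Lambda> (Suc n)" "\<And>b. b \<in> boxes \<Longrightarrow> \<exists>n. b \<in> \<Lambda> n"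
    using assms by (auto simp: exhausting_paths_def)
  have sp: "\<Lambda> \<in> space (PiM UNIV diagram_space)" using L(2) by (simp add: space_PiM PiE_iff)
  have "\<exists>g. \<forall>k. g k \<notin> \<Lambda> k \<and> \<Lambda> (Suc k) = insert (g k) (\<Lambda> k)"
    using L(3) unfolding adds_box_def by (intro choice) blast
  then obtain g where g: "\<And>k. g k \<notin> \<Lambda> k" "\<And>k. \<Lambda> (Suc k) = insert (g k) (\<Lambda> k)" by blast
  have Lg: "\<Lambda> k = g ` {..<k}" for k by (induction k) (simp_all add: L(1) g(2) lessThan_Suc)
  have gb: "g k \<in> boxes" for k
    using young_subset[of "\<Lambda> (Suc k)"] L(2)[of "Suc k"] g(2)[of k] by (auto simp: young_diagrams_eq)
  let ?t = "recording_tableau \<Lambda>"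
  have tg: "?t (g k) = Suc k" for k
  proof -
    have "(LEAST n. g k \<in> \<Lambda> n) = Suc k"
    proof (rule Least_equality)
      show "g k \<in> \<Lambda> (Suc k)" by (simp add: g(2))
      show "Suc k \<le> n" if "g k \<in> \<Lambda> n" for n
      proof (rule ccontr)
        assume "\<not> Suc k \<le> n"
        then have "\<Lambda> n \<subseteq> \<Lambda> k" unfolding Lg by (intro image_mono) auto
        then show False using that g(1)[of k] by blast
      qed
    qed
    then show ?thesis using gb by (simp add: recording_tableau_def)
  qed
  have surj: "boxes \<subseteq> range g" using L(4) Lg by blast
  have young: "young (g ` {..<k})" for k using L(2)[of k] by (simp add: Lg young_diagrams_eq)
  have ext: "?t \<in> extensional boxes" by (simp add: recording_tableau_def)
  show "?t \<in> infinite_tableaux" by (rule infinite_tableauI(1)[OF ext gb tg surj young])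
  have path: "path_of boxes ?t n = map g [0..<n]" for n
    by (rule infinite_tableauI(2)[OF ext gb tg surj young])
  assume S: "S \<in> paths n"
  show "path_of boxes ?t n = S \<longleftrightarrow> \<Lambda> \<in> growth_cylinder S"
  proof
    assume "path_of boxes ?t n = S"
    then have "S = map g [0..<n]" using path by simp
    then have "\<Lambda> k = set (take k S)" if "k \<le> n" for k
      using that Lg by (simp add: take_map atLeast0LessThan)
    then show "\<Lambda> \<in> growth_cylinder S" using S sp by (simp add: growth_cylinder_def paths_length)
  next
    assume "\<Lambda> \<in> growth_cylinder S"
    moreover have p: "path_of boxes ?t n \<in> paths n" by (rule path_of_tableau) fact
    moreover have "\<Lambda> \<in> growth_cylinder (path_of boxes ?t n)"
      using sp Lg unfolding path by (simp add: growth_cylinder_def take_map atLeast0LessThan)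
    ultimately show "path_of boxes ?t n = S"
      using disjoint_growth_cylinders[OF p S] by blast
  qed
qed

definition cylinder :: "box list \<Rightarrow> (box \<Rightarrow> nat) set" where
  "cylinder S = {t \<in> infinite_tableaux. path_of boxes t (length S) = S}"

lemma space_tableau_space [simp]: "space tableau_space = infinite_tableaux"
  unfolding tableau_space_def by (rule space_measure_of) auto

lemma sets_tableau_space:
  "sets tableau_space = sigma_sets infinite_tableaux {{t \<in> infinite_tableaux. t b \<in> A} | b A. b \<in> boxes}"
  unfolding tableau_space_def by (rule sets_measure_of) auto

lemma box_event_cylinders:
  assumes "b \<in> boxes"
  shows "{t \<in> infinite_tableaux. t b \<in> A} =
     (\<Union>n. \<Union>S\<in>{S \<in> paths (Suc n). Suc n \<in> A \<and> S ! n = b}. cylinder S)"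
proof (intro equalityI subsetI)
  fix t assume "t \<in> {t \<in> infinite_tableaux. t b \<in> A}"
  then have t: "t \<in> infinite_tableaux" "t b \<in> A" by auto
  have "t b \<in> {1..}" using infinite_tableauD(2)[OF t(1)] assms by blast
  then obtain n where n: "t b = Suc n" by (cases "t b") auto
  let ?S = "path_of boxes t (Suc n)"
  have "inv_into boxes t (t b) = b" using infinite_tableauD(1)[OF t(1)] assms by simp
  then have "?S ! n = b" using n by (simp add: nth_path_of)
  then have "?S \<in> {S \<in> paths (Suc n). Suc n \<in> A \<and> S ! n = b}"
    using path_of_tableau[OF t(1)] t(2) n by simp
  moreover have "t \<in> cylinder ?S" using t(1) by (simp add: cylinder_def)
  ultimately show "t \<in> (\<Union>n. \<Union>S\<in>{S \<in> paths (Suc n). Suc n \<in> A \<and> S ! n = b}. cylinder S)" by blast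
next
  fix t assume "t \<in> (\<Union>n. \<Union>S\<in>{S \<in> paths (Suc n). Suc n \<in> A \<and> S ! n = b}. cylinder S)"
  then obtain n S where S: "S \<in> paths (Suc n)" "Suc n \<in> A" "S ! n = b" "t \<in> cylinder S" by blast
  then have t: "t \<in> infinite_tableaux" "path_of boxes t (Suc n) = S" by (auto simp: cylinder_def paths_length)
  then have "b = inv_into boxes t (Suc n)" using S(3) nth_path_of[of n "Suc n" boxes t] by simp
  moreover have "Suc n \<in> t ` boxes" using infinite_tableauD(2)[OF t(1)] by simp
  ultimately have "t b = Suc n" by (simp add: f_inv_into_f)
  then show "t \<in> {t \<in> infinite_tableaux. t b \<in> A}" using t S(2) by simp
qed

text \<open>
  The empty set is included to make the family stable under intersection.
\<close>

definition cylinders :: "(box \<Rightarrow> nat) set set" where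
  "cylinders = insert {} (\<Union>n. cylinder ` paths n)"

lemma cylinder_subset: "cylinder S \<subseteq> infinite_tableaux"
  by (auto simp: cylinder_def)

lemma cylinders_Pow: "cylinders \<subseteq> Pow infinite_tableaux"
  using cylinder_subset by (auto simp: cylinders_def)

lemma countable_paths: "countable (paths n)"
  by (simp add: countable_finite)

lemma sets_tableau_space_cylinders: "sets tableau_space = sigma_sets infinite_tableaux cylinders"
proof
  show "sets tableau_space \<subseteq> sigma_sets infinite_tableaux cylinders"
    unfolding sets_tableau_space
  proof (rule sigma_sets_mono, safe)
    fix b A assume b: "b \<in> boxes"
    interpret sigma_algebra infinite_tableaux "sigma_sets infinite_tableaux cylinders"
      by (rule sigma_algebra_sigma_sets[OF cylinders_Pow])
    have "cylinder S \<in> sigma_sets infinite_tableaux cylinders" if "S \<in> paths (Suc n)" for S n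
      using that by (intro sigma_sets.Basic) (auto simp: cylinders_def)
    then show "{t \<in> infinite_tableaux. t b \<in> A} \<in> sigma_sets infinite_tableaux cylinders"
      unfolding box_event_cylinders[OF b]
      by (intro countable_UN countable_UN') (auto intro!: countable_subset[OF _ countable_paths])
  qed
  show "sigma_sets infinite_tableaux cylinders \<subseteq> sets tableau_space"
  proof -
    have "cylinder S \<in> sets tableau_space" if S: "S \<in> paths n" for S n
    proof -
      have Sb: "S ! k \<in> boxes" if "k < n" for k
        using young_subset[OF young_set_path[OF S]] nth_mem[of k S] that S by (auto simp: paths_length)
      have "cylinder S = infinite_tableaux \<inter> (\<Inter>k\<in>{..<n}. {t \<in> infinite_tableaux. t (S ! k) \<in> {Suc k}})"
      proof (intro equalityI subsetI)
        fix t assume t: "t \<in> cylinder S"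
        then have t': "t \<in> infinite_tableaux" "path_of boxes t n = S"
          using S by (auto simp: cylinder_def paths_length)
        have "t (S ! k) = Suc k" if "k < n" for k
          using that infinite_tableauD(2)[OF t'(1)] by (simp add: t'(2)[symmetric] nth_path_of f_inv_into_f)
        then show "t \<in> infinite_tableaux \<inter> (\<Inter>k\<in>{..<n}. {t \<in> infinite_tableaux. t (S ! k) \<in> {Suc k}})"
          using t' by simp
      next
        fix t assume "t \<in> infinite_tableaux \<inter> (\<Inter>k\<in>{..<n}. {t \<in> infinite_tableaux. t (S ! k) \<in> {Suc k}})"
        then have t: "t \<in> infinite_tableaux" "\<And>k. k < n \<Longrightarrow> t (S ! k) = Suc k" by auto
        have "path_of boxes t n = S"
          using S t Sb
          by (intro nth_equalityI) (auto simp: paths_length nth_path_of intro!: inv_into_f_eq infinite_tableauD(1))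
        then show "t \<in> cylinder S" using t S by (simp add: cylinder_def paths_length)
      qed
      moreover have "{t \<in> infinite_tableaux. t (S ! k) \<in> {Suc k}} \<in> sets tableau_space" if "k < n" for k
        unfolding sets_tableau_space using Sb[OF that] by (intro sigma_sets.Basic) blast
      moreover have "infinite_tableaux \<in> sets tableau_space" using sets.top[of tableau_space] by simp
      ultimately show ?thesis
        by (cases "n = 0") (auto intro!: sets.Int sets.finite_INT)
    qed
    then have "cylinders \<subseteq> sets tableau_space" by (auto simp: cylinders_def)
    then show ?thesis using sets.sigma_sets_subset[of cylinders tableau_space] by simp
  qed
qed

lemma cylinder_sets: "S \<in> paths n \<Longrightarrow> cylinder S \<in> sets tableau_space"
  unfolding sets_tableau_space_cylinders by (intro sigma_sets.Basic) (auto simp: cylinders_def)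

lemma disjoint_cylinders:
  "S \<in> paths n \<Longrightarrow> T \<in> paths n \<Longrightarrow> S \<noteq> T \<Longrightarrow> cylinder S \<inter> cylinder T = {}"
  by (auto simp: cylinder_def paths_length)

lemma cylinder_Int_cases:
  assumes "S \<in> paths m" "T \<in> paths n" "m \<le> n"
  shows "cylinder S \<inter> cylinder T \<in> {{}, cylinder T}"
proof -
  have "path_of boxes t m = take m T" if "t \<in> cylinder T" for t
    using that assms take_path_of[of m n boxes t] by (auto simp: cylinder_def paths_length)
  then show ?thesis using assms by (cases "take m T = S") (auto simp: cylinder_def paths_length)
qed

lemma Int_stable_cylinders: "Int_stable cylinders"
proof (rule Int_stableI)
  fix a b assume "a \<in> cylinders" "b \<in> cylinders"
  then consider "a = {} \<or> b = {}"
    | S m T n where "a = cylinder S" "b = cylinder T" "S \<in> paths m" "T \<in> paths n"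
    unfolding cylinders_def by blast
  then show "a \<inter> b \<in> cylinders"
  proof cases
    case 2
    then show ?thesis
      using cylinder_Int_cases[of S m T n] cylinder_Int_cases[of T n S m]
      unfolding cylinders_def by (cases "m \<le> n") (auto simp: Int_commute)
  qed (auto simp: cylinders_def)
qed

lemma cylinder_Nil: "cylinder [] = infinite_tableaux"
  by (auto simp: cylinder_def path_of_def)

lemma cylinder_measure_eqI:
  assumes "sets M = sets tableau_space" "sets N = sets tableau_space" "finite_measure M"
    and "\<And>S n. S \<in> paths n \<Longrightarrow> emeasure M (cylinder S) = emeasure N (cylinder S)"
  shows "M = N"
proof (rule measure_eqI_generator_eq[OF Int_stable_cylinders cylinders_Pow, where A = "\<lambda>_. infinite_tableaux"])
  show "emeasure M X = emeasure N X" if "X \<in> cylinders" for X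
    using that assms(4) by (auto simp: cylinders_def)
  have "cylinder [] \<in> cylinders" unfolding cylinders_def by (intro insertI2 UN_I[of 0]) auto
  then show "range (\<lambda>_. infinite_tableaux) \<subseteq> cylinders" by (simp add: cylinder_Nil)
  show "emeasure M infinite_tableaux \<noteq> \<infinity>" for i
    using finite_measure.emeasure_finite[OF assms(3)] by simp
qed (use assms sets_tableau_space_cylinders in auto)

lemma measurable_recording_tableau:
  "recording_tableau \<in> measurable (restrict_space plancherel_growth exhausting_paths) tableau_space"
  unfolding measurable_def
proof (intro CollectI conjI)
  let ?R = "restrict_space plancherel_growth exhausting_paths"
  have sp: "space ?R = exhausting_paths"
    using exhausting_paths_eq by (auto simp: space_restrict_space)
  show "recording_tableau \<in> space ?R \<rightarrow> space tableau_space"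
    using recording_tableau_exhausting(1) sp by auto
  then have into: "recording_tableau \<in> space ?R \<rightarrow> infinite_tableaux" by simp
  have "recording_tableau -` X \<inter> space ?R \<in> sets ?R" if X: "X \<in> cylinders" for X
  proof (cases "X = {}")
    case False
    then obtain S n where S: "S \<in> paths n" "X = cylinder S" using X by (auto simp: cylinders_def)
    have "recording_tableau -` X \<inter> space ?R = growth_cylinder S \<inter> exhausting_paths"
      using recording_tableau_exhausting(1) recording_tableau_exhausting(2)[of _ S n] S by (auto simp: sp cylinder_def paths_length)
    then show ?thesis
      using growth_cylinder_sets_emeasure(1)[OF S(1)] by (auto simp: sets_restrict_space)
  qed simp
  then have "recording_tableau \<in> measurable ?R tableau_space"
    using into by (intro measurable_sigma_sets[OF sets_tableau_space_cylinders cylinders_Pow])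
  then show "\<forall>y\<in>sets tableau_space. recording_tableau -` y \<inter> space ?R \<in> sets ?R"
    by (auto dest: measurable_sets)
qed

lemma space_plancherel_measure: "space plancherel_measure = infinite_tableaux"
  and sets_plancherel_measure: "sets plancherel_measure = sets tableau_space"
  by (simp_all add: plancherel_measure_def)

text \<open>
  The restriction to exhausting paths in the definition of the measure loses no mass, so cylinders
  keep the probabilities that they have for the growth process.
\<close>

lemma emeasure_plancherel_cylinder:
  assumes S: "S \<in> paths n"
  shows "emeasure plancherel_measure (cylinder S) = ennreal (weight S)"
proof -
  let ?R = "restrict_space plancherel_growth exhausting_paths"
  have sp: "space ?R = exhausting_paths"
    using exhausting_paths_eq by (auto simp: space_restrict_space)
  have "emeasure plancherel_measure (cylinder S) = emeasure ?R (recording_tableau -` cylinder S \<inter> space ?R)"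
    unfolding plancherel_measure_def
    by (rule emeasure_distr[OF measurable_recording_tableau cylinder_sets[OF S]])
  also have "recording_tableau -` cylinder S \<inter> space ?R = growth_cylinder S \<inter> exhausting_paths"
    using recording_tableau_exhausting(1) recording_tableau_exhausting(2)[of _ S n] S by (auto simp: sp cylinder_def paths_length)
  also have "emeasure ?R \<dots> = emeasure plancherel_growth (growth_cylinder S \<inter> exhausting_paths)"
    using exhausting_paths_sets by (intro emeasure_restrict_space) auto
  also have "\<dots> = emeasure plancherel_growth (growth_cylinder S)"
    using AE_exhausting_paths growth_cylinder_sets_emeasure(1)[OF S] exhausting_paths_sets
    by (intro emeasure_eq_AE) auto
  finally show ?thesis using growth_cylinder_sets_emeasure(2)[OF S] by simp
qed

lemma prob_space_plancherel_measure: "prob_space plancherel_measure"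
proof (rule prob_spaceI)
  show "emeasure plancherel_measure (space plancherel_measure) = 1"
    using emeasure_plancherel_cylinder[of "[]" 0] by (simp add: space_plancherel_measure cylinder_Nil)
qed

section \<open>Measure preservation and ergodicity\<close>

lemma jeu_de_taquin_pow_cylinder:
  assumes T: "T \<in> paths n"
  shows "(jeu_de_taquin ^^ m) -` cylinder T \<inter> infinite_tableaux =
    (\<Union>U\<in>{U \<in> paths (m + n). (promote ^^ m) U = T}. cylinder U)"
proof (intro equalityI subsetI)
  fix t assume "t \<in> (jeu_de_taquin ^^ m) -` cylinder T \<inter> infinite_tableaux"
  then have t: "t \<in> infinite_tableaux" "path_of boxes ((jeu_de_taquin ^^ m) t) n = T"
    using T by (auto simp: cylinder_def paths_length)
  then have "path_of boxes t (m + n) \<in> {U \<in> paths (m + n). (promote ^^ m) U = T}"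
    using path_of_tableau[OF t(1)] jeu_de_taquin_pow(2)[OF t(1)] by simp
  moreover have "t \<in> cylinder (path_of boxes t (m + n))" using t(1) by (simp add: cylinder_def)
  ultimately show "t \<in> (\<Union>U\<in>{U \<in> paths (m + n). (promote ^^ m) U = T}. cylinder U)" by blast
next
  fix t assume "t \<in> (\<Union>U\<in>{U \<in> paths (m + n). (promote ^^ m) U = T}. cylinder U)"
  then obtain U where U: "U \<in> paths (m + n)" "(promote ^^ m) U = T" "t \<in> cylinder U" by blast
  then have t: "t \<in> infinite_tableaux" "path_of boxes t (m + n) = U" by (auto simp: cylinder_def paths_length)
  then show "t \<in> (jeu_de_taquin ^^ m) -` cylinder T \<inter> infinite_tableaux"
    using U T jeu_de_taquin_pow[OF t(1), of m] by (simp add: cylinder_def paths_length)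
qed

lemma measurable_jeu_de_taquin_pow: "jeu_de_taquin ^^ m \<in> measurable tableau_space tableau_space"
proof (rule measurable_sigma_sets[OF sets_tableau_space_cylinders cylinders_Pow])
  show "jeu_de_taquin ^^ m \<in> space tableau_space \<rightarrow> infinite_tableaux"
    using jeu_de_taquin_pow(1) by auto
  fix X assume X: "X \<in> cylinders"
  show "(jeu_de_taquin ^^ m) -` X \<inter> space tableau_space \<in> sets tableau_space"
  proof (cases "X = {}")
    case False
    then obtain T n where T: "T \<in> paths n" "X = cylinder T" using X by (auto simp: cylinders_def)
    have "finite {U \<in> paths (m + n). (promote ^^ m) U = T}" by simp
    then show ?thesis
      using jeu_de_taquin_pow_cylinder[OF T(1), of m] cylinder_sets
      by (auto simp: T(2) intro!: sets.finite_UN)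
  qed simp
qed

lemma emeasure_cylinder_Int_vimage_cylinder:
  assumes S: "S \<in> paths m" and T: "T \<in> paths n"
  shows "emeasure plancherel_measure (cylinder S \<inter> ((jeu_de_taquin ^^ m) -` cylinder T \<inter> infinite_tableaux)) =
    ennreal (weight S * weight T)"
proof -
  have "cylinder S \<inter> ((jeu_de_taquin ^^ m) -` cylinder T \<inter> infinite_tableaux) =
      (\<Union>U\<in>products S T. cylinder U)"
  proof -
    have "cylinder S \<inter> cylinder U = (if take m U = S then cylinder U else {})" if "U \<in> paths (m + n)" for U
      using that S take_path_of[of m "m + n" boxes] by (auto simp: cylinder_def paths_length)
    moreover have "products S T = {U \<in> {U \<in> paths (m + n). (promote ^^ m) U = T}. take m U = S}"
      using S T by (auto simp: products_def paths_length)
    ultimately show ?thesis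
      unfolding jeu_de_taquin_pow_cylinder[OF T] Int_UN_distrib by auto
  qed
  also have "emeasure plancherel_measure (\<Union>U\<in>products S T. cylinder U) =
      (\<Sum>U\<in>products S T. emeasure plancherel_measure (cylinder U))"
  proof (rule sum_emeasure[symmetric])
    have sub: "products S T \<subseteq> paths (m + n)" using products_subset[of S T] S T by (simp add: paths_length)
    show "cylinder ` products S T \<subseteq> sets plancherel_measure"
      using sub cylinder_sets sets_plancherel_measure by blast
    show "disjoint_family_on cylinder (products S T)"
      unfolding disjoint_family_on_def using sub disjoint_cylinders by blast
  qed simp
  also have "\<dots> = (\<Sum>U\<in>products S T. ennreal (weight U))"
    using products_subset[of S T] emeasure_plancherel_cylinder by (intro sum.cong) auto
  also have "\<dots> = ennreal (\<Sum>U\<in>products S T. weight U)"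
    by (rule sum_ennreal) (rule weight_nonneg)
  also have "(\<Sum>U\<in>products S T. weight U) = weight S * weight T"
    by (rule sum_weight_products[OF S T])
  finally show ?thesis .
qed

text \<open>
  The \<open>m\<close>-th iterate of the jeu de taquin map is independent of the first \<open>m\<close> boxes of the tableau
  and has the Plancherel measure as its law.  On cylinders this is \<open>sum_weight_products\<close>; both sides
  are finite measures in \<open>A\<close>.
\<close>

lemma emeasure_cylinder_Int_vimage:
  assumes S: "S \<in> paths m" and A: "A \<in> sets tableau_space"
  shows "emeasure plancherel_measure (cylinder S \<inter> ((jeu_de_taquin ^^ m) -` A \<inter> infinite_tableaux)) =
    emeasure plancherel_measure (cylinder S) * emeasure plancherel_measure A"
proof -
  interpret prob_space plancherel_measure by (rule prob_space_plancherel_measure)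
  let ?P = plancherel_measure
  let ?M = "distr (restrict_space ?P (cylinder S)) tableau_space (jeu_de_taquin ^^ m)"
  let ?N = "scale_measure (emeasure ?P (cylinder S)) ?P"
  have S': "cylinder S \<in> sets ?P" using cylinder_sets[OF S] by (simp add: sets_plancherel_measure)
  have J: "jeu_de_taquin ^^ m \<in> measurable (restrict_space ?P (cylinder S)) tableau_space"
    using measurable_jeu_de_taquin_pow
    by (intro measurable_restrict_space1) (simp add: measurable_cong_sets[OF sets_plancherel_measure refl])
  have M: "emeasure ?M B = emeasure ?P (cylinder S \<inter> ((jeu_de_taquin ^^ m) -` B \<inter> infinite_tableaux))"
    if B: "B \<in> sets tableau_space" for B
  proof -
    have "emeasure ?M B = emeasure (restrict_space ?P (cylinder S))
        ((jeu_de_taquin ^^ m) -` B \<inter> space (restrict_space ?P (cylinder S)))"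
      by (rule emeasure_distr[OF J B])
    also have "(jeu_de_taquin ^^ m) -` B \<inter> space (restrict_space ?P (cylinder S)) =
        cylinder S \<inter> ((jeu_de_taquin ^^ m) -` B \<inter> infinite_tableaux)"
      by (auto simp: space_restrict_space space_plancherel_measure)
    also have "emeasure (restrict_space ?P (cylinder S)) \<dots> = emeasure ?P \<dots>"
      using S' by (intro emeasure_restrict_space) auto
    finally show ?thesis .
  qed
  have "?M = ?N"
  proof (rule cylinder_measure_eqI)
    show "finite_measure ?M"
    proof (rule finite_measureI)
      show "emeasure ?M (space ?M) \<noteq> \<infinity>"
        using M[OF sets.top] by simp
    qed
    show "emeasure ?M (cylinder T) = emeasure ?N (cylinder T)" if T: "T \<in> paths n" for T n
      using M[OF cylinder_sets[OF T]] emeasure_cylinder_Int_vimage_cylinder[OF S T]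
        emeasure_plancherel_cylinder[OF S] emeasure_plancherel_cylinder[OF T]
      by (simp add: ennreal_mult weight_nonneg)
  qed (simp_all add: sets_plancherel_measure)
  then show ?thesis using M[OF A] by simp
qed

theorem theorem1p3:
  shows "measure_preserving_system plancherel_measure jeu_de_taquin \<and>
         ergodic_system plancherel_measure jeu_de_taquin"
proof -
  interpret prob_space plancherel_measure by (rule prob_space_plancherel_measure)
  let ?P = plancherel_measure
  have J: "jeu_de_taquin ^^ m \<in> measurable ?P ?P" for m
    using measurable_jeu_de_taquin_pow
    by (simp add: measurable_cong_sets[OF sets_plancherel_measure sets_plancherel_measure])
  have preserving: "measure_preserving_system ?P jeu_de_taquin"
    unfolding measure_preserving_system_def
  proof (intro conjI ballI)
    show "prob_space ?P" by (rule prob_space_plancherel_measure)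
    show J1: "jeu_de_taquin \<in> measurable ?P ?P" using J[of 1] by simp
    fix A assume A: "A \<in> sets ?P"
    \<comment> \<open>Every tableau starts in the corner, so for one box the independence is invariance.\<close>
    have one: "[(1, 1)] \<in> paths (Suc 0)" by (simp add: paths_1)
    have full: "cylinder [(1, 1)] = infinite_tableaux"
    proof
      show "infinite_tableaux \<subseteq> cylinder [(1, 1)]"
        using path_of_tableau[of _ "Suc 0"] by (auto simp: cylinder_def paths_1)
    qed (rule cylinder_subset)
    then show "emeasure ?P (jeu_de_taquin -` A \<inter> space ?P) = emeasure ?P A"
      using emeasure_cylinder_Int_vimage[OF one, of A] A emeasure_space_1
      by (simp add: sets_plancherel_measure space_plancherel_measure Int_absorb2 Int_absorb1)
  qed
  have "emeasure ?P A = 0 \<or> emeasure ?P A = 1"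
    if A: "A \<in> sets ?P" and inv: "jeu_de_taquin -` A \<inter> space ?P = A" for A
  proof -
    have invm: "(jeu_de_taquin ^^ m) -` A \<inter> infinite_tableaux = A" for m
    proof (induction m)
      case 0
      then show ?case using inv by (auto simp: space_plancherel_measure)
    next
      case (Suc m)
      have "(jeu_de_taquin ^^ Suc m) -` A \<inter> infinite_tableaux =
          (jeu_de_taquin ^^ m) -` (jeu_de_taquin -` A \<inter> infinite_tableaux) \<inter> infinite_tableaux"
        using jeu_de_taquin_pow(1) by auto
      also have "jeu_de_taquin -` A \<inter> infinite_tableaux = A" using inv by (simp add: space_plancherel_measure)
      finally show ?case using Suc by simp
    qed
    \<comment> \<open>As A is its own preimage under every iterate, it is independent of every cylinder and
      therefore of every event, in particular of itself.\<close>
    have "density ?P (indicator A) = scale_measure (emeasure ?P A) ?P"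
    proof (rule cylinder_measure_eqI)
      have dens: "emeasure (density ?P (indicator A)) B = emeasure ?P (A \<inter> B)" if "B \<in> sets ?P" for B
        using A that by (rule emeasure_restricted)
      show "finite_measure (density ?P (indicator A))"
        by (rule finite_measureI) (use dens[of "space ?P"] in simp)
      fix S n assume S: "S \<in> paths n"
      show "emeasure (density ?P (indicator A)) (cylinder S) = emeasure (scale_measure (emeasure ?P A) ?P) (cylinder S)"
        using dens[of "cylinder S"] cylinder_sets[OF S] emeasure_cylinder_Int_vimage[OF S, of A] A invm[of n]
        by (simp add: sets_plancherel_measure Int_commute mult.commute)
    qed (simp_all add: sets_plancherel_measure)
    then have "emeasure (density ?P (indicator A)) A = emeasure ?P A * emeasure ?P A" by simp
    moreover have "emeasure (density ?P (indicator A)) A = emeasure ?P A"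
      using emeasure_restricted[OF A A] by simp
    ultimately have "prob A = prob A * prob A"
      by (simp add: emeasure_eq_measure ennreal_mult[symmetric])
    then show ?thesis by (auto simp: emeasure_eq_measure)
  qed
  then show ?thesis using preserving by (auto simp: ergodic_system_def)
qed

end
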